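(* Let $A\in\mathrm{GL}_n(\mathbb{C})$ and let $(f_t)_{t\in\mathbb{C}^k}\subset\hat G_A$ be a polynomial family $$f_t(z)=Az+\sum_{0\le|i|\le d_0}t^if_i(z),$$ where $i\in\mathbb{N}^k$ and the $f_i$ are ($n$-tuples of) formal power series in $z\in\mathbb{C}^n$ with no terms of order less than $2$. Let $(h_{t,s})_{(t,s)\in\mathbb{C}^k\times\mathbb{C}^{\delta(A)}}$ be the universal family of linearizations. We have the following dichotomy: 1) Up to finite order, all the formal linearizations $(h_{t,s})$ are converging, i.e. all $f_t$ are linearizable. More precisely, for any $m\ge2$ and any $(t,s_m)\in\mathbb{C}^k\times\mathbb{C}^{\delta(A,m)}$, there exists $s\in\mathbb{C}^{\delta(A)}$ with $s_m=\pi_m(s)$ and $h_{t,s}$ converging. 2) There is an exceptional set $E\subset\mathbb{C}^k$ of $\Gamma$-capacity $0$ such that for every $t\notin E$ all the formal linearizations $h_{t,s}$, $s\in\mathbb{C}^{\delta(A)}$, are diverging, i.e. all $f_t$, $t\notin E$, are non-linearizable.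
   Context: $\hat G$ is the group, under composition, of formal diffeomorphisms of $(\mathbb{C}^n,0)$ fixing $0$; $\hat G_0\subset\hat G$ is the subgroup of elements $h$ with $D_0h=I$; $\pi_m$ is truncation to the $m$-jet. The matrix $A$ is assumed in Jordan normal form. $\hat G_A=\{h^{-1}\circ A\circ h:h\in\hat G_0\}$ is the set of formal diffeomorphisms formally conjugated to $A$. For $f\in\hat G_A$, $\hat G_0(f)=\{h\in\hat G_0:h\circ f\circ h^{-1}=A\}$ is the set of formal linearizations of $f$; an element of $\hat G_0$ is converging if its power series converge in a neighborhood of $0$, diverging otherwise; $f$ is linearizable if some $h\in\hat G_0(f)$ is converging. Let $\mathrm{Cent}(A)=\{k\in\hat G_0:k\circ A=A\circ k\}$. Identifying jets in $\pi_m(\hat G_0)$ with the vector of their coefficients of order between $2$ and $m$, $\pi_m(\mathrm{Cent}(A))$ is a linear space of dimension denoted $\delta(A,m)$; $\delta(A)=\lim_m\delta(A,m)\in\mathbb{N}\cup\{+\infty\}$, and $\mathbb{C}^{\delta(A)}$ is the space of all complex sequences if $\delta(A)=+\infty$. Choosing bases compatible with truncation gives a linear isomorphism $\psi_{\infty,A}:\mathbb{C}^{\delta(A)}\to\mathrm{Cent}(A)$ such that the $m$-jet of $\psi_{\infty,A}(s)$ depends only on, and is parametrized bijectively by, the first $\delta(A,m)$ coordinates of $s$; this vector of coordinates is denoted $\pi_m(s)\in\mathbb{C}^{\delta(A,m)}$. There is a family $h_t\in\hat G_0(f_t)$, $t\in\mathbb{C}^k$, whose coefficients of order $m$ are polynomials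 in $t$ of degree at most $d_0m$; fixing one, the universal family is $h_{t,s}=\psi_{\infty,A}(s)\circ h_t$. For each $t$, $s\mapsto h_{t,s}$ is a bijection of $\mathbb{C}^{\delta(A)}$ onto $\hat G_0(f_t)$. $\Gamma$-capacity: let $\mathrm{Cap}$ be the logarithmic capacity of subsets of $\mathbb{C}$. For $E\subset\mathbb{C}^k$, $k\ge2$, $\Gamma_k^{k-1}(E)\subset\mathbb{C}^{k-1}$ is the set of $z\in\mathbb{C}^{k-1}$ such that the slice $\{w\in\mathbb{C}:(z,w)\in E\}$ has positive capacity. Put $\Gamma_k^1(E)=\Gamma_2^1\circ\Gamma_3^2\circ\cdots\circ\Gamma_k^{k-1}(E)\subset\mathbb{C}$ (and $\Gamma_1^1(E)=E$). The $\Gamma$-capacity of $E$ is $\sup_{U}\mathrm{Cap}\,\Gamma_k^1(U(E))$, the supremum being over all unitary transformations $U$ of $\mathbb{C}^k$. *)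

theory Defs
  imports
    "HOL-Analysis.Analysis"
    "HOL-Probability.Probability_Measure"
    "Jordan_Normal_Form.Jordan_Normal_Form"
begin

no_notation Matrix.vec_index (infixl "$" 100)

section \<open>Formal power series in several variables\<close>

text \<open>Variables are indexed by the finite type \<open>'n\<close>; a multi-index is an element of
  \<open>nat ^ 'n\<close>.\<close>

typedef (overloaded) ('a, 'n::finite) mfps = "UNIV :: (nat ^ 'n \<Rightarrow> 'a) set"
  morphisms mfps_nth Abs_mfps ..

setup_lifting type_definition_mfps

lemma finite_multi_index_sums:
  fixes a :: "nat ^ 'n::finite"
  shows "finite {(b, c). b + c = a}"
proof -
  have fin: "finite {b :: nat ^ 'n. \<forall>i. b $ i \<le> a $ i}"
  proof -
    have "{b :: nat ^ 'n. \<forall>i. b $ i \<le> a $ i} \<subseteq> vec_lambda ` (UNIV \<rightarrow>\<^sub>E {..(\<Sum>i\<in>UNIV. a $ i)})"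
    proof
      fix b :: "nat ^ 'n" assume "b \<in> {b. \<forall>i. b $ i \<le> a $ i}"
      then have "b $ i \<le> (\<Sum>i\<in>UNIV. a $ i)" for i
        by (metis (mono_tags, lifting) UNIV_I finite_class.finite_UNIV le_trans mem_Collect_eq
            member_le_sum zero_le)
      then have "vec_nth b \<in> UNIV \<rightarrow>\<^sub>E {..(\<Sum>i\<in>UNIV. a $ i)}" by auto
      moreover have "b = vec_lambda (vec_nth b)" by simp
      ultimately show "b \<in> vec_lambda ` (UNIV \<rightarrow>\<^sub>E {..(\<Sum>i\<in>UNIV. a $ i)})" by blast
    qed
    then show ?thesis
      by (rule finite_subset) (intro finite_imageI finite_PiE; simp)
  qed
  have "{(b, c). b + c = a} \<subseteq> {b. \<forall>i. b $ i \<le> a $ i} \<times> {b. \<forall>i. b $ i \<le> a $ i}"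
    by auto
  then show ?thesis
    by (rule finite_subset) (intro finite_cartesian_product fin)
qed

instantiation mfps :: (comm_ring_1, finite) comm_ring_1
begin

lift_definition zero_mfps :: "('a, 'b) mfps" is "\<lambda>_. 0" .
lift_definition one_mfps :: "('a, 'b) mfps" is "\<lambda>a. if a = 0 then 1 else 0" .
lift_definition plus_mfps :: "('a, 'b) mfps \<Rightarrow> ('a, 'b) mfps \<Rightarrow> ('a, 'b) mfps"
  is "\<lambda>f g a. f a + g a" .
lift_definition minus_mfps :: "('a, 'b) mfps \<Rightarrow> ('a, 'b) mfps \<Rightarrow> ('a, 'b) mfps"
  is "\<lambda>f g a. f a - g a" .
lift_definition uminus_mfps :: "('a, 'b) mfps \<Rightarrow> ('a, 'b) mfps" is "\<lambda>f a. - f a" .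
lift_definition times_mfps :: "('a, 'b) mfps \<Rightarrow> ('a, 'b) mfps \<Rightarrow> ('a, 'b) mfps"
  is "\<lambda>f g a. \<Sum>(b, c) | b + c = a. f b * g c" .

instance
proof
  fix f g h :: "('a, 'b) mfps"
  show "f + g + h = f + (g + h)" "f + g = g + f" "0 + f = f" "- f + f = 0" "f - g = f + - g"
    by (transfer; simp add: fun_eq_iff algebra_simps)+
  show "(0 :: ('a, 'b) mfps) \<noteq> 1"
    by transfer (auto simp: fun_eq_iff)
  show "(f + g) * h = f * h + g * h"
    by transfer (simp add: fun_eq_iff distrib_right sum.distrib case_prod_unfold)
  show "f * g = g * f"
  proof (transfer, rule ext)
    fix f g :: "nat ^ 'b \<Rightarrow> 'a" and a :: "nat ^ 'b"
    show "(\<Sum>(b, c) | b + c = a. f b * g c) = (\<Sum>(b, c) | b + c = a. g b * f c)"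
      by (rule sum.reindex_bij_witness[of _ prod.swap prod.swap])
        (auto simp: add.commute mult.commute)
  qed
  show "1 * f = f"
  proof (transfer, rule ext)
    fix f :: "nat ^ 'b \<Rightarrow> 'a" and a :: "nat ^ 'b"
    have "(\<Sum>(b, c) | b + c = a. (if b = 0 then 1 else 0) * f c)
        = (\<Sum>(b, c) \<in> {(0 :: nat ^ 'b, a)}. (if b = 0 then 1 else 0) * f c)"
      by (rule sum.mono_neutral_right) (auto simp: finite_multi_index_sums split: if_splits)
    then show "(\<Sum>(b, c) | b + c = a. (if b = 0 then 1 else 0) * f c) = f a" by simp
  qed
  show "f * g * h = f * (g * h)"
  proof (transfer, rule ext)
    fix f g h :: "nat ^ 'b \<Rightarrow> 'a" and a :: "nat ^ 'b"
    have "(\<Sum>(b, c) | b + c = a. (\<Sum>(d, e) | d + e = b. f d * g e) * h c)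
        = (\<Sum>p\<in>{(b, c). b + c = a}. \<Sum>q\<in>{(d, e). d + e = fst p}. f (fst q) * g (snd q) * h (snd p))"
      by (simp add: case_prod_unfold sum_distrib_right)
    also have "\<dots> = (\<Sum>(p, q)\<in>Sigma {(b, c). b + c = a} (\<lambda>p. {(d, e). d + e = fst p}).
        f (fst q) * g (snd q) * h (snd p))"
      by (rule sum.Sigma) (auto simp: finite_multi_index_sums)
    also have "\<dots> = (\<Sum>(p, q)\<in>Sigma {(b, c). b + c = a} (\<lambda>p. {(d, e). d + e = snd p}).
        f (fst p) * (g (fst q) * h (snd q)))"
      by (rule sum.reindex_bij_witness[of _
            "\<lambda>((d, x), (e, c)). ((d + e, c), (d, e))" "\<lambda>((b, c), (d, e)). ((d, e + c), (e, c))"])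
        (auto simp: algebra_simps)
    also have "\<dots> = (\<Sum>p\<in>{(b, c). b + c = a}. \<Sum>q\<in>{(d, e). d + e = snd p}.
        f (fst p) * (g (fst q) * h (snd q)))"
      by (rule sum.Sigma[symmetric]) (auto simp: finite_multi_index_sums)
    also have "\<dots> = (\<Sum>(b, c) | b + c = a. f b * (\<Sum>(d, e) | d + e = c. g d * h e))"
      by (simp add: case_prod_unfold sum_distrib_left)
    finally show "(\<Sum>(b, c) | b + c = a. (\<Sum>(d, e) | d + e = b. f d * g e) * h c)
        = (\<Sum>(b, c) | b + c = a. f b * (\<Sum>(d, e) | d + e = c. g d * h e))" .
  qed
qed

end

definition mfps_const :: "'a::zero \<Rightarrow> ('a, 'n::finite) mfps" where
  "mfps_const c = Abs_mfps (\<lambda>a. if a = 0 then c else 0)"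

definition mfps_var :: "'n \<Rightarrow> ('a::zero_neq_one, 'n::finite) mfps" where
  "mfps_var j = Abs_mfps (\<lambda>a. if a = axis j 1 then 1 else 0)"

definition mi_size :: "nat ^ 'n::finite \<Rightarrow> nat" where
  "mi_size a = (\<Sum>i\<in>UNIV. a $ i)"

text \<open>Substitution, meaningful when all \<open>G $ j\<close> have constant term \<open>0\<close>: then the terms
  with \<open>mi_size b > mi_size a\<close> do not contribute to the coefficient at \<open>a\<close>.\<close>

definition mfps_compose ::
  "('a::comm_ring_1, 'n::finite) mfps \<Rightarrow> ('a, 'n) mfps ^ 'n \<Rightarrow> ('a, 'n) mfps" where
  "mfps_compose f G = Abs_mfps (\<lambda>a. \<Sum>b | mi_size b \<le> mi_size a.
     mfps_nth f b * mfps_nth (\<Prod>j\<in>UNIV. (G $ j) ^ (b $ j)) a)"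


section \<open>Formal diffeomorphisms\<close>

type_synonym 'n fmap = "(complex, 'n) mfps ^ 'n"

definition fm_id :: "'n::finite fmap" where
  "fm_id = (\<chi> i. mfps_var i)"

definition fm_comp :: "'n::finite fmap \<Rightarrow> 'n fmap \<Rightarrow> 'n fmap" where
  "fm_comp F G = (\<chi> i. mfps_compose (F $ i) G)"

definition fm_scale :: "complex \<Rightarrow> 'n::finite fmap \<Rightarrow> 'n fmap" where
  "fm_scale c F = (\<chi> i. mfps_const c * F $ i)"

definition fm_linear :: "complex ^ 'n ^ 'n \<Rightarrow> 'n::finite fmap" where
  "fm_linear A = (\<chi> i. \<Sum>j\<in>UNIV. mfps_const (A $ i $ j) * mfps_var j)"

definition fm_deriv0 :: "'n::finite fmap \<Rightarrow> complex ^ 'n ^ 'n" where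
  "fm_deriv0 F = (\<chi> i j. mfps_nth (F $ i) (axis j 1))"

definition fm_jet :: "nat \<Rightarrow> 'n::finite fmap \<Rightarrow> 'n fmap" where
  "fm_jet m F = (\<chi> i. Abs_mfps (\<lambda>a. if mi_size a \<le> m then mfps_nth (F $ i) a else 0))"

definition fm_order_ge :: "nat \<Rightarrow> 'n::finite fmap \<Rightarrow> bool" where
  "fm_order_ge m F \<longleftrightarrow> (\<forall>i a. mi_size a < m \<longrightarrow> mfps_nth (F $ i) a = 0)"

definition G_hat :: "'n::finite fmap set" where
  "G_hat = {F. fm_order_ge 1 F \<and> invertible (fm_deriv0 F)}"

definition G_hat0 :: "'n::finite fmap set" where
  "G_hat0 = {h \<in> G_hat. fm_deriv0 h = Finite_Cartesian_Product.mat 1}"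

definition fm_inv :: "'n::finite fmap \<Rightarrow> 'n fmap" where
  "fm_inv h = (THE g. g \<in> G_hat \<and> fm_comp g h = fm_id \<and> fm_comp h g = fm_id)"

definition G_hat_conj :: "complex ^ 'n ^ 'n \<Rightarrow> 'n::finite fmap set" where
  "G_hat_conj A = {fm_comp (fm_inv h) (fm_comp (fm_linear A) h) | h. h \<in> G_hat0}"

definition formal_linearizations :: "complex ^ 'n ^ 'n \<Rightarrow> 'n::finite fmap \<Rightarrow> 'n fmap set" where
  "formal_linearizations A f = {h \<in> G_hat0. fm_comp h (fm_comp f (fm_inv h)) = fm_linear A}"

definition converging :: "'n::finite fmap \<Rightarrow> bool" where
  "converging F \<longleftrightarrow> (\<forall>\<^sub>F z in nhds (0 :: complex ^ 'n). \<forall>i.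
     (\<lambda>a. mfps_nth (F $ i) a * (\<Prod>j\<in>UNIV. (z $ j) ^ (a $ j))) summable_on UNIV)"

abbreviation diverging :: "'n::finite fmap \<Rightarrow> bool" where
  "diverging F \<equiv> \<not> converging F"

definition linearizable :: "complex ^ 'n ^ 'n \<Rightarrow> 'n::finite fmap \<Rightarrow> bool" where
  "linearizable A f \<longleftrightarrow> (\<exists>h \<in> formal_linearizations A f. converging h)"

text \<open>The coordinates, indexed by the unordered type \<open>'n\<close>, have to be enumerated before
  \<open>A\<close> can be compared with a block diagonal matrix of Jordan blocks. As the enumeration \<open>e\<close> may be
  reversed, it does not matter whether the off-diagonal ones stand above or below the diagonal.\<close>

definition in_jordan_normal_form :: "complex ^ 'n ^ 'n \<Rightarrow> bool" where
  "in_jordan_normal_form (A :: complex ^ 'n::finite ^ 'n) \<longleftrightarrow>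
     (\<exists>e n_as. bij_betw e (UNIV :: 'n set) {..<CARD('n)} \<and>
        0 \<notin> fst ` set n_as \<and> sum_list (map fst n_as) = CARD('n) \<and>
        (\<forall>i j. A $ i $ j = jordan_matrix n_as $$ (e i, e j)))"


section \<open>The centralizer and the universal family of linearizations\<close>

definition Cent :: "complex ^ 'n ^ 'n \<Rightarrow> 'n::finite fmap set" where
  "Cent A = {k \<in> G_hat0. fm_comp k (fm_linear A) = fm_comp (fm_linear A) k}"

lemma mfps_nth_const_mult: "mfps_nth (mfps_const c * f) a = c * mfps_nth f a"
  for c :: "'a::comm_ring_1" and f :: "('a, 'b::finite) mfps"
proof -
  have "mfps_nth (mfps_const c * f) a
      = (\<Sum>(b, d) | b + d = a. (if b = 0 then c else 0) * mfps_nth f d)"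
    by (simp add: times_mfps.rep_eq mfps_const_def Abs_mfps_inverse)
  also have "\<dots> = (\<Sum>(b, d) \<in> {(0 :: nat ^ 'b, a)}. (if b = 0 then c else 0) * mfps_nth f d)"
    by (rule sum.mono_neutral_right) (auto simp: finite_multi_index_sums split: if_splits)
  finally show ?thesis by simp
qed

interpretation fmap: vector_space "fm_scale :: complex \<Rightarrow> 'n::finite fmap \<Rightarrow> 'n fmap"
proof
  fix c d :: complex and F G :: "'n fmap"
  have eqI: "F = G" if "\<And>i a. mfps_nth (F $ i) a = mfps_nth (G $ i) a" for F G :: "'n fmap"
    using that by (simp add: Finite_Cartesian_Product.vec_eq_iff mfps_nth_inject[symmetric] fun_eq_iff)
  have nth: "mfps_nth (fm_scale c F $ i) a = c * mfps_nth (F $ i) a" for c F i a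
    by (simp add: fm_scale_def mfps_nth_const_mult)
  show "fm_scale c (F + G) = fm_scale c F + fm_scale c G"
    "fm_scale (c + d) F = fm_scale c F + fm_scale d F"
    "fm_scale c (fm_scale d F) = fm_scale (c * d) F" "fm_scale 1 F = F"
    by (rule eqI; simp add: nth plus_mfps.rep_eq algebra_simps)+
qed

text \<open>An element of \<open>G_hat0\<close> has identity \<open>1\<close>-jet; subtracting \<open>fm_id\<close> retains precisely the
  coefficients of order at least \<open>2\<close>.\<close>

definition cent_dim_jet :: "complex ^ 'n ^ 'n \<Rightarrow> nat \<Rightarrow> nat" where
  "cent_dim_jet A m = fmap.dim ((\<lambda>k. fm_jet m (k - fm_id)) ` Cent (A :: complex ^ 'n::finite ^ 'n))"

definition cent_dim :: "complex ^ 'n ^ 'n \<Rightarrow> enat" where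
  "cent_dim (A :: complex ^ 'n::finite ^ 'n) = lim (\<lambda>m. enat (cent_dim_jet A m))"

text \<open>The space \<open>\<complex>\<^sup>d\<close>, for \<open>d \<in> \<nat> \<union> {\<infinity>}\<close>: sequences whose coordinates
  \<open>0, \<dots>, d - 1\<close> are arbitrary and whose other entries vanish.\<close>

definition cspace :: "enat \<Rightarrow> (nat \<Rightarrow> complex) set" where
  "cspace d = {s. \<forall>i. d \<le> enat i \<longrightarrow> s i = 0}"

definition first_coords :: "nat \<Rightarrow> (nat \<Rightarrow> complex) \<Rightarrow> nat \<Rightarrow> complex" where
  "first_coords d s = (\<lambda>i. if i < d then s i else 0)"

text \<open>Truncation-compatible linear parametrizations \<open>\<psi>\<close> of \<open>Cent A\<close> by \<open>\<complex>\<^bsup>\<delta>(A)\<^esup>\<close>.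
  The linear structure on \<open>Cent A\<close> is that of the coefficients of order at least \<open>2\<close>.\<close>

definition cent_param :: "complex ^ 'n ^ 'n \<Rightarrow> ((nat \<Rightarrow> complex) \<Rightarrow> 'n::finite fmap) \<Rightarrow> bool" where
  "cent_param A \<psi> \<longleftrightarrow>
     bij_betw \<psi> (cspace (cent_dim A)) (Cent A) \<and>
     (\<forall>c. \<forall>s \<in> cspace (cent_dim A). \<forall>s' \<in> cspace (cent_dim A).
        \<psi> (\<lambda>i. c * s i + s' i) - fm_id = fm_scale c (\<psi> s - fm_id) + (\<psi> s' - fm_id)) \<and>
     (\<forall>m. \<forall>s \<in> cspace (cent_dim A). \<forall>s' \<in> cspace (cent_dim A).
        fm_jet m (\<psi> s) = fm_jet m (\<psi> s') \<longleftrightarrow>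
        first_coords (cent_dim_jet A m) s = first_coords (cent_dim_jet A m) s')"

definition exponents :: "nat \<Rightarrow> nat \<Rightarrow> (nat \<Rightarrow> nat) set" where
  "exponents k d = {i. (\<forall>j\<ge>k. i j = 0) \<and> (\<Sum>j<k. i j) \<le> d}"

lemma finite_exponents: "finite (exponents k d)"
proof -
  have "i j \<le> d" if "i \<in> exponents k d" for i j
  proof (cases "j < k")
    case True
    then have "i j \<le> (\<Sum>j<k. i j)" by (intro member_le_sum) auto
    with that show ?thesis by (simp add: exponents_def)
  qed (use that in \<open>simp add: exponents_def\<close>)
  then have "exponents k d \<subseteq> {i. \<forall>j. (j \<in> {..<k} \<longrightarrow> i j \<in> {..d}) \<and> (j \<notin> {..<k} \<longrightarrow> i j = 0)}"
    by (auto simp: exponents_def)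
  then show ?thesis
    by (rule finite_subset) (rule finite_set_of_finite_funs; simp)
qed

definition monomial :: "nat \<Rightarrow> (nat \<Rightarrow> nat) \<Rightarrow> (nat \<Rightarrow> complex) \<Rightarrow> complex" where
  "monomial k i t = (\<Prod>j<k. t j ^ i j)"

definition polynomial_le :: "nat \<Rightarrow> nat \<Rightarrow> ((nat \<Rightarrow> complex) \<Rightarrow> complex) \<Rightarrow> bool" where
  "polynomial_le k d p \<longleftrightarrow>
     (\<exists>c. \<forall>t \<in> cspace (enat k). p t = (\<Sum>i\<in>exponents k d. c i * monomial k i t))"

definition polynomial_linearizations :: "complex ^ 'n ^ 'n \<Rightarrow> nat \<Rightarrow> nat \<Rightarrow>
    ((nat \<Rightarrow> complex) \<Rightarrow> 'n fmap) \<Rightarrow> ((nat \<Rightarrow> complex) \<Rightarrow> 'n::finite fmap) \<Rightarrow> bool" where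
  "polynomial_linearizations A k d0 f h \<longleftrightarrow>
     (\<forall>t \<in> cspace (enat k). h t \<in> formal_linearizations A (f t)) \<and>
     (\<forall>i a. polynomial_le k (d0 * mi_size a) (\<lambda>t. mfps_nth (h t $ i) a))"

definition universal_family :: "((nat \<Rightarrow> complex) \<Rightarrow> 'n fmap) \<Rightarrow> ((nat \<Rightarrow> complex) \<Rightarrow> 'n fmap) \<Rightarrow>
    (nat \<Rightarrow> complex) \<Rightarrow> (nat \<Rightarrow> complex) \<Rightarrow> 'n::finite fmap" where
  "universal_family \<psi> h t s = fm_comp (\<psi> s) (h t)"


section \<open>Logarithmic capacity and \<open>\<Gamma>\<close>-capacity\<close>

definition log_kernel :: "complex \<Rightarrow> complex \<Rightarrow> ereal" where
  "log_kernel z w = (if z = w then \<infinity> else ereal (- ln (dist z w)))"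

text \<open>The energy \<open>\<integral>\<integral> log (1 / |z - w|) d\<mu>(z) d\<mu>(w)\<close>, as the difference of the integrals of
  the positive and negative parts; the latter is finite if \<open>\<mu>\<close> has compact support.\<close>

definition log_energy :: "complex measure \<Rightarrow> ereal" where
  "log_energy \<mu> =
     enn2ereal (\<integral>\<^sup>+ z. \<integral>\<^sup>+ w. e2ennreal (log_kernel z w) \<partial>\<mu> \<partial>\<mu>) -
     enn2ereal (\<integral>\<^sup>+ z. \<integral>\<^sup>+ w. e2ennreal (- log_kernel z w) \<partial>\<mu> \<partial>\<mu>)"

definition log_capacity :: "complex set \<Rightarrow> ennreal" where
  "log_capacity E =
     (SUP \<mu> \<in> {\<mu>. prob_space \<mu> \<and> sets \<mu> = sets borel \<and>
                  (\<exists>K. compact K \<and> K \<subseteq> E \<and> emeasure \<mu> K = 1)}.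
        if log_energy \<mu> = \<infinity> then 0 else ennreal (exp (- real_of_ereal (log_energy \<mu>))))"

text \<open>\<open>Gamma_slice k\<close> maps subsets of \<open>\<complex>\<^bsup>k+1\<^esup>\<close> to subsets of \<open>\<complex>\<^sup>k\<close>; the point
  \<open>(z, w)\<close> is \<open>z(k := w)\<close>.\<close>

definition Gamma_slice :: "nat \<Rightarrow> (nat \<Rightarrow> complex) set \<Rightarrow> (nat \<Rightarrow> complex) set" where
  "Gamma_slice k E = {z \<in> cspace (enat k). log_capacity {w. z(k := w) \<in> E} > 0}"

text \<open>The value for \<open>k = 0\<close> is irrelevant.\<close>

fun Gamma_one :: "nat \<Rightarrow> (nat \<Rightarrow> complex) set \<Rightarrow> complex set" where
  "Gamma_one 0 E = {}"
| "Gamma_one (Suc 0) E = {w. (\<lambda>_. 0)(0 := w) \<in> E}"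
| "Gamma_one (Suc (Suc k)) E = Gamma_one (Suc k) (Gamma_slice (Suc k) E)"

definition unitary_matrix :: "nat \<Rightarrow> (nat \<Rightarrow> nat \<Rightarrow> complex) \<Rightarrow> bool" where
  "unitary_matrix k U \<longleftrightarrow>
     (\<forall>i<k. \<forall>j<k. (\<Sum>l<k. cnj (U l i) * U l j) = (if i = j then 1 else 0))"

definition apply_matrix :: "nat \<Rightarrow> (nat \<Rightarrow> nat \<Rightarrow> complex) \<Rightarrow> (nat \<Rightarrow> complex) \<Rightarrow> nat \<Rightarrow> complex" where
  "apply_matrix k U t = (\<lambda>i. if i < k then \<Sum>j<k. U i j * t j else 0)"

definition Gamma_capacity :: "nat \<Rightarrow> (nat \<Rightarrow> complex) set \<Rightarrow> ennreal" where
  "Gamma_capacity k E =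
     (SUP U \<in> {U. unitary_matrix k U}. log_capacity (Gamma_one k (apply_matrix k U ` E)))"

end

theory Submission
  imports Defs "HOL-Computational_Algebra.Fundamental_Theorem_Algebra"
begin

text \<open>
  If every \<open>f t\<close> is linearizable, an exceptional set can only be the whole of \<open>\<complex>\<^sup>k\<close>. This set has
  positive \<open>\<Gamma>\<close>-capacity, since the uniform distribution on an interval has finite logarithmic
  energy (\<open>Gamma_capacity_cspace\<close>). So the two alternatives exclude each other.

  For the converse, suppose that the set of all \<open>t\<close> with \<open>f t\<close> linearizable has positive
  \<open>\<Gamma>\<close>-capacity. For \<open>t\<close> in this set there are convergent linearizations, but nothing says that they
  depend polynomially on \<open>t\<close>. The remedy is to single out a canonical one. Consider
  the inverse \<open>g\<close> of a linearization, which satisfies \<open>f \<circ> g = g \<circ> A\<close>; the other solutions are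
  \<open>g \<circ> c\<close> with \<open>c\<close> in the centralizer of \<open>A\<close>. Let \<open>P\<close> project, degree by degree, onto the maps that
  commute with \<open>A\<close>. The normalization \<open>P (g \<circ> c) = id\<close> is equivalent to the fixed-point equation
  \<open>c = id - P ((g - id) \<circ> c)\<close>. It has a unique formal solution, so that the normalized solution
  depends on \<open>f\<close> only. Its coefficients of order \<open>m\<close> are polynomials in \<open>t\<close> of degree \<open>O(m)\<close> if
  those of \<open>g\<close> are (\<open>map_family_normalization\<close>). And it converges if \<open>g\<close> does
  (\<open>fixed_point_geometrically_bounded\<close>): the unknown \<open>c\<close> is substituted into the fixed convergent
  series \<open>g\<close>, which loses no derivatives, and \<open>P\<close> is a contraction if it is
  taken orthogonal for the Bombieri norm, which is submultiplicative. For a linearization \<open>h\<close> in place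
  of its inverse, the unknown would be the outer map of \<open>c \<circ> h\<close>, and the corresponding
  equation \<open>c = id - P (c \<circ> h - c)\<close> would lose derivatives. With \<open>P\<close> replaced by the identity, the same equation inverts convergent
  maps. Altogether \<open>f t\<close> is linearizable if and only if the coefficients of the normalized solution
  are bounded by \<open>N ^ m\<close> in order \<open>m\<close>, for some \<open>N\<close> (\<open>linearizable_iff_geometric_locus\<close>).

  What remains concerns polynomials only. A polynomial that is bounded by \<open>M\<close> on a compact set of
  positive capacity has coefficients bounded by \<open>M * C ^ degree\<close>
  (\<open>bernstein_inequality_positive_capacity\<close>). If a family of polynomials of degree \<open>O(m)\<close> in one
  variable satisfies bounds \<open>N ^ m\<close> at each point of a set of positive capacity, then for one \<open>N\<close>
  this happens on a set of positive capacity, and thus the coefficients are geometrically bounded too.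
  Eliminating one variable after the other, in the order in which the slices are taken in the definition of
  the \<open>\<Gamma>\<close>-capacity, one obtains geometric bounds at every point (\<open>geometric_locus_Gamma_capacity\<close>).
  Hence all \<open>f t\<close> are linearizable.

  Finally, truncations of elements of the centralizer lie in the centralizer. Composing a convergent
  linearization with such polynomial maps on the left, one reaches every jet
  (\<open>converging_linearization_with_prescribed_jet\<close>).
\<close>

section \<open>Composition of formal power series\<close>

(* Keeps the entry 1 of the multi-indices axis j 1 in the form in which the rules below match it. *)
declare One_nat_def [simp del]

(* The unqualified name vec_eq_iff belongs to the vectors of varying length. *)
lemmas cart_eq_iff = Finite_Cartesian_Product.vec_eq_iff

lemma mi_size_add [simp]: "mi_size (a + b) = mi_size a + mi_size b"
  by (simp add: mi_size_def sum.distrib)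

lemma mi_size_zero [simp]: "mi_size 0 = 0"
  by (simp add: mi_size_def)

lemma mi_size_eq_0_iff [simp]: "mi_size a = 0 \<longleftrightarrow> a = 0"
  by (auto simp: mi_size_def cart_eq_iff)

lemma mi_size_axis [simp]: "mi_size (axis j c) = c"
  by (simp add: mi_size_def axis_def)

lemma nth_le_mi_size: "a $ i \<le> mi_size a"
  unfolding mi_size_def by (rule member_le_sum) auto

lemma finite_mi_size_le [simp]: "finite {a :: nat ^ 'n::finite. mi_size a \<le> m}"
proof -
  have "{a :: nat ^ 'n. mi_size a \<le> m} \<subseteq> vec_lambda ` (UNIV \<rightarrow>\<^sub>E {..m})"
  proof
    fix a :: "nat ^ 'n" assume "a \<in> {a. mi_size a \<le> m}"
    then have "vec_nth a \<in> UNIV \<rightarrow>\<^sub>E {..m}"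
      using nth_le_mi_size[of a] by (auto intro: order.trans)
    moreover have "a = vec_lambda (vec_nth a)" by simp
    ultimately show "a \<in> vec_lambda ` (UNIV \<rightarrow>\<^sub>E {..m})" by blast
  qed
  then show ?thesis by (rule finite_subset) (intro finite_imageI finite_PiE; simp)
qed

lemma finite_mi_size_eq [simp]: "finite {a :: nat ^ 'n::finite. mi_size a = m}"
  by (rule finite_subset[OF _ finite_mi_size_le[of m]]) auto

lemma mi_decompose:
  assumes "a \<noteq> (0 :: nat ^ 'n::finite)"
  obtains b j where "a = b + axis j 1"
proof -
  obtain j where j: "a $ j \<noteq> 0" using assms by (auto simp: cart_eq_iff)
  have "a = (\<chi> i. if i = j then a $ i - 1 else a $ i) + axis j 1"
    using j by (auto simp: cart_eq_iff axis_def)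
  then show ?thesis by (rule that)
qed

lemma mi_induct [case_names zero add]:
  assumes "P 0" "\<And>b j. P b \<Longrightarrow> P (b + axis j 1)"
  shows "P (a :: nat ^ 'n::finite)"
proof (induction "mi_size a" arbitrary: a)
  case 0
  then show ?case using assms(1) by simp
next
  case (Suc m)
  then have "a \<noteq> 0" by auto
  then obtain b j where a: "a = b + axis j 1" by (rule mi_decompose)
  with Suc have "P b" by simp
  then show ?case using assms(2) a by simp
qed

lemma mfps_eqI: "(\<And>a. mfps_nth f a = mfps_nth g a) \<Longrightarrow> f = g"
  by (simp add: mfps_nth_inject[symmetric] fun_eq_iff)

lemma fmap_eqI: "(\<And>i a. mfps_nth (F $ i) a = mfps_nth (G $ i) a) \<Longrightarrow> F = G"
  for F G :: "'n::finite fmap"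
  by (simp add: cart_eq_iff mfps_eqI)

lemma nth_Abs_mfps [simp]: "mfps_nth (Abs_mfps f) a = f a"
  by (simp add: Abs_mfps_inverse)

lemmas mfps_nth_simps [simp] =
  zero_mfps.rep_eq one_mfps.rep_eq plus_mfps.rep_eq minus_mfps.rep_eq uminus_mfps.rep_eq

lemma mfps_nth_mult:
  "mfps_nth (f * g) a = (\<Sum>(b, c) | b + c = a. mfps_nth f b * mfps_nth g c)"
  by (simp add: times_mfps.rep_eq)

lemma mfps_nth_sum: "mfps_nth (\<Sum>x\<in>A. f x) a = (\<Sum>x\<in>A. mfps_nth (f x) a)"
  by (induction A rule: infinite_finite_induct) auto

lemma mfps_nth_const [simp]: "mfps_nth (mfps_const c) a = (if a = 0 then c else 0)"
  by (simp add: mfps_const_def)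

lemma mfps_nth_var [simp]: "mfps_nth (mfps_var j) a = (if a = axis j 1 then 1 else 0)"
  by (simp add: mfps_var_def)

lemma mfps_nth_mult_var_shift [simp]:
  "mfps_nth (f * mfps_var j) (a + axis j 1) = mfps_nth f a"
  for f :: "('a::comm_ring_1, 'n::finite) mfps"
proof -
  have "mfps_nth (f * mfps_var j) (a + axis j 1)
      = (\<Sum>(b, c)\<in>{(a, axis j 1)}. mfps_nth f b * mfps_nth (mfps_var j) c)"
    unfolding mfps_nth_mult
    by (rule sum.mono_neutral_right) (auto simp: finite_multi_index_sums split: if_splits)
  then show ?thesis by simp
qed

lemma mfps_nth_mult_var_eq_0:
  "a $ j = 0 \<Longrightarrow> mfps_nth (f * mfps_var j) a = 0"
  for f :: "('a::comm_ring_1, 'n::finite) mfps"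
  unfolding mfps_nth_mult by (rule sum.neutral) (auto simp: axis_def)

definition mfps_order_ge :: "nat \<Rightarrow> ('a::zero, 'n::finite) mfps \<Rightarrow> bool" where
  "mfps_order_ge p f \<longleftrightarrow> (\<forall>a. mi_size a < p \<longrightarrow> mfps_nth f a = 0)"

lemma fm_order_ge_iff: "fm_order_ge m F \<longleftrightarrow> (\<forall>i. mfps_order_ge m (F $ i))"
  by (auto simp: fm_order_ge_def mfps_order_ge_def)

lemma mfps_order_ge_mult:
  fixes f g :: "('a::comm_ring_1, 'n::finite) mfps"
  assumes "mfps_order_ge p f" "mfps_order_ge q g"
  shows "mfps_order_ge (p + q) (f * g)"
  unfolding mfps_order_ge_def mfps_nth_mult
proof (intro allI impI sum.neutral ballI, clarify)
  fix b c :: "nat ^ 'n" assume "mi_size (b + c) < p + q"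
  then have "mi_size b < p \<or> mi_size c < q" by auto
  then show "mfps_nth f b * mfps_nth g c = 0"
    using assms by (auto simp: mfps_order_ge_def)
qed

definition mpow :: "('a::comm_ring_1, 'n::finite) mfps ^ 'n \<Rightarrow> nat ^ 'n \<Rightarrow> ('a, 'n) mfps" where
  "mpow G b = (\<Prod>j\<in>UNIV. (G $ j) ^ (b $ j))"

lemma mpow_0 [simp]: "mpow G 0 = 1"
  by (simp add: mpow_def)

lemma mpow_add: "mpow G (b + c) = mpow G b * mpow G c"
  by (simp add: mpow_def power_add prod.distrib)

lemma mpow_axis [simp]: "mpow G (axis j 1) = G $ j"
proof -
  have "mpow G (axis j 1) = (\<Prod>i\<in>UNIV. if i = j then G $ i else 1)"
    unfolding mpow_def by (rule prod.cong) (auto simp: axis_def)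
  then show ?thesis by simp
qed

lemma mfps_order_ge_mpow:
  assumes "\<And>j. mfps_order_ge 1 (G $ j)"
  shows "mfps_order_ge (mi_size b) (mpow G b)"
proof (induction b rule: mi_induct)
  case zero
  show ?case by (simp add: mfps_order_ge_def)
next
  case (add b j)
  then show ?case using mfps_order_ge_mult[OF add assms[of j]] by (simp add: mpow_add)
qed

lemma mpow_nth_eq_0:
  assumes "\<And>j. mfps_order_ge 1 (G $ j)" "mi_size a < mi_size b"
  shows "mfps_nth (mpow G b) a = 0"
  using mfps_order_ge_mpow[of G b] assms by (auto simp: mfps_order_ge_def)

lemma nth_compose:
  assumes "\<And>j. mfps_order_ge 1 (G $ j)" "mi_size a \<le> M"
  shows "mfps_nth (mfps_compose f G) a
    = (\<Sum>b | mi_size b \<le> M. mfps_nth f b * mfps_nth (mpow G b) a)"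
  unfolding mfps_compose_def nth_Abs_mfps mpow_def[symmetric]
proof (rule sum.mono_neutral_left)
  show "\<forall>b\<in>{b. mi_size b \<le> M} - {b. mi_size b \<le> mi_size a}.
      mfps_nth f b * mfps_nth (mpow G b) a = 0"
    using mpow_nth_eq_0[OF assms(1)] by (simp add: not_le)
qed (use assms(2) in auto)

lemma nth_compose': 
  "mfps_nth (mfps_compose f G) a
    = (\<Sum>b | mi_size b \<le> mi_size a. mfps_nth f b * mfps_nth (mpow G b) a)"
  unfolding mfps_compose_def nth_Abs_mfps mpow_def[symmetric] ..

lemma compose_add: "mfps_compose (f + g) G = mfps_compose f G + mfps_compose g G"
  by (rule mfps_eqI) (simp add: nth_compose' distrib_right sum.distrib)

lemma compose_diff: "mfps_compose (f - g) G = mfps_compose f G - mfps_compose g G"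
  by (rule mfps_eqI) (simp add: nth_compose' left_diff_distrib sum_subtractf)

lemma compose_const: "mfps_compose (mfps_const c) G = mfps_const c"
proof (rule mfps_eqI)
  fix a
  have "mfps_nth (mfps_compose (mfps_const c) G) a
     = (\<Sum>b\<in>{0}. mfps_nth (mfps_const c) b * mfps_nth (mpow G b) a)"
    unfolding nth_compose' by (rule sum.mono_neutral_right) auto
  then show "mfps_nth (mfps_compose (mfps_const c) G) a = mfps_nth (mfps_const c) a"
    by simp
qed

lemma mfps_const_1: "mfps_const 1 = 1"
  by (rule mfps_eqI) simp

lemma compose_one: "mfps_compose 1 G = 1"
  using compose_const[of 1 G] by (simp add: mfps_const_1)

text \<open>On both sides only the products \<open>f\<^sub>c * g\<^sub>d\<close> with \<open>mi_size c + mi_size d \<le> mi_size a\<close>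
  contribute to the coefficient at \<open>a\<close>, as \<open>mpow G (c + d)\<close> has order at least \<open>mi_size (c + d)\<close>.
  Both sides can therefore be compared with the sum over a square of indices.\<close>

lemma compose_mult:
  fixes f g :: "('a::comm_ring_1, 'n::finite) mfps"
  assumes G: "\<And>j. mfps_order_ge 1 (G $ j)"
  shows "mfps_compose (f * g) G = mfps_compose f G * mfps_compose g G"
proof (rule mfps_eqI)
  fix a :: "nat ^ 'n"
  let ?m = "mi_size a"
  let ?S = "{b :: nat ^ 'n. mi_size b \<le> ?m}"
  let ?F = "\<lambda>c d. mfps_nth f c * mfps_nth g d * mfps_nth (mpow G (c + d)) a"
  have "mfps_nth (mfps_compose (f * g) G) a
      = (\<Sum>b\<in>?S. \<Sum>p\<in>{(c, d). c + d = b}. ?F (fst p) (snd p))"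
    unfolding nth_compose' mfps_nth_mult
    by (auto simp: sum_distrib_right case_prod_unfold intro!: sum.cong)
  also have "\<dots> = (\<Sum>(b, p)\<in>Sigma ?S (\<lambda>b. {(c, d). c + d = b}). ?F (fst p) (snd p))"
    by (rule sum.Sigma) (auto simp: finite_multi_index_sums)
  also have "\<dots> = (\<Sum>(c, d)\<in>{(c, d). mi_size c + mi_size d \<le> ?m}. ?F c d)"
    by (rule sum.reindex_bij_witness[of _ "\<lambda>(c, d). (c + d, (c, d))" snd]) auto
  also have "\<dots> = (\<Sum>(c, d)\<in>?S \<times> ?S. ?F c d)"
  proof (rule sum.mono_neutral_left)
    have "?F c d = 0" if "\<not> mi_size c + mi_size d \<le> ?m" for c d
      using mpow_nth_eq_0[OF G, of a "c + d"] that by simp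
    then show "\<forall>p\<in>?S \<times> ?S - {(c, d). mi_size c + mi_size d \<le> ?m}. (case p of (c, d) \<Rightarrow> ?F c d) = 0"
      by auto
  qed auto
  finally have L: "mfps_nth (mfps_compose (f * g) G) a = (\<Sum>(c, d)\<in>?S \<times> ?S. ?F c d)" .
  have "mfps_nth (mfps_compose f G * mfps_compose g G) a
     = (\<Sum>(x, y) | x + y = a. (\<Sum>c\<in>?S. mfps_nth f c * mfps_nth (mpow G c) x)
           * (\<Sum>d\<in>?S. mfps_nth g d * mfps_nth (mpow G d) y))"
    unfolding mfps_nth_mult
    by (rule sum.cong) (auto simp: nth_compose[OF G, of _ ?m])
  also have "\<dots> = (\<Sum>p | fst p + snd p = a. \<Sum>q\<in>?S \<times> ?S.
       mfps_nth f (fst q) * mfps_nth g (snd q) *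
         (mfps_nth (mpow G (fst q)) (fst p) * mfps_nth (mpow G (snd q)) (snd p)))"
    by (simp add: sum_product sum.cartesian_product case_prod_unfold mult_ac)
  also have "\<dots> = (\<Sum>q\<in>?S \<times> ?S. \<Sum>p | fst p + snd p = a.
       mfps_nth f (fst q) * mfps_nth g (snd q) *
         (mfps_nth (mpow G (fst q)) (fst p) * mfps_nth (mpow G (snd q)) (snd p)))"
    by (rule sum.swap)
  also have "\<dots> = (\<Sum>(c, d)\<in>?S \<times> ?S. ?F c d)"
    by (simp add: mpow_add mfps_nth_mult case_prod_unfold sum_distrib_left)
  finally show "mfps_nth (mfps_compose (f * g) G) a = mfps_nth (mfps_compose f G * mfps_compose g G) a"
    using L by simp
qed

lemma compose_sum: "mfps_compose (\<Sum>x\<in>A. f x) G = (\<Sum>x\<in>A. mfps_compose (f x) G)"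
proof -
  have "mfps_compose 0 G = 0" by (rule mfps_eqI) (simp add: nth_compose')
  then show ?thesis by (induction A rule: infinite_finite_induct) (auto simp: compose_add)
qed

lemma compose_var:
  assumes G: "\<And>j. mfps_order_ge 1 (G $ j)"
  shows "mfps_compose (mfps_var j) G = G $ j"
proof (rule mfps_eqI)
  fix a
  have "mfps_nth (mfps_compose (mfps_var j) G) a
     = (\<Sum>b\<in>{axis j 1}. mfps_nth (mfps_var j) b * mfps_nth (mpow G b) a)"
    unfolding nth_compose[OF G le_SucI[OF order_refl]]
    by (rule sum.mono_neutral_right) auto
  then show "mfps_nth (mfps_compose (mfps_var j) G) a = mfps_nth (G $ j) a" by simp
qed

lemma compose_mpow:
  assumes H: "\<And>j. mfps_order_ge 1 (H $ j)"
  shows "mfps_compose (mpow G b) H = mpow (\<chi> i. mfps_compose (G $ i) H) b"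
  by (induction b rule: mi_induct) (simp_all add: compose_one compose_mult[OF H] mpow_add)

lemma compose_order:
  assumes G: "\<And>j. mfps_order_ge 1 (G $ j)" and f: "mfps_order_ge p f"
  shows "mfps_order_ge p (mfps_compose f G)"
  using f by (auto simp: mfps_order_ge_def nth_compose')

text \<open>Substitution of \<open>H\<close> is a ring homomorphism and depends only on the coefficients of order at
  most \<open>mi_size a\<close> at \<open>a\<close>, so that it can be applied to \<open>mfps_compose f G\<close> term by term.\<close>

lemma compose_assoc:
  fixes f :: "('a::comm_ring_1, 'n::finite) mfps"
  assumes G: "\<And>j. mfps_order_ge 1 (G $ j)" and H: "\<And>j. mfps_order_ge 1 (H $ j)"
  shows "mfps_compose (mfps_compose f G) H = mfps_compose f (\<chi> i. mfps_compose (G $ i) H)"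
proof (rule mfps_eqI)
  fix a :: "nat ^ 'n"
  let ?S = "{b :: nat ^ 'n. mi_size b \<le> mi_size a}"
  have "mfps_nth (mfps_compose (mfps_compose f G) H) a
      = (\<Sum>c\<in>?S. (\<Sum>b\<in>?S. mfps_nth f b * mfps_nth (mpow G b) c) * mfps_nth (mpow H c) a)"
    unfolding nth_compose'[of _ H]
    by (rule sum.cong) (auto simp: nth_compose[OF G, of _ "mi_size a"])
  also have "\<dots> = (\<Sum>c\<in>?S. \<Sum>b\<in>?S. mfps_nth f b * (mfps_nth (mpow G b) c * mfps_nth (mpow H c) a))"
    by (simp add: sum_distrib_right mult.assoc)
  also have "\<dots> = (\<Sum>b\<in>?S. \<Sum>c\<in>?S. mfps_nth f b * (mfps_nth (mpow G b) c * mfps_nth (mpow H c) a))"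
    by (rule sum.swap)
  also have "\<dots> = (\<Sum>b\<in>?S. mfps_nth f b * mfps_nth (mfps_compose (mpow G b) H) a)"
    by (simp add: nth_compose' sum_distrib_left)
  also have "\<dots> = mfps_nth (mfps_compose f (\<chi> i. mfps_compose (G $ i) H)) a"
    by (simp add: nth_compose' compose_mpow[OF H])
  finally show "mfps_nth (mfps_compose (mfps_compose f G) H) a
      = mfps_nth (mfps_compose f (\<chi> i. mfps_compose (G $ i) H)) a" .
qed

text \<open>Multiplication by a variable shifts the coefficients.\<close>

lemma mpow_id: "mfps_nth (mpow fm_id b) a = (if a = b then 1 else 0)"
proof (induction b arbitrary: a rule: mi_induct)
  case zero
  then show ?case by simp
next
  case (add b j)
  have eq: "mpow fm_id (b + axis j 1) = mpow fm_id b * mfps_var j"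
    by (simp add: mpow_add) (simp add: fm_id_def)
  show ?case
  proof (cases "a $ j = 0")
    case True
    then have "a \<noteq> b + axis j 1" by (auto simp: axis_def)
    then show ?thesis unfolding eq using mfps_nth_mult_var_eq_0[OF True] by simp
  next
    case False
    have "a = (\<chi> i. if i = j then a $ i - 1 else a $ i) + axis j 1"
      using False by (auto simp: cart_eq_iff axis_def)
    then obtain a' where "a = a' + axis j 1" by blast
    then show ?thesis using add[of a'] unfolding eq by simp
  qed
qed

lemma compose_id: "mfps_compose f fm_id = f"
proof (rule mfps_eqI)
  fix a
  have "mfps_nth (mfps_compose f fm_id) a = (\<Sum>b\<in>{a}. mfps_nth f b * mfps_nth (mpow fm_id b) a)"
    unfolding nth_compose' by (rule sum.mono_neutral_right) (auto simp: mpow_id)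
  then show "mfps_nth (mfps_compose f fm_id) a = mfps_nth f a" by (simp add: mpow_id)
qed

lemma fm_comp_nth [simp]: "fm_comp F G $ i = mfps_compose (F $ i) G"
  by (simp add: fm_comp_def)

lemma fm_comp_assoc:
  assumes "fm_order_ge 1 G" "fm_order_ge 1 H"
  shows "fm_comp (fm_comp F G) H = fm_comp F (fm_comp G H)"
  using assms by (simp add: fm_order_ge_iff fm_comp_def compose_assoc)

lemma fm_comp_id_right [simp]: "fm_comp F fm_id = F"
  by (simp add: cart_eq_iff compose_id)

lemma fm_comp_id_left: "fm_order_ge 1 F \<Longrightarrow> fm_comp fm_id F = F"
  by (simp add: cart_eq_iff fm_order_ge_iff fm_id_def compose_var)

lemma fm_comp_diff_left: "fm_comp (F - G) H = fm_comp F H - fm_comp G H"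
  by (simp add: cart_eq_iff compose_diff)

lemma fm_order_ge_comp:
  "fm_order_ge p F \<Longrightarrow> fm_order_ge 1 G \<Longrightarrow> fm_order_ge p (fm_comp F G)"
  by (auto simp: fm_order_ge_iff intro!: compose_order)

lemma fm_order_ge_id: "fm_order_ge 1 fm_id"
  by (auto simp: fm_order_ge_def fm_id_def)

lemma fm_linear_nth: "mfps_nth (fm_linear A $ i) a = (\<Sum>j\<in>UNIV. A $ i $ j * (if a = axis j 1 then 1 else 0))"
  by (simp add: fm_linear_def mfps_nth_sum mfps_nth_const_mult)

lemma fm_order_ge_linear: "fm_order_ge 1 (fm_linear A)"
  by (auto simp: fm_order_ge_def fm_linear_nth intro!: sum.neutral)

lemma fm_comp_linear_nth:
  assumes "fm_order_ge 1 F"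
  shows "mfps_nth (fm_comp (fm_linear A) F $ i) a = (\<Sum>j\<in>UNIV. A $ i $ j * mfps_nth (F $ j) a)"
proof -
  have F: "\<And>j. mfps_order_ge 1 (F $ j)" using assms by (simp add: fm_order_ge_iff)
  have "fm_comp (fm_linear A) F $ i = (\<Sum>j\<in>UNIV. mfps_const (A $ i $ j) * F $ j)"
    by (simp add: fm_linear_def compose_sum compose_mult[OF F] compose_const compose_var[OF F])
  then show ?thesis by (simp add: mfps_nth_sum mfps_nth_const_mult)
qed

section \<open>A fixed-point equation and inverse maps\<close>

lemma fm_order_ge_add: "fm_order_ge m F \<Longrightarrow> fm_order_ge m G \<Longrightarrow> fm_order_ge m (F + G)"
  and fm_order_ge_diff: "fm_order_ge m F \<Longrightarrow> fm_order_ge m G \<Longrightarrow> fm_order_ge m (F - G)"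
  by (auto simp: fm_order_ge_def)

lemma fm_order_ge_minus_iff [simp]: "fm_order_ge m (- F) \<longleftrightarrow> fm_order_ge m F"
  by (auto simp: fm_order_ge_def)

lemma fm_order_ge_mono: "fm_order_ge m F \<Longrightarrow> l \<le> m \<Longrightarrow> fm_order_ge l F"
  by (auto simp: fm_order_ge_def)

lemma mi_size_1_iff: "mi_size a = 1 \<longleftrightarrow> (\<exists>j. a = axis j 1)"
proof
  assume a: "mi_size a = 1"
  then have "a \<noteq> 0" by auto
  then obtain b j where "a = b + axis j 1" by (rule mi_decompose)
  with a show "\<exists>j. a = axis j 1" by (intro exI[of _ j]) auto
qed auto

lemma G_hat0_iff: "h \<in> G_hat0 \<longleftrightarrow> fm_order_ge 2 (h - fm_id)"
proof
  assume h: "h \<in> G_hat0"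
  show "fm_order_ge 2 (h - fm_id)"
    unfolding fm_order_ge_def
  proof (intro allI impI)
    fix i and a :: "nat ^ 'a" assume "mi_size a < 2"
    then consider "a = 0" | "mi_size a = 1" by (metis less_2_cases mi_size_eq_0_iff One_nat_def)
    then show "mfps_nth ((h - fm_id) $ i) a = 0"
    proof cases
      case 1
      then show ?thesis using h by (simp add: G_hat0_def G_hat_def fm_order_ge_def fm_id_def)
    next
      case 2
      then obtain j where "a = axis j 1" using mi_size_1_iff by blast
      moreover have "fm_deriv0 h $ i $ j = (Finite_Cartesian_Product.mat 1 :: complex ^ 'a ^ 'a) $ i $ j"
        using h by (simp add: G_hat0_def)
      ultimately show ?thesis
        by (auto simp: fm_deriv0_def fm_id_def Finite_Cartesian_Product.mat_def axis_eq_axis)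
    qed
  qed
next
  assume o: "fm_order_ge 2 (h - fm_id)"
  then have "fm_order_ge 1 h"
    using fm_order_ge_add[OF fm_order_ge_mono[OF o, of 1] fm_order_ge_id] by simp
  moreover have "mfps_nth (h $ i) (axis j 1) = mfps_nth (fm_id $ i) (axis j 1)" for i j
    using o unfolding fm_order_ge_def
    by (metis eq_iff_diff_eq_0 mi_size_axis minus_mfps.rep_eq one_less_numeral_iff semiring_norm(76)
        vector_minus_component)
  then have "fm_deriv0 h $ i $ j = (Finite_Cartesian_Product.mat 1 :: complex ^ 'a ^ 'a) $ i $ j" for i j
    by (auto simp: fm_deriv0_def Finite_Cartesian_Product.mat_def fm_id_def axis_eq_axis)
  then have "fm_deriv0 h = Finite_Cartesian_Product.mat 1"
    by (simp add: cart_eq_iff)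
  ultimately show "h \<in> G_hat0"
    by (auto simp: G_hat0_def G_hat_def invertible_def intro!: exI[of _ "Finite_Cartesian_Product.mat 1"])
qed

lemma G_hat0_order: "h \<in> G_hat0 \<Longrightarrow> fm_order_ge 1 h"
  by (simp add: G_hat0_def G_hat_def)

lemma G_hat0_comp:
  assumes "h \<in> G_hat0" "k \<in> G_hat0"
  shows "fm_comp h k \<in> G_hat0"
proof -
  have "fm_comp h k - fm_id = fm_comp (h - fm_id) k + (k - fm_id)"
    using G_hat0_order[OF assms(2)] by (simp add: fm_comp_diff_left fm_comp_id_left)
  then show ?thesis
    using assms unfolding G_hat0_iff
    by (metis G_hat0_iff G_hat0_order assms(2) fm_order_ge_add fm_order_ge_comp)
qed


definition coeffs_of_degree :: "nat \<Rightarrow> ('n::finite \<times> (nat ^ 'n)) set" where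
  "coeffs_of_degree m = UNIV \<times> {b. mi_size b = m}"

lemma finite_coeffs_of_degree [simp]: "finite (coeffs_of_degree m)"
  by (simp add: coeffs_of_degree_def)

text \<open>The linear operator that acts on the homogeneous part of each degree by the matrix \<open>p\<close>. A
  matrix rather than an abstract linear map makes it evident that the operator preserves polynomial
  dependence on parameters.\<close>

definition graded_op ::
  "(('n::finite \<times> (nat ^ 'n)) \<Rightarrow> ('n \<times> (nat ^ 'n)) \<Rightarrow> complex) \<Rightarrow> 'n fmap \<Rightarrow> 'n fmap" where
  "graded_op p F = (\<chi> i. Abs_mfps (\<lambda>a.
     \<Sum>x\<in>coeffs_of_degree (mi_size a). p (i, a) x * mfps_nth (F $ fst x) (snd x)))"

lemma graded_op_nth [simp]: "mfps_nth (graded_op p F $ i) a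
    = (\<Sum>x\<in>coeffs_of_degree (mi_size a). p (i, a) x * mfps_nth (F $ fst x) (snd x))"
  by (simp add: graded_op_def)

lemma graded_op_diff: "graded_op p (F - G) = graded_op p F - graded_op p G"
  by (rule fmap_eqI) (simp add: algebra_simps sum_subtractf)

lemma graded_op_order: "fm_order_ge m F \<Longrightarrow> fm_order_ge m (graded_op p F)"
  by (auto simp: fm_order_ge_def coeffs_of_degree_def intro!: sum.neutral)

lemma graded_op_id: "graded_op (\<lambda>x y. if x = y then 1 else 0) F = F"
proof (rule fmap_eqI)
  fix i and a :: "nat ^ 'a"
  have "(\<Sum>x\<in>coeffs_of_degree (mi_size a). (if (i, a) = x then 1 else 0) * mfps_nth (F $ fst x) (snd x))
      = (\<Sum>x\<in>{(i, a)}. (if (i, a) = x then 1 else 0) * mfps_nth (F $ fst x) (snd x))"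
    by (rule sum.mono_neutral_right) (auto simp: coeffs_of_degree_def)
  then show "mfps_nth (graded_op (\<lambda>x y. if x = y then 1 else 0) F $ i) a = mfps_nth (F $ i) a"
    by simp
qed

lemma mpow_diff_order:
  assumes F: "\<And>j. mfps_order_ge 1 (F $ j)" and F': "\<And>j. mfps_order_ge 1 (F' $ j)"
    and d: "\<And>j. mfps_order_ge (Suc m) (F $ j - F' $ j)"
  shows "mfps_order_ge (m + mi_size b) (mpow F b - mpow F' b)"
proof (induction b rule: mi_induct)
  case zero
  show ?case by (simp add: mfps_order_ge_def)
next
  case (add b j)
  have eq: "mpow F (b + axis j 1) - mpow F' (b + axis j 1)
      = mpow F b * (F $ j - F' $ j) + (mpow F b - mpow F' b) * F' $ j"
    unfolding mpow_add mpow_axis by (simp add: algebra_simps)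
  have "mfps_order_ge (m + mi_size (b + axis j 1)) (mpow F b * (F $ j - F' $ j))"
    using mfps_order_ge_mult[OF mfps_order_ge_mpow[OF F, of b] d[of j]] by (simp add: add_ac One_nat_def)
  moreover have "mfps_order_ge (m + mi_size (b + axis j 1)) ((mpow F b - mpow F' b) * F' $ j)"
    using mfps_order_ge_mult[OF add F'[of j]] by (simp add: add_ac)
  ultimately show ?case unfolding eq by (simp add: mfps_order_ge_def)
qed

text \<open>Each monomial of degree at least \<open>2\<close> in the coordinates has a factor of order at least
  \<open>1\<close> besides the difference. The gain of one order makes \<open>c \<mapsto> fm_id - T (fm_comp G c)\<close> a contraction in the adic topology for every
  degree-preserving linear \<open>T\<close>.\<close>

lemma fm_comp_diff_right_order:
  assumes G: "fm_order_ge 2 G" and F: "fm_order_ge 1 F" and F': "fm_order_ge 1 F'"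
    and d: "fm_order_ge (Suc m) (F - F')"
  shows "fm_order_ge (Suc (Suc m)) (fm_comp G F - fm_comp G F')"
  unfolding fm_order_ge_def
proof (intro allI impI)
  fix i and a :: "nat ^ 'a" assume a: "mi_size a < Suc (Suc m)"
  have "mfps_nth (G $ i) b * mfps_nth (mpow F b) a = mfps_nth (G $ i) b * mfps_nth (mpow F' b) a" for b
  proof (cases "mi_size b < 2")
    case True
    then show ?thesis using G by (simp add: fm_order_ge_def)
  next
    case False
    have "mfps_order_ge (m + mi_size b) (mpow F b - mpow F' b)"
      using F F' d by (intro mpow_diff_order) (auto simp: fm_order_ge_iff)
    then show ?thesis using a False by (auto simp: mfps_order_ge_def)
  qed
  then show "mfps_nth ((fm_comp G F - fm_comp G F') $ i) a = 0"
    by (simp only: vector_minus_component minus_mfps.rep_eq fm_comp_nth nth_compose' right_minus_eq)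
qed

text \<open>Iteration for the equation \<open>c = fm_id - graded_op p (fm_comp G c)\<close>. The steps after
  the \<open>j\<close>-th one do not change the coefficients of order at most \<open>j\<close>, so that the solution takes its coefficients of
  order \<open>m\<close> from the \<open>m\<close>-th iterate.\<close>

primrec fixed_point_iterate ::
  "(('n::finite \<times> (nat ^ 'n)) \<Rightarrow> ('n \<times> (nat ^ 'n)) \<Rightarrow> complex) \<Rightarrow> 'n fmap \<Rightarrow> nat \<Rightarrow> 'n fmap" where
  "fixed_point_iterate p G 0 = fm_id"
| "fixed_point_iterate p G (Suc j) = fm_id - graded_op p (fm_comp G (fixed_point_iterate p G j))"

definition fixed_point ::
  "(('n::finite \<times> (nat ^ 'n)) \<Rightarrow> ('n \<times> (nat ^ 'n)) \<Rightarrow> complex) \<Rightarrow> 'n fmap \<Rightarrow> 'n fmap" where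
  "fixed_point p G = (\<chi> i. Abs_mfps (\<lambda>a. mfps_nth (fixed_point_iterate p G (mi_size a) $ i) a))"

lemma fixed_point_iterate_order:
  assumes G: "fm_order_ge 2 G"
  shows "fm_order_ge 1 (fixed_point_iterate p G j)"
proof (induction j)
  case (Suc j)
  then have "fm_order_ge 1 (fm_comp G (fixed_point_iterate p G j))"
    using G by (intro fm_order_ge_comp) (auto intro: fm_order_ge_mono)
  then show ?case by (auto intro!: fm_order_ge_diff fm_order_ge_id graded_op_order)
qed (simp add: fm_order_ge_id)

lemma fixed_point_iterate_step_order:
  assumes G: "fm_order_ge 2 G"
  shows "fm_order_ge (Suc (Suc j)) (fixed_point_iterate p G (Suc j) - fixed_point_iterate p G j)"
proof (induction j)
  case 0
  then show ?case using graded_op_order[OF G, of p] by (simp add: numeral_2_eq_2)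
next
  case (Suc j)
  have "fm_order_ge (Suc (Suc (Suc j)))
      (fm_comp G (fixed_point_iterate p G (Suc j)) - fm_comp G (fixed_point_iterate p G j))"
    using fm_comp_diff_right_order[OF G fixed_point_iterate_order[OF G] fixed_point_iterate_order[OF G] Suc] .
  then have "fm_order_ge (Suc (Suc (Suc j))) (- graded_op p
      (fm_comp G (fixed_point_iterate p G (Suc j)) - fm_comp G (fixed_point_iterate p G j)))"
    by (simp add: graded_op_order del: fixed_point_iterate.simps)
  then show ?case unfolding graded_op_diff by simp
qed

lemma fixed_point_iterate_stable:
  assumes G: "fm_order_ge 2 G" and "mi_size a \<le> j"
  shows "mfps_nth (fixed_point_iterate p G j $ i) a = mfps_nth (fixed_point p G $ i) a"
  using assms(2)
proof (induction j rule: dec_induct)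
  case base
  then show ?case by (simp add: fixed_point_def)
next
  case (step j)
  then show ?case using fixed_point_iterate_step_order[OF G, of j p]
    by (auto simp: fm_order_ge_def simp del: fixed_point_iterate.simps)
qed

lemma fixed_point_order:
  assumes "fm_order_ge 2 G"
  shows "fm_order_ge 1 (fixed_point p G)"
  using fixed_point_iterate_order[OF assms, of p 1]
  unfolding fm_order_ge_def
  by (metis assms fixed_point_iterate_stable less_imp_le)

lemma fixed_point_eq:
  assumes G: "fm_order_ge 2 G"
  shows "fixed_point p G = fm_id - graded_op p (fm_comp G (fixed_point p G))"
proof (rule fmap_eqI)
  fix i and a :: "nat ^ 'a"
  let ?m = "mi_size a"
  have "fm_order_ge (Suc ?m) (fixed_point_iterate p G ?m - fixed_point p G)"
    by (simp add: fm_order_ge_def fixed_point_iterate_stable[OF G])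
  from graded_op_order[OF fm_comp_diff_right_order[OF G fixed_point_iterate_order[OF G] fixed_point_order[OF G] this], of p]
  have "mfps_nth ((graded_op p (fm_comp G (fixed_point_iterate p G ?m))
      - graded_op p (fm_comp G (fixed_point p G))) $ i) a = 0"
    unfolding graded_op_diff fm_order_ge_def by simp
  then have "mfps_nth ((fm_id - graded_op p (fm_comp G (fixed_point p G))) $ i) a
      = mfps_nth (fixed_point_iterate p G (Suc ?m) $ i) a"
    by simp
  then show "mfps_nth (fixed_point p G $ i) a
      = mfps_nth ((fm_id - graded_op p (fm_comp G (fixed_point p G))) $ i) a"
    by (simp only: fixed_point_iterate_stable[OF G le_SucI[OF order_refl]])
qed

lemma fixed_point_unique:
  assumes G: "fm_order_ge 2 G"
    and c: "fm_order_ge 1 c" "c = fm_id - graded_op p (fm_comp G c)"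
  shows "c = fixed_point p G"
proof -
  let ?d = "fixed_point p G"
  note d = fixed_point_order[OF G, of p]
  have "fm_order_ge (Suc m) (c - ?d)" for m
  proof (induction m)
    case 0
    show ?case using fm_order_ge_diff[OF c(1) d] by (simp add: One_nat_def)
  next
    case (Suc m)
    have "c - ?d = (fm_id - graded_op p (fm_comp G c)) - (fm_id - graded_op p (fm_comp G ?d))"
      using c(2) fixed_point_eq[OF G, of p] by argo
    also have "\<dots> = - graded_op p (fm_comp G c - fm_comp G ?d)"
      by (simp add: graded_op_diff)
    finally show ?case
      using graded_op_order[OF fm_comp_diff_right_order[OF G c(1) d Suc], of p] by simp
  qed
  then show ?thesis
    by (intro fmap_eqI) (metis eq_iff_diff_eq_0 fm_order_ge_def lessI minus_mfps.rep_eq vector_minus_component)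
qed

lemma fixed_point_in_G_hat0:
  assumes G: "fm_order_ge 2 G"
  shows "fixed_point p G \<in> G_hat0"
proof -
  have "fixed_point p G - fm_id = - graded_op p (fm_comp G (fixed_point p G))"
    using fixed_point_eq[OF G, of p] by (metis add_diff_cancel_left' diff_conv_add_uminus)
  then show ?thesis
    unfolding G_hat0_iff using G fixed_point_order[OF G]
    by (metis fm_order_ge_comp fm_order_ge_minus_iff graded_op_order)
qed


abbreviation id_kernel :: "('n::finite \<times> (nat ^ 'n)) \<Rightarrow> ('n \<times> (nat ^ 'n)) \<Rightarrow> complex" where
  "id_kernel \<equiv> (\<lambda>x y. if x = y then 1 else 0)"

text \<open>For the identity operator the equation reads \<open>g = fm_id - (h - fm_id) \<circ> g\<close>, that is
  \<open>h \<circ> g = fm_id\<close>.\<close>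

lemma fixed_point_right_inverse:
  assumes h: "h \<in> G_hat0"
  shows "fm_comp h (fixed_point id_kernel (h - fm_id)) = fm_id"
proof -
  have G: "fm_order_ge 2 (h - fm_id)" using h by (simp add: G_hat0_iff)
  let ?g = "fixed_point id_kernel (h - fm_id)"
  have "?g = fm_id - fm_comp (h - fm_id) ?g"
    using fixed_point_eq[OF G, of id_kernel] by (simp only: graded_op_id)
  then have "?g = fm_id - (fm_comp h ?g - ?g)"
    by (simp only: fm_comp_diff_left fm_comp_id_left[OF fixed_point_order[OF G]])
  then show ?thesis by (simp add: algebra_simps)
qed

lemma fm_inv_eqI:
  assumes g: "g \<in> G_hat" and h: "h \<in> G_hat" and "fm_comp g h = fm_id" "fm_comp h g = fm_id"
  shows "fm_inv h = g"
  unfolding fm_inv_def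
proof (rule the_equality)
  fix g' assume g': "g' \<in> G_hat \<and> fm_comp g' h = fm_id \<and> fm_comp h g' = fm_id"
  have o: "fm_order_ge 1 F" if "F \<in> G_hat" for F :: "'a fmap" using that by (simp add: G_hat_def)
  have "g' = fm_comp g' (fm_comp h g)" using assms by simp
  also have "\<dots> = fm_comp (fm_comp g' h) g" using g h by (simp add: fm_comp_assoc o)
  also have "\<dots> = g" using g g' by (simp add: fm_comp_id_left o)
  finally show "g' = g" .
qed (use assms in auto)

text \<open>The right inverse \<open>g\<close> of \<open>h\<close> has a right inverse in turn, which must be \<open>h\<close>.\<close>

lemma fm_inv_props:
  assumes h: "h \<in> G_hat0"
  shows fm_inv_in_G_hat0: "fm_inv h \<in> G_hat0"
    and fm_comp_inv_left: "fm_comp (fm_inv h) h = fm_id"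
    and fm_comp_inv_right: "fm_comp h (fm_inv h) = fm_id"
    and fm_inv_eq_fixed_point: "fm_inv h = fixed_point id_kernel (h - fm_id)"
proof -
  let ?r = "\<lambda>h. fixed_point id_kernel (h - fm_id) :: 'a fmap"
  have r: "?r k \<in> G_hat0" "fm_comp k (?r k) = fm_id" if "k \<in> G_hat0" for k :: "'a fmap"
    using fixed_point_in_G_hat0 fixed_point_right_inverse that by (auto simp: G_hat0_iff)
  let ?g = "?r h"
  have "h = fm_comp h (fm_comp ?g (?r ?g))" using r(2)[OF r(1)[OF h]] by simp
  also have "\<dots> = fm_comp (fm_comp h ?g) (?r ?g)"
    by (rule fm_comp_assoc[symmetric]) (intro G_hat0_order r(1) h)+
  also have "\<dots> = ?r ?g" using r h by (simp add: fm_comp_id_left G_hat0_order)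
  finally have l: "fm_comp ?g h = fm_id" using r[OF r(1)[OF h]] by simp
  have "?g \<in> G_hat" "h \<in> G_hat" using r(1)[OF h] h unfolding G_hat0_def by simp_all
  then show e: "fm_inv h = ?g" using l r(2)[OF h] by (rule fm_inv_eqI)
  show "fm_inv h \<in> G_hat0" "fm_comp (fm_inv h) h = fm_id" "fm_comp h (fm_inv h) = fm_id"
    unfolding e using l r h by auto
qed


lemma formal_linearizations_iff:
  assumes f: "fm_order_ge 1 f"
  shows "h \<in> formal_linearizations A f \<longleftrightarrow> h \<in> G_hat0 \<and> fm_comp h f = fm_comp (fm_linear A) h"
proof -
  have "fm_comp h (fm_comp f (fm_inv h)) = fm_linear A \<longleftrightarrow> fm_comp h f = fm_comp (fm_linear A) h"
    if h: "h \<in> G_hat0"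
  proof -
    note o = G_hat0_order[OF h] G_hat0_order[OF fm_inv_in_G_hat0[OF h]] f fm_order_ge_linear
    have "fm_comp (fm_comp h (fm_comp f (fm_inv h))) h = fm_comp h f"
      using o h by (simp add: fm_comp_assoc fm_comp_inv_left fm_order_ge_comp)
    moreover have "fm_comp (fm_comp (fm_linear A) h) (fm_inv h) = fm_linear A"
      using o h by (simp add: fm_comp_assoc fm_comp_inv_right)
    moreover have "fm_comp (fm_comp h f) (fm_inv h) = fm_comp h (fm_comp f (fm_inv h))"
      using o by (simp add: fm_comp_assoc)
    ultimately show ?thesis by metis
  qed
  then show ?thesis by (auto simp: formal_linearizations_def)
qed

lemma G_hat_conj_order: "f \<in> G_hat_conj A \<Longrightarrow> fm_order_ge 1 f"
  by (auto simp: G_hat_conj_def G_hat0_order fm_inv_in_G_hat0 intro!: fm_order_ge_comp fm_order_ge_linear)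

lemma Cent_comp_linearization:
  assumes f: "fm_order_ge 1 f" and h: "h \<in> formal_linearizations A f" and c: "c \<in> Cent A"
  shows "fm_comp c h \<in> formal_linearizations A f"
proof -
  have h': "h \<in> G_hat0" "fm_comp h f = fm_comp (fm_linear A) h"
    using h by (auto simp: formal_linearizations_iff[OF f])
  have c': "c \<in> G_hat0" "fm_comp c (fm_linear A) = fm_comp (fm_linear A) c"
    using c by (auto simp: Cent_def)
  note o = G_hat0_order[OF h'(1)] G_hat0_order[OF c'(1)] f fm_order_ge_linear[of A]
  have "fm_comp (fm_comp c h) f = fm_comp c (fm_comp (fm_linear A) h)"
    using o h' by (simp add: fm_comp_assoc)
  also have "\<dots> = fm_comp (fm_linear A) (fm_comp c h)"
    using o c' by (simp flip: fm_comp_assoc)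
  finally show ?thesis using h' c' by (simp add: formal_linearizations_iff[OF f] G_hat0_comp)
qed

lemma linearizations_differ_by_Cent:
  assumes f: "fm_order_ge 1 f" and h: "h \<in> formal_linearizations A f" and k: "k \<in> formal_linearizations A f"
  shows "fm_comp k (fm_inv h) \<in> Cent A"
proof -
  have h': "h \<in> G_hat0" "fm_comp h f = fm_comp (fm_linear A) h"
    and k': "k \<in> G_hat0" "fm_comp k f = fm_comp (fm_linear A) k"
    using h k by (auto simp: formal_linearizations_iff[OF f])
  note hi = fm_inv_in_G_hat0[OF h'(1)]
  note o = G_hat0_order[OF h'(1)] G_hat0_order[OF k'(1)] G_hat0_order[OF hi] f fm_order_ge_linear[of A]
  have "fm_comp f (fm_inv h) = fm_comp (fm_comp (fm_inv h) h) (fm_comp f (fm_inv h))"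
    using o h' by (simp add: fm_comp_inv_left fm_comp_id_left fm_order_ge_comp)
  also have "\<dots> = fm_comp (fm_inv h) (fm_comp (fm_comp h f) (fm_inv h))"
    using o by (simp add: fm_comp_assoc fm_order_ge_comp)
  also have "\<dots> = fm_comp (fm_inv h) (fm_linear A)"
    using o h' by (simp add: h'(2) fm_comp_assoc fm_comp_inv_right fm_order_ge_comp)
  finally have "fm_comp (fm_comp k (fm_inv h)) (fm_linear A) = fm_comp (fm_comp k f) (fm_inv h)"
    using o by (simp add: fm_comp_assoc)
  also have "\<dots> = fm_comp (fm_linear A) (fm_comp k (fm_inv h))"
    using o by (simp add: k'(2) fm_comp_assoc)
  finally show ?thesis using k' hi by (simp add: Cent_def G_hat0_comp)
qed

lemma Cent_comp:
  assumes c: "c \<in> Cent A" and d: "d \<in> Cent A"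
  shows "fm_comp c d \<in> Cent A"
  using Cent_comp_linearization[OF fm_order_ge_linear _ c, of d A] d
  by (auto simp: formal_linearizations_iff[OF fm_order_ge_linear] Cent_def)

lemma Cent_inv:
  assumes c: "c \<in> Cent A"
  shows "fm_inv c \<in> Cent A"
proof -
  have "fm_id \<in> formal_linearizations A (fm_linear A)"
    by (simp add: formal_linearizations_iff[OF fm_order_ge_linear] fm_comp_id_left[OF fm_order_ge_linear]
        G_hat0_iff) (simp add: fm_order_ge_def)
  moreover have "c \<in> formal_linearizations A (fm_linear A)"
    using c by (auto simp: formal_linearizations_iff[OF fm_order_ge_linear] Cent_def)
  ultimately have "fm_comp fm_id (fm_inv c) \<in> Cent A"
    by (intro linearizations_differ_by_Cent[OF fm_order_ge_linear])
  then show ?thesis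
    using c by (simp add: fm_comp_id_left G_hat0_order fm_inv_in_G_hat0 Cent_def)
qed

section \<open>The Bombieri norm on homogeneous parts\<close>

text \<open>The coefficient \<open>(mi_size a)! / (\<Prod>i. (a $ i)!)\<close>; as a coefficient of a power, it inherits its
  identities from the ring of formal power series.\<close>

definition multinomial :: "nat ^ 'n::finite \<Rightarrow> real" where
  "multinomial a = mfps_nth ((\<Sum>i\<in>UNIV. mfps_var i) ^ mi_size a) a"

abbreviation var_sum :: "(real, 'n::finite) mfps" where
  "var_sum \<equiv> (\<Sum>i\<in>UNIV. mfps_var i)"

lemma mfps_nth_mult_var_cases:
  fixes f :: "('a::comm_ring_1, 'n::finite) mfps"
  obtains "mfps_nth (f * mfps_var j) a = 0"
  | b where "a = b + axis j 1" "mfps_nth (f * mfps_var j) a = mfps_nth f b"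
proof (cases "a $ j = 0")
  case False
  have "a = (\<chi> i. if i = j then a $ i - 1 else a $ i) + axis j 1"
    using False by (auto simp: cart_eq_iff axis_def)
  then obtain b where "a = b + axis j 1" by blast
  then show ?thesis using that(2)[of b] by simp
qed (use that(1) mfps_nth_mult_var_eq_0 in blast)

lemma var_sum_power_bounds:
  "0 \<le> mfps_nth (var_sum ^ m) a \<and> mfps_nth (var_sum ^ m) a \<le> real CARD('n) ^ m"
  for a :: "nat ^ 'n::finite"
proof (induction m arbitrary: a)
  case (Suc m)
  have *: "0 \<le> mfps_nth (var_sum ^ m * mfps_var j) a \<and> mfps_nth (var_sum ^ m * mfps_var j) a \<le> real CARD('n) ^ m"
    for j
    by (cases rule: mfps_nth_mult_var_cases[of "var_sum ^ m" j a]) (use Suc in auto)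
  have "mfps_nth (var_sum ^ Suc m) a = (\<Sum>j\<in>UNIV. mfps_nth (var_sum ^ m * mfps_var j) a)"
    unfolding power_Suc2 sum_distrib_left mfps_nth_sum ..
  moreover have "0 \<le> (\<Sum>j\<in>UNIV. mfps_nth (var_sum ^ m * mfps_var j) a)"
    using * by (simp add: sum_nonneg)
  moreover have "(\<Sum>j\<in>UNIV. mfps_nth (var_sum ^ m * mfps_var j) a) \<le> real CARD('n) * real CARD('n) ^ m"
    using * by (intro sum_bounded_above) auto
  ultimately show ?case by simp
qed auto

lemma var_sum_power_homogeneous: "mi_size a \<noteq> m \<Longrightarrow> mfps_nth (var_sum ^ m) a = 0"
proof (induction m arbitrary: a)
  case (Suc m)
  have "mfps_nth (var_sum ^ m * mfps_var j) a = 0" for j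
    by (cases rule: mfps_nth_mult_var_cases[of "var_sum ^ m" j a]) (use Suc in \<open>auto simp: One_nat_def\<close>)
  then show ?case unfolding power_Suc2 sum_distrib_left mfps_nth_sum by simp
qed auto

lemma var_sum_power_nth: "mfps_nth (var_sum ^ m) a = (if mi_size a = m then multinomial a else 0)"
  by (auto simp: multinomial_def var_sum_power_homogeneous)

lemma multinomial_nonneg: "0 \<le> multinomial a"
  and multinomial_le: "multinomial a \<le> real CARD('n) ^ mi_size a"
  for a :: "nat ^ 'n::finite"
  using var_sum_power_bounds[of "mi_size a" a] by (auto simp: multinomial_def)

lemma multinomial_0 [simp]: "multinomial 0 = 1"
  by (simp add: multinomial_def)

text \<open>Vandermonde's identity for multinomial coefficients: compare the coefficients in
  \<open>(\<Sum>i. x\<^sub>i) ^ (p + q) = (\<Sum>i. x\<^sub>i) ^ p * (\<Sum>i. x\<^sub>i) ^ q\<close>.\<close>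

lemma multinomial_vandermonde:
  assumes "p \<le> mi_size a"
  shows "(\<Sum>(b, c) | b + c = a \<and> mi_size b = p. multinomial b * multinomial c) = multinomial a"
proof -
  have "multinomial a = mfps_nth (var_sum ^ p * var_sum ^ (mi_size a - p)) a"
    using assms by (simp add: multinomial_def flip: power_add)
  also have "\<dots> = (\<Sum>(b, c) | b + c = a. if mi_size b = p then multinomial b * multinomial c else 0)"
    unfolding mfps_nth_mult
    by (rule sum.cong) (use assms in \<open>auto simp: var_sum_power_nth\<close>)
  also have "\<dots> = (\<Sum>(b, c) | b + c = a \<and> mi_size b = p. multinomial b * multinomial c)"
    by (rule sum.mono_neutral_cong_right) (auto simp: finite_multi_index_sums split: if_splits)
  finally show ?thesis ..
qed

lemma multinomial_ge_1: "1 \<le> multinomial a"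
proof (induction a rule: mi_induct)
  case (add b j)
  have e: "multinomial (axis j 1 :: nat ^ 'a) = 1"
    by (simp add: multinomial_def mfps_nth_sum axis_eq_axis)
  have "multinomial b * multinomial (axis j 1)
      \<le> (\<Sum>(b', c') | b' + c' = b + axis j 1 \<and> mi_size b' = mi_size b. multinomial b' * multinomial c')"
    by (rule order.trans[OF _ member_le_sum[of "(b, axis j 1)"]])
      (auto simp: multinomial_nonneg intro!: finite_subset[OF _ finite_multi_index_sums[of "b + axis j 1"]])
  then show ?case using add e by (simp add: multinomial_vandermonde)
qed auto

text \<open>The Bombieri norm of the homogeneous part of degree \<open>m\<close>. Dividing by the multinomial
  coefficients makes this Hilbert norm submultiplicative, see \<open>degree_norm_mult\<close>.\<close>

definition degree_norm :: "nat \<Rightarrow> (complex, 'n::finite) mfps \<Rightarrow> real" where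
  "degree_norm m f = L2_set (\<lambda>a. cmod (mfps_nth f a) / sqrt (multinomial a)) {a. mi_size a = m}"

lemma degree_norm_nonneg [simp]: "0 \<le> degree_norm m f"
  by (simp add: degree_norm_def)

lemma degree_norm_add: "degree_norm m (f + g) \<le> degree_norm m f + degree_norm m g"
proof -
  have "degree_norm m (f + g) \<le> L2_set (\<lambda>a. cmod (mfps_nth f a) / sqrt (multinomial a)
      + cmod (mfps_nth g a) / sqrt (multinomial a)) {a. mi_size a = m}"
    unfolding degree_norm_def
    by (rule L2_set_mono)
      (auto simp flip: add_divide_distrib simp: multinomial_nonneg norm_triangle_ineq divide_right_mono)
  also have "\<dots> \<le> degree_norm m f + degree_norm m g"
    unfolding degree_norm_def by (rule L2_set_triangle_ineq)
  finally show ?thesis .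
qed

lemma degree_norm_const_mult: "degree_norm m (mfps_const c * f) = cmod c * degree_norm m f"
  by (simp add: degree_norm_def mfps_nth_const_mult norm_mult L2_set_right_distrib)

lemma degree_norm_0 [simp]: "degree_norm m 0 = 0"
  using degree_norm_const_mult[of m 0 0] by simp

lemma degree_norm_sum: "degree_norm m (\<Sum>x\<in>A. f x) \<le> (\<Sum>x\<in>A. degree_norm m (f x))"
proof (induction A rule: infinite_finite_induct)
  case (insert x A)
  then show ?case using degree_norm_add[of m "f x" "sum f A"] by simp
qed simp_all

lemma degree_norm_cong:
  "(\<And>a. mi_size a = m \<Longrightarrow> mfps_nth f a = mfps_nth g a) \<Longrightarrow> degree_norm m f = degree_norm m g"
  unfolding degree_norm_def by (rule L2_set_cong) auto

text \<open>The Cauchy--Schwarz inequality with weights \<open>multinomial b * multinomial c\<close>, whose sum over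
  all decompositions \<open>b + c = a\<close> with \<open>mi_size b = p\<close> is the weight of \<open>a\<close>.\<close>

lemma degree_norm_mult_part:
  fixes f g :: "(complex, 'n::finite) mfps"
  assumes "p \<le> m"
  shows "L2_set (\<lambda>a. cmod (\<Sum>(b, c) | b + c = a \<and> mi_size b = p. mfps_nth f b * mfps_nth g c)
      / sqrt (multinomial a)) {a. mi_size a = m} \<le> degree_norm p f * degree_norm (m - p) g"
proof -
  let ?M = multinomial
  define u where "u b = cmod (mfps_nth f b) / sqrt (?M b)" for b
  define v where "v b = cmod (mfps_nth g b) / sqrt (?M b)" for b
  let ?D = "\<lambda>a. {x. fst x + snd x = a \<and> mi_size (fst x) = p} :: ((nat ^ 'n) \<times> (nat ^ 'n)) set"
  have M: "?M a > 0" for a :: "nat ^ 'n" using multinomial_ge_1[of a] by linarith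
  have finD: "finite (?D a)" for a
    by (rule finite_subset[OF _ finite_multi_index_sums[of a]]) auto
  have part: "(cmod (\<Sum>x\<in>?D a. mfps_nth f (fst x) * mfps_nth g (snd x)) / sqrt (?M a))\<^sup>2
      \<le> (\<Sum>x\<in>?D a. (u (fst x) * v (snd x))\<^sup>2)" if a: "mi_size a = m" for a
  proof -
    have "cmod (\<Sum>x\<in>?D a. mfps_nth f (fst x) * mfps_nth g (snd x))
        \<le> (\<Sum>x\<in>?D a. cmod (mfps_nth f (fst x) * mfps_nth g (snd x)))"
      by (rule norm_sum)
    also have "\<dots> = (\<Sum>x\<in>?D a. \<bar>sqrt (?M (fst x) * ?M (snd x))\<bar> * \<bar>u (fst x) * v (snd x)\<bar>)"
      using M by (auto simp: u_def v_def norm_mult abs_mult real_sqrt_mult less_imp_neq[symmetric]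
          less_imp_le intro!: sum.cong)
    also have "\<dots> \<le> L2_set (\<lambda>x. sqrt (?M (fst x) * ?M (snd x))) (?D a)
        * L2_set (\<lambda>x. u (fst x) * v (snd x)) (?D a)"
      by (rule L2_set_mult_ineq)
    also have "L2_set (\<lambda>x. sqrt (?M (fst x) * ?M (snd x))) (?D a) = sqrt (?M a)"
      using multinomial_vandermonde[of p a] assms a
      by (simp add: L2_set_def multinomial_nonneg case_prod_unfold)
    finally have "cmod (\<Sum>x\<in>?D a. mfps_nth f (fst x) * mfps_nth g (snd x)) / sqrt (?M a)
        \<le> L2_set (\<lambda>x. u (fst x) * v (snd x)) (?D a)"
      using M[of a] by (simp add: divide_le_eq mult.commute)
    then have "(cmod (\<Sum>x\<in>?D a. mfps_nth f (fst x) * mfps_nth g (snd x)) / sqrt (?M a))\<^sup>2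
        \<le> (L2_set (\<lambda>x. u (fst x) * v (snd x)) (?D a))\<^sup>2"
      by (intro power_mono) (auto simp: multinomial_nonneg)
    then show ?thesis by (simp add: L2_set_def sum_nonneg)
  qed
  have "(\<Sum>a | mi_size a = m. (cmod (\<Sum>x\<in>?D a. mfps_nth f (fst x) * mfps_nth g (snd x)) / sqrt (?M a))\<^sup>2)
      \<le> (\<Sum>a | mi_size a = m. \<Sum>x\<in>?D a. (u (fst x) * v (snd x))\<^sup>2)"
    by (rule sum_mono) (use part in auto)
  also have "\<dots> = (\<Sum>(a, x)\<in>Sigma {a. mi_size a = m} ?D. (u (fst x) * v (snd x))\<^sup>2)"
    by (rule sum.Sigma) (use finD in auto)
  also have "\<dots> = (\<Sum>x\<in>{b. mi_size b = p} \<times> {c. mi_size c = m - p}. (u (fst x) * v (snd x))\<^sup>2)"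
    by (rule sum.reindex_bij_witness[of _ "\<lambda>x. (fst x + snd x, x)" snd]) (use assms in auto)
  also have "\<dots> = (\<Sum>b | mi_size b = p. (u b)\<^sup>2) * (\<Sum>c | mi_size c = m - p. (v c)\<^sup>2)"
    by (simp add: sum_product sum.cartesian_product power_mult_distrib case_prod_unfold)
  finally show ?thesis
    by (simp add: degree_norm_def L2_set_def u_def v_def real_sqrt_mult[symmetric] case_prod_unfold)
qed

lemma degree_norm_mult:
  "degree_norm m (f * g) \<le> (\<Sum>p\<le>m. degree_norm p f * degree_norm (m - p) g)"
  for f g :: "(complex, 'n::finite) mfps"
proof -
  define T :: "nat \<Rightarrow> (complex, 'n) mfps" where
    "T p = Abs_mfps (\<lambda>a. \<Sum>(b, c) | b + c = a \<and> mi_size b = p. mfps_nth f b * mfps_nth g c)" for p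
  have "mfps_nth (f * g) a = mfps_nth (\<Sum>p\<le>m. T p) a" if "mi_size a = m" for a
  proof -
    have "(\<Sum>x | fst x + snd x = a. mfps_nth f (fst x) * mfps_nth g (snd x))
        = (\<Sum>p\<le>m. \<Sum>x\<in>{x \<in> {x. fst x + snd x = a}. mi_size (fst x) = p}. mfps_nth f (fst x) * mfps_nth g (snd x))"
      by (rule sum.group[symmetric])
        (use that finite_multi_index_sums[of a] in \<open>auto simp: case_prod_unfold\<close>)
    then show ?thesis by (simp add: mfps_nth_mult mfps_nth_sum T_def case_prod_unfold)
  qed
  then have "degree_norm m (f * g) = degree_norm m (\<Sum>p\<le>m. T p)"
    by (rule degree_norm_cong)
  also have "\<dots> \<le> (\<Sum>p\<le>m. degree_norm m (T p))" by (rule degree_norm_sum)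
  also have "\<dots> \<le> (\<Sum>p\<le>m. degree_norm p f * degree_norm (m - p) g)"
    using degree_norm_mult_part[of _ m f g] by (intro sum_mono) (auto simp: degree_norm_def[of m] T_def)
  finally show ?thesis .
qed

text \<open>The truncated sums of \<open>\<Sum>j. degree_norm j f * r ^ j\<close>. A bound that is uniform in \<open>m\<close> means
  convergence near \<open>0\<close>, while for fixed \<open>m\<close> these are always finite, so that formal solutions can be
  estimated before their convergence is known.\<close>

definition partial_norm :: "real \<Rightarrow> nat \<Rightarrow> (complex, 'n::finite) mfps \<Rightarrow> real" where
  "partial_norm r m f = (\<Sum>j\<le>m. degree_norm j f * r ^ j)"

lemma partial_norm_nonneg: "0 \<le> r \<Longrightarrow> 0 \<le> partial_norm r m f"
  by (simp add: partial_norm_def sum_nonneg)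

lemma partial_norm_mult:
  assumes r: "0 \<le> r"
  shows "partial_norm r m (f * g) \<le> partial_norm r m f * partial_norm r m g"
proof -
  let ?u = "\<lambda>j. degree_norm j f * r ^ j" and ?v = "\<lambda>j. degree_norm j g * r ^ j"
  have "partial_norm r m (f * g) \<le> (\<Sum>j\<le>m. (\<Sum>p\<le>j. degree_norm p f * degree_norm (j - p) g) * r ^ j)"
    unfolding partial_norm_def using r by (intro sum_mono mult_right_mono degree_norm_mult) auto
  also have "\<dots> = (\<Sum>j\<le>m. \<Sum>p\<le>j. ?u p * ?v (j - p))"
  proof (intro sum.cong refl)
    fix j
    have "r ^ j = r ^ p * r ^ (j - p)" if "p \<le> j" for p using that by (simp flip: power_add)
    then show "(\<Sum>p\<le>j. degree_norm p f * degree_norm (j - p) g) * r ^ j = (\<Sum>p\<le>j. ?u p * ?v (j - p))"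
      unfolding sum_distrib_right by (intro sum.cong) (simp_all add: mult_ac)
  qed
  also have "\<dots> = (\<Sum>(p, q)\<in>{(p, q). p + q \<le> m}. ?u p * ?v q)"
    by (rule sum.triangle_reindex_eq[symmetric])
  also have "\<dots> \<le> (\<Sum>(p, q)\<in>{..m} \<times> {..m}. ?u p * ?v q)"
    by (rule sum_mono2) (use r in auto)
  also have "\<dots> = partial_norm r m f * partial_norm r m g"
    by (simp add: partial_norm_def sum_product sum.cartesian_product)
  finally show ?thesis .
qed

lemma partial_norm_1: "partial_norm r m 1 = 1"
proof -
  have "degree_norm j (1 :: (complex, 'a) mfps) = (if j = 0 then 1 else 0)" for j
    by (auto simp: degree_norm_def L2_set_eq_0_iff)
  then have "partial_norm r m (1 :: (complex, 'a) mfps) = (\<Sum>j\<le>m. if j = 0 then 1 else 0)"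
    unfolding partial_norm_def by (intro sum.cong) auto
  then show ?thesis by simp
qed

lemma partial_norm_mpow:
  assumes r: "0 \<le> r" and Y: "\<And>j. partial_norm r m (G $ j) \<le> Y"
  shows "partial_norm r m (mpow G b) \<le> Y ^ mi_size b"
proof (induction b rule: mi_induct)
  case zero
  show ?case by (simp add: partial_norm_1)
next
  case (add b j)
  have "partial_norm r m (mpow G b * G $ j) \<le> partial_norm r m (mpow G b) * partial_norm r m (G $ j)"
    by (rule partial_norm_mult[OF r])
  also have "\<dots> \<le> Y ^ mi_size b * Y"
    using add Y[of j] partial_norm_nonneg[OF r] by (intro mult_mono) (auto intro: order.trans)
  finally show ?case by (simp add: mpow_add power_add)
qed

lemma partial_norm_compose:
  assumes r: "0 \<le> r" and G: "\<And>j. mfps_order_ge 1 (G $ j)" and Y: "\<And>j. partial_norm r m (G $ j) \<le> Y"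
  shows "partial_norm r m (mfps_compose f G) \<le> (\<Sum>b | mi_size b \<le> m. cmod (mfps_nth f b) * Y ^ mi_size b)"
proof -
  let ?g = "\<Sum>b | mi_size b \<le> m. mfps_const (mfps_nth f b) * mpow G b"
  have "partial_norm r m (mfps_compose f G) = partial_norm r m ?g"
    unfolding partial_norm_def
    by (intro sum.cong refl arg_cong2[where f = "(*)"] degree_norm_cong)
      (simp add: mfps_nth_sum mfps_nth_const_mult nth_compose[OF G, of _ m])
  also have "\<dots> \<le> (\<Sum>j\<le>m. (\<Sum>b | mi_size b \<le> m. cmod (mfps_nth f b) * degree_norm j (mpow G b)) * r ^ j)"
    unfolding partial_norm_def using r
    by (intro sum_mono mult_right_mono order.trans[OF degree_norm_sum]) (auto simp: degree_norm_const_mult)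
  also have "\<dots> = (\<Sum>b | mi_size b \<le> m. cmod (mfps_nth f b) * partial_norm r m (mpow G b))"
    unfolding partial_norm_def sum_distrib_right sum_distrib_left
    by (subst sum.swap) (simp add: mult_ac)
  also have "\<dots> \<le> (\<Sum>b | mi_size b \<le> m. cmod (mfps_nth f b) * Y ^ mi_size b)"
    by (intro sum_mono mult_left_mono partial_norm_mpow r Y) auto
  finally show ?thesis .
qed

section \<open>Convergence of fixed points\<close>

text \<open>The Hilbert sum over the components: linear operators on maps may mix the components, and
  orthogonal projections are contractions only for a Hilbert norm.\<close>

definition fm_degree_norm :: "nat \<Rightarrow> 'n::finite fmap \<Rightarrow> real" where
  "fm_degree_norm m F = L2_set (\<lambda>x. cmod (mfps_nth (F $ fst x) (snd x)) / sqrt (multinomial (snd x)))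
     (coeffs_of_degree m)"

definition fm_partial_norm :: "real \<Rightarrow> nat \<Rightarrow> 'n::finite fmap \<Rightarrow> real" where
  "fm_partial_norm r m F = (\<Sum>j\<le>m. fm_degree_norm j F * r ^ j)"

lemma fm_degree_norm_nonneg [simp]: "0 \<le> fm_degree_norm m F"
  by (simp add: fm_degree_norm_def)

lemma fm_degree_norm_squared: "(fm_degree_norm m F)\<^sup>2 = (\<Sum>i\<in>UNIV. (degree_norm m (F $ i))\<^sup>2)"
  by (simp add: fm_degree_norm_def degree_norm_def L2_set_def sum_nonneg coeffs_of_degree_def
      sum.cartesian_product case_prod_unfold)

lemma degree_norm_le_fm: "degree_norm m (F $ i) \<le> fm_degree_norm m F"
  by (rule power2_le_imp_le) (auto simp: fm_degree_norm_squared intro!: member_le_sum)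

lemma fm_degree_norm_le_sum: "fm_degree_norm m F \<le> (\<Sum>i\<in>UNIV. degree_norm m (F $ i))"
proof -
  have "fm_degree_norm m F = L2_set (\<lambda>i. degree_norm m (F $ i)) UNIV"
    using fm_degree_norm_squared[of m F] by (simp add: L2_set_def real_sqrt_unique)
  then show ?thesis by (simp add: L2_set_le_sum)
qed

lemma fm_degree_norm_diff: "fm_degree_norm m (F - G) \<le> fm_degree_norm m F + fm_degree_norm m G"
proof -
  have "fm_degree_norm m (F - G) \<le> L2_set (\<lambda>x.
      cmod (mfps_nth (F $ fst x) (snd x)) / sqrt (multinomial (snd x))
      + cmod (mfps_nth (G $ fst x) (snd x)) / sqrt (multinomial (snd x))) (coeffs_of_degree m)"
    unfolding fm_degree_norm_def
    by (rule L2_set_mono)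
      (auto simp flip: add_divide_distrib simp: multinomial_nonneg norm_triangle_ineq4 divide_right_mono)
  also have "\<dots> \<le> fm_degree_norm m F + fm_degree_norm m G"
    unfolding fm_degree_norm_def by (rule L2_set_triangle_ineq)
  finally show ?thesis .
qed

lemma fm_degree_norm_id_le: "fm_degree_norm m (fm_id :: 'n::finite fmap) \<le> (if m = 1 then real CARD('n) else 0)"
proof -
  have "degree_norm m (fm_id $ i :: (complex, 'n) mfps) \<le> (if m = 1 then 1 else 0)" for i :: 'n
  proof (cases "m = 1")
    case True
    have "degree_norm m (fm_id $ i :: (complex, 'n) mfps)
        \<le> (\<Sum>a | mi_size a = m. cmod (mfps_nth (fm_id $ i) a) / sqrt (multinomial a))"
      unfolding degree_norm_def by (rule L2_set_le_sum) (simp add: multinomial_nonneg)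
    also have "\<dots> = (\<Sum>a\<in>{axis i 1}. cmod (mfps_nth (fm_id $ i) a) / sqrt (multinomial a))"
      by (rule sum.mono_neutral_right) (auto simp: True fm_id_def)
    also have "\<dots> \<le> 1"
      using multinomial_ge_1[of "axis i 1"] by (simp add: fm_id_def)
    finally show ?thesis using True by simp
  next
    case False
    then have "degree_norm m (fm_id $ i :: (complex, 'n) mfps) = degree_norm m (0 :: (complex, 'n) mfps)"
      by (intro degree_norm_cong) (auto simp: fm_id_def)
    then show ?thesis using False by simp
  qed
  then have "(\<Sum>i\<in>UNIV. degree_norm m (fm_id $ i :: (complex, 'n) mfps))
      \<le> (\<Sum>i\<in>(UNIV::'n set). if m = 1 then 1 else 0)"
    by (intro sum_mono)
  then show ?thesis using fm_degree_norm_le_sum[of m "fm_id :: 'n fmap"] by (auto split: if_splits)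
qed

lemma fm_partial_norm_nonneg: "0 \<le> r \<Longrightarrow> 0 \<le> fm_partial_norm r m F"
  by (simp add: fm_partial_norm_def sum_nonneg)

lemma partial_norm_le_fm: "0 \<le> r \<Longrightarrow> partial_norm r m (F $ i) \<le> fm_partial_norm r m F"
  unfolding partial_norm_def fm_partial_norm_def by (intro sum_mono mult_right_mono degree_norm_le_fm) auto

lemma fm_partial_norm_le_sum:
  "0 \<le> r \<Longrightarrow> fm_partial_norm r m F \<le> (\<Sum>i\<in>UNIV. partial_norm r m (F $ i))"
  unfolding partial_norm_def fm_partial_norm_def
  by (subst sum.swap, unfold sum_distrib_right[symmetric])
    (intro sum_mono mult_right_mono fm_degree_norm_le_sum, auto)

lemma fm_partial_norm_id_minus:
  fixes F :: "'n::finite fmap"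
  assumes r: "0 \<le> r"
  shows "fm_partial_norm r m (fm_id - F) \<le> real CARD('n) * r + fm_partial_norm r m F"
proof -
  have "fm_partial_norm r m (fm_id - F)
      \<le> (\<Sum>j\<le>m. ((if j = 1 then real CARD('n) else 0) + fm_degree_norm j F) * r ^ j)"
    unfolding fm_partial_norm_def using r
    by (intro sum_mono mult_right_mono order.trans[OF fm_degree_norm_diff] add_right_mono
        fm_degree_norm_id_le) auto
  also have "\<dots> = (\<Sum>j\<le>m. (if j = 1 then real CARD('n) else 0) * r ^ j) + fm_partial_norm r m F"
    by (simp add: fm_partial_norm_def distrib_right sum.distrib)
  also have "(\<Sum>j\<le>m. (if j = 1 then real CARD('n) else 0) * r ^ j)
      = (\<Sum>j\<le>m. if j = 1 then real CARD('n) * r else 0)"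
    by (intro sum.cong) auto
  also have "\<dots> \<le> real CARD('n) * r"
    using r by simp
  finally show ?thesis by simp
qed

lemma coeff_le_fm_partial_norm:
  fixes F :: "'n::finite fmap"
  assumes r: "0 < r" and a: "mi_size a \<le> m"
  shows "cmod (mfps_nth (F $ i) a) \<le> fm_partial_norm r m F * (real CARD('n) / r) ^ mi_size a"
proof -
  let ?s = "mi_size a"
  have M: "1 \<le> multinomial a" by (rule multinomial_ge_1)
  have "cmod (mfps_nth (F $ i) a) / sqrt (multinomial a) \<le> fm_degree_norm ?s F"
    unfolding fm_degree_norm_def
    using member_le_L2_set[of "coeffs_of_degree ?s" "(i, a)"
        "\<lambda>x. cmod (mfps_nth (F $ fst x) (snd x)) / sqrt (multinomial (snd x))"]
    by (simp add: coeffs_of_degree_def)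
  also have "fm_degree_norm ?s F * r ^ ?s \<le> fm_partial_norm r m F"
    unfolding fm_partial_norm_def
    using member_le_sum[of ?s "{..m}" "\<lambda>j. fm_degree_norm j F * r ^ j"] a r by simp
  then have "fm_degree_norm ?s F \<le> fm_partial_norm r m F / r ^ ?s"
    using r by (simp add: field_simps)
  finally have "cmod (mfps_nth (F $ i) a) \<le> fm_partial_norm r m F / r ^ ?s * sqrt (multinomial a)"
    using M by (simp add: field_simps)
  also have "\<dots> \<le> fm_partial_norm r m F / r ^ ?s * real CARD('n) ^ ?s"
  proof (rule mult_left_mono)
    have "sqrt (multinomial a) \<le> multinomial a" using M by (simp add: real_le_lsqrt power2_eq_square)
    then show "sqrt (multinomial a) \<le> real CARD('n) ^ ?s" using multinomial_le[of a] by linarith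
  qed (use r fm_partial_norm_nonneg[of r m F] in auto)
  finally show ?thesis by (simp add: power_divide)
qed

lemma fm_partial_norm_graded_op:
  assumes r: "0 \<le> r" and p: "\<And>m F. fm_degree_norm m (graded_op p F) \<le> fm_degree_norm m F"
  shows "fm_partial_norm r m (graded_op p F) \<le> fm_partial_norm r m F"
  unfolding fm_partial_norm_def using r by (intro sum_mono mult_right_mono p) auto

lemma card_mi_size: "card {a :: nat ^ 'n::finite. mi_size a = l} \<le> CARD('n) ^ l"
proof (induction l)
  case (Suc l)
  have "{a :: nat ^ 'n. mi_size a = Suc l} \<subseteq> (\<lambda>(b, j). b + axis j 1) ` ({a. mi_size a = l} \<times> UNIV)"
  proof
    fix a :: "nat ^ 'n" assume a: "a \<in> {a. mi_size a = Suc l}"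
    then have "a \<noteq> 0" by auto
    then obtain b j where "a = b + axis j 1" by (rule mi_decompose)
    with a show "a \<in> (\<lambda>(b, j). b + axis j 1) ` ({a. mi_size a = l} \<times> UNIV)" by force
  qed
  then have "card {a :: nat ^ 'n. mi_size a = Suc l} \<le> card ({a :: nat ^ 'n. mi_size a = l} \<times> (UNIV :: 'n set))"
    by (rule surj_card_le[rotated]) simp
  also have "\<dots> \<le> CARD('n) ^ Suc l" using Suc by (simp add: card_cartesian_product)
  finally show ?case .
qed simp

lemma sum_mi_size_le:
  assumes "\<And>l. 0 \<le> g l"
  shows "(\<Sum>a\<in>{a :: nat ^ 'n::finite. mi_size a \<le> m}. g (mi_size a)) \<le> (\<Sum>l\<le>m. real CARD('n) ^ l * g l)"
proof -
  have "(\<Sum>a\<in>{a :: nat ^ 'n. mi_size a \<le> m}. g (mi_size a))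
      = (\<Sum>l\<le>m. \<Sum>a\<in>{a \<in> {a :: nat ^ 'n. mi_size a \<le> m}. mi_size a = l}. g (mi_size a))"
    by (rule sum.group[symmetric]) auto
  also have "\<dots> \<le> (\<Sum>l\<le>m. real CARD('n) ^ l * g l)"
  proof (rule sum_mono)
    fix l
    have "(\<Sum>a\<in>{a \<in> {a :: nat ^ 'n. mi_size a \<le> m}. mi_size a = l}. g (mi_size a))
        \<le> (\<Sum>a\<in>{a :: nat ^ 'n. mi_size a = l}. g l)"
      using assms by (intro order.trans[OF eq_refl sum_mono2]) auto
    also have "\<dots> = real (card {a :: nat ^ 'n. mi_size a = l}) * g l" by simp
    also have "\<dots> \<le> real CARD('n) ^ l * g l"
      using card_mi_size[where 'n = 'n, of l] assms[of l]
      by (intro mult_right_mono) (simp_all flip: of_nat_power)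
    finally show "(\<Sum>a\<in>{a \<in> {a :: nat ^ 'n. mi_size a \<le> m}. mi_size a = l}. g (mi_size a))
        \<le> real CARD('n) ^ l * g l" .
  qed
  finally show ?thesis .
qed

text \<open>The tail of order \<open>k\<close> of a geometric series with ratio at most \<open>1/2\<close>. The cut-off is written
  into the summand, so that it can stand for the order of a power series.\<close>

lemma sum_geometric_le:
  fixes x :: real
  assumes "0 \<le> x" "x \<le> 1/2"
  shows "(\<Sum>l\<le>m. if l < k then 0 else x ^ l) \<le> 2 * x ^ k"
proof -
  have "(\<Sum>l\<le>m. if l < k then 0 else x ^ l) = (\<Sum>l\<in>{k..m}. x ^ l)"
    by (rule sum.mono_neutral_cong_right) auto
  also have "\<dots> \<le> (\<Sum>l\<in>{k..m+k}. x ^ l)" by (rule sum_mono2) (use assms in auto)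
  also have "\<dots> = (\<Sum>l\<le>m. x ^ (l + k))"
    by (rule sum.reindex_bij_witness[of _ "\<lambda>l. l + k" "\<lambda>l. l - k"]) auto
  also have "\<dots> = x ^ k * (\<Sum>l\<le>m. x ^ l)" by (simp add: power_add sum_distrib_left mult.commute)
  also have "\<dots> \<le> x ^ k * 2"
  proof (rule mult_left_mono)
    have "(\<Sum>l\<le>m. x ^ l) \<le> (\<Sum>l\<le>m. (1/2) ^ l)" by (intro sum_mono power_mono assms)
    also have "\<dots> \<le> (2::real)"
    proof -
      have "(\<Sum>l\<le>m. (1/2::real) ^ l) = 2 - (1/2) ^ m" by (induction m) (auto simp: One_nat_def)
      then show ?thesis by simp
    qed
    finally show "(\<Sum>l\<le>m. x ^ l) \<le> 2" .
  qed (use assms in auto)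
  finally show ?thesis by simp
qed

definition geometrically_bounded :: "real \<Rightarrow> 'n::finite fmap \<Rightarrow> bool" where
  "geometrically_bounded R F \<longleftrightarrow> (\<forall>i a. cmod (mfps_nth (F $ i) a) \<le> R ^ mi_size a)"

lemma fm_partial_norm_comp:
  fixes F G :: "'n::finite fmap"
  assumes r: "0 \<le> r" and R: "0 \<le> R" "geometrically_bounded R F" and F: "fm_order_ge k F"
    and G: "fm_order_ge 1 G" and Y: "fm_partial_norm r m G \<le> Y" "real CARD('n) * R * Y \<le> 1/2"
  shows "fm_partial_norm r m (fm_comp F G) \<le> 2 * real CARD('n) * (real CARD('n) * R * Y) ^ k"
proof -
  let ?n = "real CARD('n)"
  have Y0: "0 \<le> Y" using fm_partial_norm_nonneg[OF r, of m G] Y(1) by linarith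
  have i: "partial_norm r m (fm_comp F G $ i) \<le> 2 * (?n * R * Y) ^ k" for i
  proof -
    have "partial_norm r m (fm_comp F G $ i)
        \<le> (\<Sum>b | mi_size b \<le> m. cmod (mfps_nth (F $ i) b) * Y ^ mi_size b)"
      unfolding fm_comp_nth
      by (rule partial_norm_compose[OF r])
        (use G in \<open>auto simp: fm_order_ge_iff intro: order.trans[OF partial_norm_le_fm[OF r] Y(1)]\<close>)
    also have "\<dots> \<le> (\<Sum>b\<in>{b :: nat ^ 'n. mi_size b \<le> m}. if mi_size b < k then 0 else R ^ mi_size b * Y ^ mi_size b)"
      using R(2) F Y0
      by (intro sum_mono) (auto simp: geometrically_bounded_def fm_order_ge_def intro!: mult_right_mono)
    also have "\<dots> \<le> (\<Sum>l\<le>m. ?n ^ l * (if l < k then 0 else R ^ l * Y ^ l))"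
      by (rule sum_mi_size_le) (use R Y0 in auto)
    also have "\<dots> = (\<Sum>l\<le>m. if l < k then 0 else (?n * R * Y) ^ l)"
      by (intro sum.cong) (auto simp: power_mult_distrib)
    also have "\<dots> \<le> 2 * (?n * R * Y) ^ k"
      by (rule sum_geometric_le) (use R Y Y0 in auto)
    finally show ?thesis .
  qed
  have "fm_partial_norm r m (fm_comp F G) \<le> (\<Sum>i\<in>(UNIV :: 'n set). 2 * (?n * R * Y) ^ k)"
    by (rule order.trans[OF fm_partial_norm_le_sum[OF r] sum_mono]) (rule i)
  then show ?thesis by (simp add: mult_ac)
qed

text \<open>Write \<open>n = CARD('n)\<close>. If the norm of an iterate \<open>c\<close> is at most \<open>2 * n * r\<close>, then \<open>fm_comp G c\<close> is
  quadratic in this quantity, because \<open>G\<close> has order at least \<open>2\<close>, hence at most \<open>n * r\<close> for small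
  \<open>r\<close>. The map \<open>fm_id\<close> contributes \<open>n * r\<close>, and \<open>graded_op p\<close> is a contraction, so that the bound
  persists.\<close>

lemma fixed_point_geometrically_bounded:
  fixes G :: "'n::finite fmap"
  assumes p: "\<And>m F. fm_degree_norm m (graded_op p F) \<le> fm_degree_norm m F"
    and G: "fm_order_ge 2 G" and R: "1 \<le> R" "geometrically_bounded R G"
  shows "\<exists>R'\<ge>1. geometrically_bounded R' (fixed_point p G)"
proof -
  let ?n = "real CARD('n)"
  have "1 \<le> CARD('n)" using zero_less_card_finite[where 'a = 'n] by linarith
  then have n: "?n \<ge> 1" by simp
  \<comment> \<open>Chosen such that \<open>2 * n * (n * R * (2 * n * r)) ^ 2 = n * r\<close>.\<close>
  define r where "r = 1 / (8 * ?n ^ 4 * R ^ 2)"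
  have r: "0 < r" using n R by (simp add: r_def)
  have rR: "8 * ?n ^ 4 * R ^ 2 * r = 1" using n R by (simp add: r_def)
  have small: "?n * R * (2 * ?n * r) \<le> 1/2"
  proof -
    have "?n * R * (2 * ?n * r) = 1 / (4 * ?n ^ 2 * R)"
      using n R by (simp add: r_def field_simps power2_eq_square power4_eq_xxxx)
    also have "\<dots> \<le> 1 / 4"
      using mult_mono[of 1 "?n ^ 2" 1 R] n R by (simp add: divide_le_eq)
    finally show ?thesis by simp
  qed
  have bound: "fm_partial_norm r m (fixed_point_iterate p G j) \<le> 2 * ?n * r" for m j
  proof (induction j)
    case 0
    have "fm_partial_norm r m (fm_id - 0 :: 'n fmap) \<le> ?n * r + fm_partial_norm r m (0 :: 'n fmap)"
      by (rule fm_partial_norm_id_minus) (use r in auto)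
    moreover have "fm_partial_norm r m (0 :: 'n fmap) = 0"
      by (simp add: fm_partial_norm_def fm_degree_norm_def L2_set_def)
    moreover have "0 \<le> ?n * r" using r by simp
    ultimately show ?case by (simp add: mult.assoc)
  next
    case (Suc j)
    have "fm_partial_norm r m (fixed_point_iterate p G (Suc j))
        \<le> ?n * r + fm_partial_norm r m (graded_op p (fm_comp G (fixed_point_iterate p G j)))"
      unfolding fixed_point_iterate.simps by (rule fm_partial_norm_id_minus) (use r in auto)
    also have "\<dots> \<le> ?n * r + fm_partial_norm r m (fm_comp G (fixed_point_iterate p G j))"
      by (intro add_left_mono fm_partial_norm_graded_op p) (use r in auto)
    also have "\<dots> \<le> ?n * r + 2 * ?n * (?n * R * (2 * ?n * r)) ^ 2"
      by (intro add_left_mono fm_partial_norm_comp[OF _ _ R(2) G fixed_point_iterate_order[OF G] Suc small])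
        (use r R in auto)
    also have "2 * ?n * (?n * R * (2 * ?n * r)) ^ 2 = ?n * r * (8 * ?n ^ 4 * R ^ 2 * r)"
      by (simp add: power2_eq_square power4_eq_xxxx)
    finally show ?case unfolding rR by (simp add: mult_ac)
  qed
  have "geometrically_bounded (?n / r) (fixed_point p G)"
    unfolding geometrically_bounded_def
  proof (intro allI)
    fix i and a :: "nat ^ 'n"
    have "cmod (mfps_nth (fixed_point p G $ i) a)
        \<le> fm_partial_norm r (mi_size a) (fixed_point_iterate p G (mi_size a)) * (?n / r) ^ mi_size a"
      using coeff_le_fm_partial_norm[OF r order_refl, of "fixed_point_iterate p G (mi_size a)" i a]
      by (simp add: fixed_point_iterate_stable[OF G])
    also have "\<dots> \<le> 1 * (?n / r) ^ mi_size a"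
    proof (rule mult_right_mono)
      have "2 * ?n * r = 1 / (4 * ?n ^ 3 * R ^ 2)"
        using n R by (simp add: r_def field_simps power3_eq_cube power4_eq_xxxx)
      also have "\<dots> \<le> 1"
        using mult_mono[of 1 "?n ^ 3" 1 "R ^ 2"] n R by (simp add: divide_le_eq)
      finally show "fm_partial_norm r (mi_size a) (fixed_point_iterate p G (mi_size a)) \<le> 1"
        using bound[of "mi_size a" "mi_size a"] by linarith
    qed (use n r in auto)
    finally show "cmod (mfps_nth (fixed_point p G $ i) a) \<le> (?n / r) ^ mi_size a" by simp
  qed
  moreover have "1 \<le> ?n / r" 
  proof -
    have "?n / r = ?n * (8 * ?n ^ 4 * R ^ 2)" by (simp add: r_def)
    moreover have "1 \<le> ?n ^ 4 * R ^ 2" using mult_mono[of 1 "?n ^ 4" 1 "R ^ 2"] n R by simp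
    then have "1 * 1 \<le> ?n * (8 * ?n ^ 4 * R ^ 2)" using n by (intro mult_mono) auto
    ultimately show ?thesis by simp
  qed
  ultimately show ?thesis by blast
qed

section \<open>Convergent maps\<close>

lemma geometrically_bounded_mono:
  "geometrically_bounded R F \<Longrightarrow> 0 \<le> R \<Longrightarrow> R \<le> R' \<Longrightarrow> geometrically_bounded R' F"
  unfolding geometrically_bounded_def by (meson order.trans power_mono)

lemma prod_power_const: "(\<Prod>j\<in>UNIV. x ^ (a $ j)) = x ^ mi_size a"
  by (simp add: mi_size_def power_sum)

text \<open>There are at most \<open>CARD('n) ^ l\<close> multi-indices of size \<open>l\<close>, which a small polydisc compensates.\<close>

lemma geometrically_bounded_imp_converging:
  fixes F :: "'n::finite fmap"
  assumes R: "0 \<le> R" "geometrically_bounded R F"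
  shows "converging F"
proof -
  define n where "n = real CARD('n)"
  have n: "n \<ge> 0" by (simp add: n_def)
  define x where "x = 1 / (2 * (n + 1))"
  have x: "0 < x" "n * x \<le> 1/2" using n by (simp_all add: x_def field_simps)
  define e where "e = x / (R + 1)"
  have e: "0 < e" "R * e \<le> x" using x R by (simp_all add: e_def field_simps)
  have "(\<lambda>a. mfps_nth (F $ i) a * (\<Prod>j\<in>UNIV. (z $ j) ^ (a $ j))) summable_on UNIV"
    if z: "dist z 0 < e" for i and z :: "complex ^ 'n"
  proof -
    have term_le: "cmod (mfps_nth (F $ i) a * (\<Prod>j\<in>UNIV. (z $ j) ^ (a $ j))) \<le> x ^ mi_size a" for a
    proof -
      have "cmod (z $ j) \<le> e" for j
        using Finite_Cartesian_Product.norm_nth_le[of z j] z by (simp add: dist_norm)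
      then have "(\<Prod>j\<in>UNIV. cmod (z $ j) ^ (a $ j)) \<le> (\<Prod>j\<in>UNIV. e ^ (a $ j))"
        by (intro prod_mono conjI power_mono) auto
      then have "(\<Prod>j\<in>UNIV. cmod (z $ j) ^ (a $ j)) \<le> e ^ mi_size a" by (simp add: prod_power_const)
      then have "cmod (mfps_nth (F $ i) a) * (\<Prod>j\<in>UNIV. cmod (z $ j) ^ (a $ j))
          \<le> R ^ mi_size a * e ^ mi_size a"
        using R e by (intro mult_mono) (auto simp: geometrically_bounded_def intro!: prod_nonneg)
      also have "\<dots> \<le> x ^ mi_size a"
        unfolding power_mult_distrib[symmetric] using R e by (intro power_mono) auto
      finally show ?thesis by (simp add: norm_mult norm_power flip: prod_norm)
    qed
    have "(\<lambda>a. cmod (mfps_nth (F $ i) a * (\<Prod>j\<in>UNIV. (z $ j) ^ (a $ j)))) summable_on UNIV"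
    proof (rule nonneg_bdd_above_summable_on)
      show "bdd_above (sum (\<lambda>a. cmod (mfps_nth (F $ i) a * (\<Prod>j\<in>UNIV. (z $ j) ^ (a $ j))))
          ` {S. S \<subseteq> UNIV \<and> finite S})"
      proof (rule bdd_aboveI2)
        fix S :: "(nat ^ 'n) set" assume "S \<in> {S. S \<subseteq> UNIV \<and> finite S}"
        then have S: "finite S" by simp
        define m where "m = Max (insert 0 (mi_size ` S))"
        have "S \<subseteq> {a. mi_size a \<le> m}" using S by (auto simp: m_def)
        then have "(\<Sum>a\<in>S. cmod (mfps_nth (F $ i) a * (\<Prod>j\<in>UNIV. (z $ j) ^ (a $ j))))
            \<le> (\<Sum>a\<in>{a :: nat ^ 'n. mi_size a \<le> m}. cmod (mfps_nth (F $ i) a * (\<Prod>j\<in>UNIV. (z $ j) ^ (a $ j))))"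
          by (intro sum_mono2) auto
        also have "\<dots> \<le> (\<Sum>a\<in>{a :: nat ^ 'n. mi_size a \<le> m}. x ^ mi_size a)"
          by (intro sum_mono term_le)
        also have "\<dots> \<le> (\<Sum>l\<le>m. real CARD('n) ^ l * x ^ l)"
          by (rule sum_mi_size_le) (use x in auto)
        also have "\<dots> = (\<Sum>l\<le>m. if l < 0 then 0 else (n * x) ^ l)"
          by (simp add: n_def power_mult_distrib)
        also have "\<dots> \<le> 2 * (n * x) ^ 0"
          by (rule sum_geometric_le) (use x n in auto)
        finally show "(\<Sum>a\<in>S. cmod (mfps_nth (F $ i) a * (\<Prod>j\<in>UNIV. (z $ j) ^ (a $ j)))) \<le> 2" by simp
      qed
    qed auto
    then show ?thesis by (rule abs_summable_summable)
  qed
  then show ?thesis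
    unfolding converging_def eventually_nhds_metric using e(1) by blast
qed

text \<open>There is no constant term, and \<open>M \<le> M ^ m\<close> in all orders \<open>m \<ge> 1\<close>.\<close>

lemma geometrically_bounded_absorb:
  fixes F :: "'n::finite fmap"
  assumes F: "fm_order_ge 1 F" and R: "0 \<le> R" and M: "1 \<le> M"
    and b: "\<And>i a. cmod (mfps_nth (F $ i) a) \<le> M * R ^ mi_size a"
  shows "geometrically_bounded (M * R) F"
  unfolding geometrically_bounded_def
proof (intro allI)
  fix i and a :: "nat ^ 'n"
  show "cmod (mfps_nth (F $ i) a) \<le> (M * R) ^ mi_size a"
  proof (cases "mi_size a = 0")
    case True
    then show ?thesis using F by (simp add: fm_order_ge_def)
  next
    case False
    then have "M \<le> M ^ mi_size a" using self_le_power[OF M, of "mi_size a"] by (simp del: mi_size_eq_0_iff)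
    then have "M * R ^ mi_size a \<le> M ^ mi_size a * R ^ mi_size a"
      using R by (intro mult_right_mono) auto
    then show ?thesis using b[of i a] by (simp add: power_mult_distrib)
  qed
qed

text \<open>The terms of the series are bounded at a point all of whose coordinates equal one small \<open>d > 0\<close>.\<close>

lemma converging_imp_geometrically_bounded:
  fixes F :: "'n::finite fmap"
  assumes F: "fm_order_ge 1 F" and "converging F"
  obtains R where "1 \<le> R" "geometrically_bounded R F"
proof -
  obtain e where e: "e > 0" "\<And>z i. dist z 0 < e \<Longrightarrow>
      (\<lambda>a. mfps_nth (F $ i) a * (\<Prod>j\<in>UNIV. (z $ j) ^ (a $ j))) summable_on UNIV"
    using assms(2) unfolding converging_def eventually_nhds_metric by blast
  define d where "d = min 1 (e / (real CARD('n) + 1))"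
  have d: "0 < d" "d \<le> 1" "real CARD('n) * d < e"
  proof -
    show "0 < d" "d \<le> 1" using e by (auto simp: d_def)
    have "real CARD('n) * d \<le> real CARD('n) * (e / (real CARD('n) + 1))"
      by (intro mult_left_mono) (auto simp: d_def)
    also have "\<dots> < e" using e by (simp add: field_simps)
    finally show "real CARD('n) * d < e" .
  qed
  define z :: "complex ^ 'n" where "z = (\<chi> j. of_real d)"
  have "dist z 0 < e"
  proof -
    have "norm z \<le> (\<Sum>j\<in>UNIV. norm (z $ j))" unfolding norm_vec_def by (rule L2_set_le_sum) auto
    also have "\<dots> = real CARD('n) * d" using d by (simp add: z_def)
    finally show ?thesis using d by simp
  qed
  then have sm: "(\<lambda>a. norm (mfps_nth (F $ i) a * (\<Prod>j\<in>UNIV. (z $ j) ^ (a $ j)))) summable_on UNIV" for i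
    by (intro iffD1[OF summable_on_iff_abs_summable_on_complex] e(2))
  define M where "M = (\<Sum>i\<in>UNIV. infsum (\<lambda>a. norm (mfps_nth (F $ i) a * (\<Prod>j\<in>UNIV. (z $ j) ^ (a $ j)))) UNIV) + 1"
  have nonneg: "0 \<le> infsum (\<lambda>a. norm (mfps_nth (F $ i) a * (\<Prod>j\<in>UNIV. (z $ j) ^ (a $ j)))) UNIV" for i
    by (rule infsum_nonneg) auto
  have M: "1 \<le> M" using nonneg by (simp add: M_def sum_nonneg)
  have "cmod (mfps_nth (F $ i) a) \<le> M * (1 / d) ^ mi_size a" for i and a :: "nat ^ 'n"
  proof -
    have "cmod (mfps_nth (F $ i) a) * d ^ mi_size a = norm (mfps_nth (F $ i) a * (\<Prod>j\<in>UNIV. (z $ j) ^ (a $ j)))"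
      using d by (simp add: z_def prod_power_const norm_mult norm_power)
    also have "\<dots> \<le> infsum (\<lambda>a. norm (mfps_nth (F $ i) a * (\<Prod>j\<in>UNIV. (z $ j) ^ (a $ j)))) UNIV"
      using finite_sum_le_infsum[OF sm[of i], of "{a}"] by simp
    also have "\<dots> \<le> (\<Sum>i\<in>UNIV. infsum (\<lambda>a. norm (mfps_nth (F $ i) a * (\<Prod>j\<in>UNIV. (z $ j) ^ (a $ j)))) UNIV)"
      by (rule member_le_sum) (use nonneg in auto)
    finally have "cmod (mfps_nth (F $ i) a) * d ^ mi_size a \<le> M" by (simp add: M_def)
    then show ?thesis using d by (simp add: field_simps power_divide)
  qed
  then have "geometrically_bounded (M * (1 / d)) F"
    using F M d by (intro geometrically_bounded_absorb) auto
  moreover have "1 \<le> M * (1 / d)"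
    using d M mult_mono[of 1 M 1 "1 / d"] by simp
  ultimately show ?thesis using that by blast
qed

text \<open>Since \<open>G\<close> has no constant term, its norm is \<open>O(r)\<close>, so that for small \<open>r\<close> it lies where the
  geometric majorant of \<open>F\<close> converges.\<close>

lemma geometrically_bounded_comp:
  fixes F G :: "'n::finite fmap"
  assumes F: "fm_order_ge 1 F" "1 \<le> R" "geometrically_bounded R F"
    and G: "fm_order_ge 1 G" "1 \<le> S" "geometrically_bounded S G"
  shows "\<exists>T\<ge>1. geometrically_bounded T (fm_comp F G)"
proof -
  let ?n = "real CARD('n)"
  have "1 \<le> CARD('n)" using zero_less_card_finite[where 'a = 'n] by linarith
  then have n: "?n \<ge> 1" by simp
  \<comment> \<open>With this radius the bound \<open>Y\<close> for \<open>G\<close> satisfies \<open>n * R * Y = 1 / (4 * n)\<close>.\<close>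
  define r where "r = 1 / (8 * ?n ^ 4 * S * R)"
  have pos: "8 * ?n ^ 4 * S * R > 0" using n F G by simp
  have r: "0 < r" using n F G by (simp add: r_def)
  define Y where "Y = 2 * ?n ^ 2 * S * r"
  have nY: "?n * R * Y \<le> 1/2"
  proof -
    have "?n * R * Y = 1 / (4 * ?n)"
      using n F G by (simp add: Y_def r_def field_simps power2_eq_square power4_eq_xxxx)
    also have "\<dots> \<le> 1/2" using n by (simp add: divide_le_eq)
    finally show ?thesis .
  qed
  have small: "?n * S * r \<le> 1/2"
  proof -
    have "?n * S * r = 1 / (8 * ?n ^ 3 * R)"
      using n F G by (simp add: r_def field_simps power3_eq_cube power4_eq_xxxx)
    also have "\<dots> \<le> 1/2" using n F mult_mono[of 1 "?n ^ 3" 1 R] by (simp add: divide_le_eq mult_ac)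
    finally show ?thesis .
  qed
  have "fm_partial_norm r m G \<le> Y" for m
  proof -
    have "partial_norm r m (G $ i) \<le> 2 * (?n * S * r) ^ 1" for i
    proof -
      have "degree_norm j (G $ i) * r ^ j \<le> (if j < 1 then 0 else (?n * S * r) ^ j)" for j
      proof (cases "j < 1")
        case True
        then have "degree_norm j (G $ i) = degree_norm j (0 :: (complex, 'n) mfps)"
          using G by (intro degree_norm_cong) (auto simp: fm_order_ge_def)
        then show ?thesis using True by simp
      next
        case False
        have "degree_norm j (G $ i) \<le> (\<Sum>a | mi_size a = j. cmod (mfps_nth (G $ i) a) / sqrt (multinomial a))"
          unfolding degree_norm_def by (rule L2_set_le_sum) (simp add: multinomial_nonneg)
        also have "\<dots> \<le> (\<Sum>a\<in>{a :: nat ^ 'n. mi_size a = j}. S ^ j / 1)"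
          using G multinomial_ge_1 by (intro sum_mono frac_le) (auto simp: geometrically_bounded_def)
        also have "\<dots> \<le> ?n ^ j * S ^ j"
          using card_mi_size[where 'n = 'n, of j] G by (auto intro!: mult_right_mono simp flip: of_nat_power)
        finally have "degree_norm j (G $ i) * r ^ j \<le> ?n ^ j * S ^ j * r ^ j"
          using r by (intro mult_right_mono) auto
        then show ?thesis using False by (simp add: power_mult_distrib)
      qed
      then have "partial_norm r m (G $ i) \<le> (\<Sum>j\<le>m. if j < 1 then 0 else (?n * S * r) ^ j)"
        unfolding partial_norm_def by (intro sum_mono)
      also have "\<dots> \<le> 2 * (?n * S * r) ^ 1"
        by (rule sum_geometric_le) (use n G r small in auto)
      finally show ?thesis .
    qed
    then have "(\<Sum>i\<in>(UNIV :: 'n set). partial_norm r m (G $ i)) \<le> (\<Sum>i\<in>(UNIV :: 'n set). 2 * (?n * S * r) ^ 1)"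
      by (intro sum_mono)
    then show ?thesis
      using fm_partial_norm_le_sum[of r m G] r by (simp add: Y_def power2_eq_square mult_ac)
  qed
  then have *: "fm_partial_norm r m (fm_comp F G) \<le> 2 * ?n * (?n * R * Y) ^ 1" for m
    using fm_partial_norm_comp[OF _ _ F(3,1) G(1) _ nY, of r m] r F by simp
  have "2 * ?n * (?n * R * Y) ^ 1 \<le> 2 * ?n * (1/2)"
    using nY by (intro mult_left_mono) auto
  then have **: "fm_partial_norm r m (fm_comp F G) \<le> ?n" for m
    using order.trans[OF *[of m]] by simp
  have "geometrically_bounded (?n * (?n / r)) (fm_comp F G)"
  proof (rule geometrically_bounded_absorb)
    fix i and a :: "nat ^ 'n"
    show "cmod (mfps_nth (fm_comp F G $ i) a) \<le> ?n * (?n / r) ^ mi_size a"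
      using coeff_le_fm_partial_norm[OF r order_refl, of "fm_comp F G" i a]
        mult_right_mono[OF **[of "mi_size a"], of "(?n / r) ^ mi_size a"] r
      by (meson divide_nonneg_nonneg less_imp_le of_nat_0_le_iff order.trans zero_le_power)
  qed (use F G n r in \<open>auto intro: fm_order_ge_comp\<close>)
  then have "geometrically_bounded (max 1 (?n * (?n / r))) (fm_comp F G)"
    by (rule geometrically_bounded_mono) (use r in auto)
  then show ?thesis by (intro exI[of _ "max 1 (?n * (?n / r))"]) auto
qed

lemma converging_comp:
  assumes "fm_order_ge 1 F" "converging F" "fm_order_ge 1 G" "converging G"
  shows "converging (fm_comp F G)"
proof -
  obtain R S where "1 \<le> R" "geometrically_bounded R F" "1 \<le> S" "geometrically_bounded S G"
    using converging_imp_geometrically_bounded assms by metis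
  then obtain T where "T \<ge> 1" "geometrically_bounded T (fm_comp F G)"
    using geometrically_bounded_comp assms by metis
  then show ?thesis by (intro geometrically_bounded_imp_converging[of T]) auto
qed

lemma geometrically_bounded_diff_id:
  assumes R: "1 \<le> R" "geometrically_bounded R F" and F: "F \<in> G_hat0"
  shows "geometrically_bounded R (F - fm_id)"
  unfolding geometrically_bounded_def
proof (intro allI)
  fix i and a :: "nat ^ 'a"
  show "cmod (mfps_nth ((F - fm_id) $ i) a) \<le> R ^ mi_size a"
  proof (cases "mi_size a < 2")
    case True
    then show ?thesis using F R by (simp add: G_hat0_iff fm_order_ge_def)
  next
    case False
    then have "mfps_nth (fm_id $ i) a = 0" by (auto simp: fm_id_def)
    then show ?thesis using R by (simp add: geometrically_bounded_def)
  qed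
qed

lemma converging_fixed_point:
  assumes p: "\<And>m F. fm_degree_norm m (graded_op p F) \<le> fm_degree_norm m F"
    and g: "g \<in> G_hat0" "converging g"
  shows "converging (fixed_point p (g - fm_id))"
proof -
  obtain R where R: "1 \<le> R" "geometrically_bounded R g"
    using converging_imp_geometrically_bounded g G_hat0_order by metis
  have "geometrically_bounded R (g - fm_id)" by (rule geometrically_bounded_diff_id[OF R g(1)])
  then obtain R' where "1 \<le> R'" "geometrically_bounded R' (fixed_point p (g - fm_id))"
    using fixed_point_geometrically_bounded[OF p, of "g - fm_id" R] R g by (auto simp: G_hat0_iff)
  then show ?thesis by (intro geometrically_bounded_imp_converging[of R']) auto
qed

lemma converging_inv: "g \<in> G_hat0 \<Longrightarrow> converging g \<Longrightarrow> converging (fm_inv g)"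
  using converging_fixed_point[of id_kernel g] by (simp add: fm_inv_eq_fixed_point graded_op_id)

section \<open>The orthogonal projection onto the centralizer\<close>

text \<open>The matrix \<open>p\<close> describes the orthogonal projection of the functions on \<open>S\<close>, with the inner product
  weighted by \<open>w\<close>, onto the common kernel of the functionals with coefficient vectors in \<open>V\<close>.\<close>

definition kernel_projection ::
  "'s set \<Rightarrow> ('s \<Rightarrow> real) \<Rightarrow> ('s \<Rightarrow> complex) set \<Rightarrow> ('s \<Rightarrow> 's \<Rightarrow> complex) \<Rightarrow> bool" where
  "kernel_projection S w V p \<longleftrightarrow>
    (\<forall>f. \<forall>v\<in>V. (\<Sum>x\<in>S. v x * (\<Sum>y\<in>S. p x y * f y)) = 0) \<and>
    (\<forall>f. (\<forall>v\<in>V. (\<Sum>x\<in>S. v x * f x) = 0) \<longrightarrow> (\<forall>x\<in>S. (\<Sum>y\<in>S. p x y * f y) = f x)) \<and>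
    (\<forall>f g. (\<forall>v\<in>V. (\<Sum>x\<in>S. v x * g x) = 0) \<longrightarrow>
      (\<Sum>x\<in>S. of_real (w x) * (f x - (\<Sum>y\<in>S. p x y * f y)) * cnj (g x)) = 0)"

lemma kernel_projectionD:
  assumes "kernel_projection S w V p"
  shows "v \<in> V \<Longrightarrow> (\<Sum>x\<in>S. v x * (\<Sum>y\<in>S. p x y * f y)) = 0"
    and "\<forall>v\<in>V. (\<Sum>x\<in>S. v x * f x) = 0 \<Longrightarrow> x \<in> S \<Longrightarrow> (\<Sum>y\<in>S. p x y * f y) = f x"
    and "\<forall>v\<in>V. (\<Sum>x\<in>S. v x * g x) = 0 \<Longrightarrow>
      (\<Sum>x\<in>S. of_real (w x) * (f x - (\<Sum>y\<in>S. p x y * f y)) * cnj (g x)) = 0"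
  using assms unfolding kernel_projection_def by simp_all

text \<open>Gram--Schmidt: a further functional \<open>v\<close> cuts the kernel down by at most one dimension, spanned by
  the projection \<open>u\<close> of the vector that represents \<open>v\<close>.\<close>

lemma kernel_projection_exists:
  fixes S :: "'s set" and w :: "'s \<Rightarrow> real" and V :: "('s \<Rightarrow> complex) set"
  assumes S: "finite S" and w: "\<And>x. x \<in> S \<Longrightarrow> w x > 0" and V: "finite V"
  shows "\<exists>p. kernel_projection S w V p"
  using V
proof (induction V rule: finite_induct)
  case empty
  have "(\<Sum>y\<in>S. (if x = y then 1 else 0) * f y) = f x" if "x \<in> S" for x and f :: "'s \<Rightarrow> complex"
  proof -
    have "(\<Sum>y\<in>S. (if x = y then 1 else 0) * f y) = (\<Sum>y\<in>S. if x = y then f y else 0)"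
      by (intro sum.cong) auto
    then show ?thesis using that S by simp
  qed
  then show ?case
    by (intro exI[of _ "\<lambda>x y. if x = y then 1 else 0"]) (simp add: kernel_projection_def)
next
  case (insert v V)
  then obtain p where p': "kernel_projection S w V p" by blast
  note p = kernel_projectionD[OF p']
  define ip where "ip f g = (\<Sum>x\<in>S. of_real (w x) * f x * cnj (g x))" for f g :: "'s \<Rightarrow> complex"
  define P where "P f x = (\<Sum>y\<in>S. p x y * f y)" for f x
  define v' where "v' x = cnj (v x) / of_real (w x)" for x
  define u where "u = P v'"
  have ip_diff: "ip (\<lambda>x. f x - f' x) g = ip f g - ip f' g" for f f' g
    by (simp add: ip_def algebra_simps sum_subtractf)
  have ip_mult: "ip (\<lambda>x. c * f x) g = c * ip f g" for c f g
    by (simp add: ip_def sum_distrib_left mult_ac)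
  have ip_cnj: "cnj (ip f g) = ip g f" for f g
    by (simp add: ip_def mult_ac)
  have P1: "\<forall>u\<in>V. (\<Sum>x\<in>S. u x * P f x) = 0" for f
    using p(1) unfolding P_def by blast
  have P2: "P f x = f x" if "\<forall>u\<in>V. (\<Sum>x\<in>S. u x * f x) = 0" "x \<in> S" for f x
    using p(2)[OF that] by (simp add: P_def)
  have P3: "ip (\<lambda>x. f x - P f x) g = 0" if "\<forall>u\<in>V. (\<Sum>x\<in>S. u x * g x) = 0" for f g
    using p(3)[OF that] unfolding ip_def P_def by simp
  \<comment> \<open>On the subspace annihilated by \<open>V\<close>, the functional \<open>v\<close> is the inner product with \<open>u\<close>.\<close>
  have v_ip: "(\<Sum>x\<in>S. v x * g x) = ip g u" if g: "\<forall>u\<in>V. (\<Sum>x\<in>S. u x * g x) = 0" for g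
  proof -
    have "(\<Sum>x\<in>S. v x * g x) = ip g v'"
      unfolding ip_def v'_def by (intro sum.cong refl) (use w in \<open>auto simp: field_simps less_imp_neq[symmetric]\<close>)
    moreover have "ip g v' - ip g u = cnj (ip (\<lambda>x. v' x - P v' x) g)"
      unfolding ip_diff by (simp add: ip_cnj u_def)
    ultimately show ?thesis using P3[OF g, of v'] by simp
  qed
  have uV: "\<forall>x\<in>V. (\<Sum>y\<in>S. x y * u y) = 0" unfolding u_def by (rule P1)
  show ?case
  proof (cases "ip u u = 0")
    case True
    have "ip u u = of_real (\<Sum>x\<in>S. w x * (cmod (u x))\<^sup>2)"
      unfolding ip_def of_real_sum
      by (intro sum.cong) (simp_all add: mult.assoc flip: complex_norm_square)
    then have "(\<Sum>x\<in>S. w x * (cmod (u x))\<^sup>2) = 0"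
      using True by (metis of_real_eq_0_iff)
    then have "\<forall>x\<in>S. w x * (cmod (u x))\<^sup>2 = 0"
      using S w by (subst (asm) sum_nonneg_eq_0_iff) (auto simp: less_imp_le)
    then have "u x = 0" if "x \<in> S" for x using that w[OF that] by fastforce
    then have "ip g u = 0" for g by (simp add: ip_def)
    then have triv: "(\<Sum>x\<in>S. v x * g x) = 0" if "\<forall>u\<in>V. (\<Sum>x\<in>S. u x * g x) = 0" for g
      using v_ip[OF that] by simp
    show ?thesis
      using P1 P2 P3 triv unfolding kernel_projection_def P_def ip_def
      by (intro exI[of _ p]) simp
  next
    case False
    define c where "c f = ip (P f) u / ip u u" for f
    define p' where "p' x y = p x y - u x * (\<Sum>z\<in>S. of_real (w z) * p z y * cnj (u z)) / ip u u" for x y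
    have P': "(\<Sum>y\<in>S. p' x y * f y) = P f x - c f * u x" for f x
    proof -
      have "ip (P f) u = (\<Sum>y\<in>S. (\<Sum>z\<in>S. of_real (w z) * p z y * cnj (u z)) * f y)"
        unfolding ip_def P_def sum_distrib_left sum_distrib_right
        by (subst sum.swap) (simp add: mult_ac)
      then have "c f * u x = (\<Sum>y\<in>S. u x * (\<Sum>z\<in>S. of_real (w z) * p z y * cnj (u z)) / ip u u * f y)"
        by (simp add: c_def sum_distrib_left sum_divide_distrib mult_ac)
      then show ?thesis by (simp add: p'_def P_def left_diff_distrib sum_subtractf)
    qed
    have V0: "(\<Sum>x\<in>S. a x * (P f x - c f * u x)) = 0" if "a \<in> V" for a f
    proof -
      have "(\<Sum>x\<in>S. a x * (P f x - c f * u x)) = (\<Sum>x\<in>S. a x * P f x) - c f * (\<Sum>x\<in>S. a x * u x)"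
        by (simp add: algebra_simps sum_subtractf sum_distrib_left)
      then show ?thesis using P1[of f] uV that by simp
    qed
    have v0: "(\<Sum>x\<in>S. v x * (P f x - c f * u x)) = 0" for f
    proof -
      have "(\<Sum>x\<in>S. v x * (P f x - c f * u x)) = ip (\<lambda>x. P f x - c f * u x) u"
        by (rule v_ip) (use V0 in blast)
      also have "\<dots> = 0" unfolding ip_diff ip_mult using False by (simp add: c_def)
      finally show ?thesis .
    qed
    have id0: "P f x - c f * u x = f x" if f: "\<forall>u\<in>V. (\<Sum>x\<in>S. u x * f x) = 0" "(\<Sum>x\<in>S. v x * f x) = 0"
      and x: "x \<in> S" for f x
    proof -
      have "ip (P f) u = ip f u" unfolding ip_def by (intro sum.cong) (use P2[OF f(1)] in auto)
      also have "\<dots> = 0" using v_ip[OF f(1)] f(2) by simp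
      finally show ?thesis using P2[OF f(1) x] by (simp add: c_def)
    qed
    have orth: "ip (\<lambda>x. f x - (P f x - c f * u x)) g = 0"
      if g: "\<forall>u\<in>V. (\<Sum>x\<in>S. u x * g x) = 0" "(\<Sum>x\<in>S. v x * g x) = 0" for f g
    proof -
      have "ip u g = 0" using v_ip[OF g(1)] g(2) ip_cnj[of g u] by simp
      moreover have "ip (\<lambda>x. f x - P f x) g = 0" by (rule P3[OF g(1)])
      ultimately show ?thesis unfolding ip_diff ip_mult by simp
    qed
    show ?thesis
      unfolding kernel_projection_def
      by (rule exI[of _ p'], unfold P') (use V0 v0 id0 orth in \<open>simp add: ip_def\<close>)
  qed
qed

text \<open>Pythagoras.\<close>

lemma weighted_orthogonal_projection_contraction:
  fixes f Pf :: "'s \<Rightarrow> complex"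
  assumes "\<And>x. x \<in> S \<Longrightarrow> w x \<ge> 0"
    and orth: "(\<Sum>x\<in>S. of_real (w x) * (f x - Pf x) * cnj (Pf x)) = 0"
  shows "(\<Sum>x\<in>S. w x * (cmod (Pf x))\<^sup>2) \<le> (\<Sum>x\<in>S. w x * (cmod (f x))\<^sup>2)"
proof -
  have "(cmod (f x))\<^sup>2 = (cmod (Pf x))\<^sup>2 + (cmod (f x - Pf x))\<^sup>2 + 2 * Re ((f x - Pf x) * cnj (Pf x))" for x
    unfolding cmod_power2 by (simp add: power2_eq_square algebra_simps)
  then have "(\<Sum>x\<in>S. w x * (cmod (f x))\<^sup>2) = (\<Sum>x\<in>S. w x * (cmod (Pf x))\<^sup>2)
      + (\<Sum>x\<in>S. w x * (cmod (f x - Pf x))\<^sup>2) + 2 * Re (\<Sum>x\<in>S. of_real (w x) * (f x - Pf x) * cnj (Pf x))"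
    by (simp add: distrib_left sum.distrib sum_distrib_left mult.assoc mult.left_commute)
  moreover have "0 \<le> (\<Sum>x\<in>S. w x * (cmod (f x - Pf x))\<^sup>2)" using assms(1) by (intro sum_nonneg) auto
  ultimately show ?thesis using orth by simp
qed


definition commutes_with :: "complex ^ 'n ^ 'n \<Rightarrow> 'n::finite fmap \<Rightarrow> bool" where
  "commutes_with A F \<longleftrightarrow> fm_order_ge 1 F \<and> fm_comp F (fm_linear A) = fm_comp (fm_linear A) F"

lemma Cent_iff: "c \<in> Cent A \<longleftrightarrow> c \<in> G_hat0 \<and> commutes_with A c"
  using G_hat0_order by (auto simp: Cent_def commutes_with_def)

lemma commutes_with_id: "commutes_with A fm_id"
  by (simp add: commutes_with_def fm_order_ge_id fm_comp_id_left[OF fm_order_ge_linear])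

lemma fm_comp_linear_diff:
  assumes "fm_order_ge 1 F" "fm_order_ge 1 G"
  shows "fm_comp (fm_linear A) (F - G) = fm_comp (fm_linear A) F - fm_comp (fm_linear A) G"
  by (rule fmap_eqI)
    (simp add: fm_comp_linear_nth assms fm_order_ge_diff sum_subtractf right_diff_distrib del: fm_comp_nth)

lemma commutes_with_diff:
  "commutes_with A F \<Longrightarrow> commutes_with A G \<Longrightarrow> commutes_with A (F - G)"
  by (simp add: commutes_with_def fm_order_ge_diff fm_comp_diff_left fm_comp_linear_diff)

lemma mpow_linear_homogeneous:
  "mi_size b \<noteq> mi_size a \<Longrightarrow> mfps_nth (mpow (fm_linear A) a) b = 0"
proof (induction a arbitrary: b rule: mi_induct)
  case (add a j)
  have "mfps_nth (mpow (fm_linear A) a) x * mfps_nth (fm_linear A $ j) y = 0" if "x + y = b" for x y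
  proof (cases "mi_size y = 1")
    case True
    then have "mi_size x \<noteq> mi_size a" using that add.prems by auto
    then show ?thesis using add.IH by simp
  next
    case False
    then have "mfps_nth (fm_linear A $ j) y = 0" by (auto simp: fm_linear_nth intro!: sum.neutral)
    then show ?thesis by simp
  qed
  then show ?case unfolding mpow_add mpow_axis mfps_nth_mult by (intro sum.neutral) auto
qed auto

text \<open>The coefficients of the linear forms \<open>F \<mapsto> (F \<circ> A - A \<circ> F)\<^sub>y\<close>. Only coefficients of \<open>F\<close> of the
  degree of \<open>y\<close> occur, since \<open>A\<close> is linear.\<close>

definition commutator_functional ::
  "complex ^ 'n ^ 'n \<Rightarrow> 'n::finite \<times> (nat ^ 'n) \<Rightarrow> 'n \<times> (nat ^ 'n) \<Rightarrow> complex" where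
  "commutator_functional A y x = (if fst x = fst y then mfps_nth (mpow (fm_linear A) (snd x)) (snd y) else 0)
     - (if snd x = snd y then A $ fst y $ fst x else 0)"

lemma commutator_functional_sum:
  assumes F: "fm_order_ge 1 F"
  shows "(\<Sum>x\<in>coeffs_of_degree (mi_size b). commutator_functional A (i, b) x * mfps_nth (F $ fst x) (snd x))
    = mfps_nth ((fm_comp F (fm_linear A) - fm_comp (fm_linear A) F) $ i) b"
proof -
  let ?S = "{a :: nat ^ 'a. mi_size a = mi_size b}"
  have "(\<Sum>x\<in>coeffs_of_degree (mi_size b). commutator_functional A (i, b) x * mfps_nth (F $ fst x) (snd x))
      = (\<Sum>j\<in>UNIV. \<Sum>a\<in>?S. (if j = i then mfps_nth (mpow (fm_linear A) a) b * mfps_nth (F $ j) a else 0)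
          - (if a = b then A $ i $ j * mfps_nth (F $ j) a else 0))"
    by (auto simp: coeffs_of_degree_def sum.cartesian_product commutator_functional_def algebra_simps
        intro!: sum.cong)
  also have "\<dots> = (\<Sum>a\<in>?S. mfps_nth (mpow (fm_linear A) a) b * mfps_nth (F $ i) a)
      - (\<Sum>j\<in>UNIV. A $ i $ j * mfps_nth (F $ j) b)"
  proof -
    have "(\<Sum>j\<in>UNIV. \<Sum>a\<in>?S. if j = i then mfps_nth (mpow (fm_linear A) a) b * mfps_nth (F $ j) a else 0)
       = (\<Sum>j\<in>UNIV. if j = i then \<Sum>a\<in>?S. mfps_nth (mpow (fm_linear A) a) b * mfps_nth (F $ j) a else 0)"
      by (intro sum.cong) auto
    then show ?thesis unfolding sum_subtractf by simp
  qed
  also have "(\<Sum>a\<in>?S. mfps_nth (mpow (fm_linear A) a) b * mfps_nth (F $ i) a)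
      = mfps_nth (fm_comp F (fm_linear A) $ i) b"
    unfolding fm_comp_nth nth_compose'
    by (rule sum.mono_neutral_cong_left) (auto simp: mpow_linear_homogeneous mult.commute)
  finally show ?thesis using F by (simp add: fm_comp_linear_nth del: fm_comp_nth)
qed

text \<open>In each degree, commuting with \<open>A\<close> is expressed by finitely many linear equations. The
  projection is orthogonal for the Bombieri norm, since convergence requires an operator of norm at most
  \<open>1\<close> with respect to a submultiplicative norm; bounds that grow with the degree would act like
  derivatives.\<close>

lemma centralizer_projection:
  fixes A :: "complex ^ 'n::finite ^ 'n"
  obtains p where
    "\<And>F. fm_order_ge 1 F \<Longrightarrow> commutes_with A (graded_op p F)"
    "\<And>F. commutes_with A F \<Longrightarrow> graded_op p F = F"
    "\<And>m F. fm_degree_norm m (graded_op p F) \<le> fm_degree_norm m F"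
proof -
  let ?S = "coeffs_of_degree :: nat \<Rightarrow> ('n \<times> (nat ^ 'n)) set"
  define w :: "'n \<times> (nat ^ 'n) \<Rightarrow> real" where "w x = 1 / multinomial (snd x)" for x
  have w: "w x > 0" for x
    using multinomial_ge_1[of "snd x"] by (simp add: w_def)
  have "\<exists>p. kernel_projection (?S m) w (commutator_functional A ` ?S m) p" for m
    by (intro kernel_projection_exists) (use w in auto)
  then obtain P where P': "\<And>m. kernel_projection (?S m) w (commutator_functional A ` ?S m) (P m)"
    by metis
  note P = kernel_projectionD[OF P', unfolded ball_simps(9)]
  define p where "p x = P (mi_size (snd x)) x" for x
  have nth: "mfps_nth (graded_op p F $ fst x) (snd x) = (\<Sum>y\<in>?S m. P m x y * mfps_nth (F $ fst y) (snd y))"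
    if "x \<in> ?S m" for F x m
    using that by (auto simp: p_def coeffs_of_degree_def)
  have Sm: "x \<in> ?S (mi_size (snd x))" for x by (cases x) (simp add: coeffs_of_degree_def)
  have zero: "(\<Sum>x\<in>?S m. commutator_functional A y x * mfps_nth (graded_op p F $ fst x) (snd x)) = 0"
    if "y \<in> ?S m" for y m F
    using P(1)[OF imageI[OF that], of "\<lambda>x. mfps_nth (F $ fst x) (snd x)"] nth[of _ m F] by simp
  show ?thesis
  proof (rule that[of p])
    fix F :: "'n fmap" assume F: "fm_order_ge 1 F"
    then have o: "fm_order_ge 1 (graded_op p F)" by (rule graded_op_order)
    have "mfps_nth ((fm_comp (graded_op p F) (fm_linear A) - fm_comp (fm_linear A) (graded_op p F)) $ i) b = 0" for i b
      using commutator_functional_sum[OF o, of A i b] zero[OF Sm[of "(i, b)"], of F] by simp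
    then have "fm_comp (graded_op p F) (fm_linear A) = fm_comp (fm_linear A) (graded_op p F)"
      by (intro fmap_eqI) simp
    then show "commutes_with A (graded_op p F)" using o by (simp add: commutes_with_def)
  next
    fix F assume F: "commutes_with A F"
    show "graded_op p F = F"
    proof (rule fmap_eqI)
      fix i and a :: "nat ^ 'n"
      have "\<forall>y\<in>?S (mi_size a). (\<Sum>x\<in>?S (mi_size a). commutator_functional A y x * mfps_nth (F $ fst x) (snd x)) = 0"
      proof
        fix y assume that: "y \<in> ?S (mi_size a)"
        obtain j b where y: "y = (j, b)" by (cases y)
        with that have "mi_size b = mi_size a" by (simp add: coeffs_of_degree_def)
        then show "(\<Sum>x\<in>?S (mi_size a). commutator_functional A y x * mfps_nth (F $ fst x) (snd x)) = 0"
          using commutator_functional_sum[of F A j b] F by (simp add: commutes_with_def y del: fm_comp_nth)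
      qed
      from P(2)[OF this Sm[of "(i, a)", unfolded snd_conv]]
      show "mfps_nth (graded_op p F $ i) a = mfps_nth (F $ i) a"
        using nth[OF Sm[of "(i, a)"], of F] by simp
    qed
  next
    fix m and F :: "'n fmap"
    let ?f = "\<lambda>x. mfps_nth (F $ fst x) (snd x)"
    let ?Pf = "\<lambda>x. mfps_nth (graded_op p F $ fst x) (snd x)"
    have "(\<Sum>x\<in>?S m. w x * (cmod (?Pf x))\<^sup>2) \<le> (\<Sum>x\<in>?S m. w x * (cmod (?f x))\<^sup>2)"
    proof (rule weighted_orthogonal_projection_contraction)
      have "(\<Sum>x\<in>?S m. of_real (w x) * (?f x - ?Pf x) * cnj (?Pf x))
          = (\<Sum>x\<in>?S m. of_real (w x) * (?f x - (\<Sum>y\<in>?S m. P m x y * ?f y)) * cnj (?Pf x))"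
        by (intro sum.cong) (simp_all add: nth del: graded_op_nth)
      also have "\<dots> = 0" by (rule P(3)) (use zero in blast)
      finally show "(\<Sum>x\<in>?S m. of_real (w x) * (?f x - ?Pf x) * cnj (?Pf x)) = 0" .
    qed (use w in \<open>auto simp: less_imp_le\<close>)
    then show "fm_degree_norm m (graded_op p F) \<le> fm_degree_norm m F"
      by (simp add: fm_degree_norm_def L2_set_def w_def power_divide multinomial_nonneg del: graded_op_nth)
  qed
qed

section \<open>Normalized solutions of the conjugacy equation\<close>

text \<open>The solution \<open>g \<circ> c\<close>, with \<open>c\<close> in the centralizer, that \<open>graded_op p\<close> maps to the identity.\<close>

definition normalization ::
  "(('n::finite \<times> (nat ^ 'n)) \<Rightarrow> ('n \<times> (nat ^ 'n)) \<Rightarrow> complex) \<Rightarrow> 'n fmap \<Rightarrow> 'n fmap" where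
  "normalization p g = fm_comp g (fixed_point p (g - fm_id))"

context
  fixes A :: "complex ^ 'n::finite ^ 'n" and p
  assumes p1: "\<And>F. fm_order_ge 1 F \<Longrightarrow> commutes_with A (graded_op p F)"
    and p2: "\<And>F. commutes_with A F \<Longrightarrow> graded_op p F = F"
begin

lemma fixed_point_in_Cent:
  assumes g: "g \<in> G_hat0"
  shows "fixed_point p (g - fm_id) \<in> Cent A"
proof -
  have G: "fm_order_ge 2 (g - fm_id)" using g by (simp add: G_hat0_iff)
  let ?c = "fixed_point p (g - fm_id)"
  have "commutes_with A (graded_op p (fm_comp (g - fm_id) ?c))"
    using G by (intro p1 fm_order_ge_comp fixed_point_order) (auto intro: fm_order_ge_mono)
  then have "commutes_with A (fm_id - graded_op p (fm_comp (g - fm_id) ?c))"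
    by (intro commutes_with_diff commutes_with_id)
  then have "commutes_with A ?c" by (simp only: fixed_point_eq[OF G, symmetric])
  then show ?thesis using fixed_point_in_G_hat0[OF G] by (simp add: Cent_iff)
qed

text \<open>Split \<open>g \<circ> c = (g - fm_id) \<circ> c + c\<close> and use that the projection fixes \<open>c\<close>.\<close>

lemma normalized_iff_fixed_point:
  assumes g: "g \<in> G_hat0" and c: "c \<in> Cent A"
  shows "graded_op p (fm_comp g c) = fm_id \<longleftrightarrow> c = fixed_point p (g - fm_id)"
proof -
  have G: "fm_order_ge 2 (g - fm_id)" using g by (simp add: G_hat0_iff)
  have c': "fm_order_ge 1 c" "commutes_with A c" using c G_hat0_order by (auto simp: Cent_iff)
  have "fm_comp g c = fm_comp (g - fm_id) c - (0 - c)"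
    using c' by (simp add: fm_comp_diff_left fm_comp_id_left)
  then have "graded_op p (fm_comp g c) = graded_op p (fm_comp (g - fm_id) c) + c"
    using p2[OF c'(2)] by (simp only: graded_op_diff) (rule fmap_eqI, simp)
  then have "graded_op p (fm_comp g c) = fm_id \<longleftrightarrow> c = fm_id - graded_op p (fm_comp (g - fm_id) c)"
    by (auto simp: algebra_simps)
  also have "\<dots> \<longleftrightarrow> c = fixed_point p (g - fm_id)"
    using fixed_point_unique[OF G c'(1), of p] fixed_point_eq[OF G, of p] by blast
  finally show ?thesis .
qed

text \<open>Both sides are normalized and belong to the same coset \<open>g \<circ> Cent A\<close>, in which there is only one
  normalized element.\<close>

lemma normalization_comp_Cent:
  assumes g: "g \<in> G_hat0" and d: "d \<in> Cent A"
  shows "normalization p (fm_comp g d) = normalization p g"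
proof -
  have d': "d \<in> G_hat0" using d by (simp add: Cent_iff)
  let ?c = "fixed_point p (fm_comp g d - fm_id)"
  have gd: "fm_comp g d \<in> G_hat0" using g d' by (rule G_hat0_comp)
  have c: "?c \<in> Cent A" by (rule fixed_point_in_Cent[OF gd])
  then have c': "?c \<in> G_hat0" by (simp add: Cent_iff)
  have eq: "fm_comp (fm_comp g d) ?c = fm_comp g (fm_comp d ?c)"
    using d' c' by (intro fm_comp_assoc G_hat0_order)
  have "graded_op p (fm_comp g (fm_comp d ?c)) = fm_id"
    using normalized_iff_fixed_point[OF gd c] by (simp only: eq)
  then have "fm_comp d ?c = fixed_point p (g - fm_id)"
    using normalized_iff_fixed_point[OF g Cent_comp[OF d c]] by simp
  then show ?thesis unfolding normalization_def eq by simp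
qed

text \<open>If \<open>k\<close> is a convergent linearization, the inverses of \<open>k\<close> and \<open>h\<close> lie in the same coset and
  have the same normalization, and normalizing preserves convergence. Conversely the inverse of the
  normalized solution is a linearization.\<close>

lemma linearizable_iff_normalization_converging:
  assumes p3: "\<And>m F. fm_degree_norm m (graded_op p F) \<le> fm_degree_norm m F"
    and f: "fm_order_ge 1 f" and h: "h \<in> formal_linearizations A f"
  shows "linearizable A f \<longleftrightarrow> converging (normalization p (fm_inv h))"
proof
  have h0: "h \<in> G_hat0" using h by (simp add: formal_linearizations_def)
  have g0: "fm_inv h \<in> G_hat0" by (rule fm_inv_in_G_hat0[OF h0])
  {
    assume "linearizable A f"
    then obtain k where k: "k \<in> formal_linearizations A f" "converging k"
      by (auto simp: linearizable_def)
    have k0: "k \<in> G_hat0" using k by (simp add: formal_linearizations_def)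
    have ki: "fm_inv k \<in> G_hat0" by (rule fm_inv_in_G_hat0[OF k0])
    have d: "fm_comp h (fm_inv k) \<in> Cent A" by (rule linearizations_differ_by_Cent[OF f k(1) h])
    have "fm_comp (fm_inv h) (fm_comp h (fm_inv k)) = fm_comp (fm_comp (fm_inv h) h) (fm_inv k)"
      by (rule fm_comp_assoc[symmetric]) (intro G_hat0_order h0 ki)+
    also have "\<dots> = fm_inv k" by (simp add: fm_comp_inv_left[OF h0] fm_comp_id_left G_hat0_order ki)
    finally have eq: "normalization p (fm_inv h) = normalization p (fm_inv k)"
      using normalization_comp_Cent[OF g0 d] by simp
    have "converging (fm_inv k)" by (rule converging_inv[OF k0 k(2)])
    then show "converging (normalization p (fm_inv h))"
      unfolding eq unfolding normalization_def using ki
      by (intro converging_comp converging_fixed_point p3 G_hat0_order fixed_point_in_G_hat0)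
        (auto simp: G_hat0_iff)
  next
    assume conv: "converging (normalization p (fm_inv h))"
    let ?c = "fixed_point p (fm_inv h - fm_id)"
    have c: "?c \<in> Cent A" by (rule fixed_point_in_Cent[OF g0])
    then have c0: "?c \<in> G_hat0" by (simp add: Cent_iff)
    let ?n = "fm_comp (fm_inv h) ?c"
    have n0: "?n \<in> G_hat0" by (rule G_hat0_comp[OF g0 c0])
    let ?k = "fm_comp (fm_inv ?c) h"
    have k: "?k \<in> formal_linearizations A f" by (rule Cent_comp_linearization[OF f h Cent_inv[OF c]])
    note o = G_hat0_order[OF h0] G_hat0_order[OF g0] G_hat0_order[OF c0] G_hat0_order[OF n0]
      G_hat0_order[OF fm_inv_in_G_hat0[OF c0]] G_hat0_order[OF fm_inv_in_G_hat0[OF n0]]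
    have "fm_comp ?k ?n = fm_comp (fm_inv ?c) (fm_comp (fm_comp h (fm_inv h)) ?c)"
      using o by (simp add: fm_comp_assoc fm_order_ge_comp)
    also have "\<dots> = fm_id"
      using o by (simp add: fm_comp_inv_right[OF h0] fm_comp_inv_left[OF c0] fm_comp_id_left)
    finally have kn: "fm_comp ?k ?n = fm_id" .
    have "fm_inv ?n = fm_comp (fm_comp ?k ?n) (fm_inv ?n)"
      unfolding kn using o by (simp add: fm_comp_id_left)
    also have "\<dots> = fm_comp ?k (fm_comp ?n (fm_inv ?n))"
      using o by (intro fm_comp_assoc) auto
    also have "\<dots> = ?k" by (simp add: fm_comp_inv_right[OF n0])
    finally have "fm_inv ?n = ?k" .
    moreover have "converging (fm_inv ?n)"
      using converging_inv[OF n0] conv by (simp add: normalization_def)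
    ultimately show "linearizable A f" using k by (auto simp: linearizable_def)
  }
qed

end


text \<open>Polynomial functions of degree at most \<open>d\<close> in the first \<open>k\<close> coordinates, as functions on all
  sequences; the rules are chosen for closure properties, substitutions and inductions.\<close>

inductive polyfun :: "nat \<Rightarrow> nat \<Rightarrow> ((nat \<Rightarrow> complex) \<Rightarrow> complex) \<Rightarrow> bool" for k where
  polyfun_const: "polyfun k d (\<lambda>t. c)"
| polyfun_var: "j < k \<Longrightarrow> polyfun k 1 (\<lambda>t. t j)"
| polyfun_add: "polyfun k d p \<Longrightarrow> polyfun k d q \<Longrightarrow> polyfun k d (\<lambda>t. p t + q t)"
| polyfun_mult: "polyfun k d p \<Longrightarrow> polyfun k e q \<Longrightarrow> polyfun k (d + e) (\<lambda>t. p t * q t)"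

lemma polyfun_mono: "polyfun k d p \<Longrightarrow> d \<le> e \<Longrightarrow> polyfun k e p"
  using polyfun_mult[OF _ polyfun_const[of k "e - d" 1], of d p] by simp

lemma polyfun_sum: "(\<And>x. x \<in> S \<Longrightarrow> polyfun k d (p x)) \<Longrightarrow> polyfun k d (\<lambda>t. \<Sum>x\<in>S. p x t)"
  by (induction S rule: infinite_finite_induct) (auto intro: polyfun_const polyfun_add)

lemma polyfun_cmult: "polyfun k d p \<Longrightarrow> polyfun k d (\<lambda>t. c * p t)"
  using polyfun_mult[OF polyfun_const[of k 0 c]] by simp

lemma polyfun_diff: "polyfun k d p \<Longrightarrow> polyfun k d q \<Longrightarrow> polyfun k d (\<lambda>t. p t - q t)"
  using polyfun_add[OF _ polyfun_cmult[of k d q "-1"], of p] by simp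

lemma polyfun_power: "polyfun k d p \<Longrightarrow> polyfun k (d * e) (\<lambda>t. p t ^ e)"
proof (induction e)
  case (Suc e)
  then show ?case using polyfun_mult[of k d p "d * e" "\<lambda>t. p t ^ e"] by simp
qed (simp add: polyfun_const)

lemma polyfun_monomial: "l \<le> k \<Longrightarrow> polyfun k (\<Sum>j<l. i j) (\<lambda>t. \<Prod>j<l. t j ^ i j)"
proof (induction l)
  case (Suc l)
  then show ?case
    using polyfun_mult[OF Suc.IH polyfun_power[OF polyfun_var[of l k], of "i l"]] by simp
qed (simp add: polyfun_const)

lemma polynomial_le_imp_polyfun:
  assumes "polynomial_le k d p"
  shows "polyfun k d (\<lambda>t. p (first_coords k t))"
proof -
  obtain c where c: "\<And>t. t \<in> cspace (enat k) \<Longrightarrow> p t = (\<Sum>i\<in>exponents k d. c i * monomial k i t)"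
    using assms by (auto simp: polynomial_le_def)
  have "monomial k i (first_coords k t) = (\<Prod>j<k. t j ^ i j)" for i t
    unfolding monomial_def by (intro prod.cong) (auto simp: first_coords_def)
  moreover have "first_coords k t \<in> cspace (enat k)" for t
    by (simp add: cspace_def first_coords_def)
  ultimately have "(\<lambda>t. p (first_coords k t)) = (\<lambda>t. \<Sum>i\<in>exponents k d. c i * (\<Prod>j<k. t j ^ i j))"
    by (simp add: c)
  moreover have "polyfun k d (\<lambda>t. \<Sum>i\<in>exponents k d. c i * (\<Prod>j<k. t j ^ i j))"
    by (intro polyfun_sum polyfun_cmult polyfun_mono[OF polyfun_monomial]) (auto simp: exponents_def)
  ultimately show ?thesis by simp
qed

text \<open>Orders and degrees are coupled: a coefficient of order \<open>m\<close> of a series of order \<open>l\<close> has degree at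
  most \<open>D * (m - l)\<close>. In this form the conditions are multiplicative, and for \<open>l = 1\<close> they are
  stable under composition.\<close>

definition series_family :: "nat \<Rightarrow> nat \<Rightarrow> nat \<Rightarrow> ((nat \<Rightarrow> complex) \<Rightarrow> (complex, 'n::finite) mfps) \<Rightarrow> bool" where
  "series_family k D l \<phi> \<longleftrightarrow> (\<forall>t. mfps_order_ge l (\<phi> t)) \<and>
     (\<forall>a. polyfun k (D * (mi_size a - l)) (\<lambda>t. mfps_nth (\<phi> t) a))"

definition map_family :: "nat \<Rightarrow> nat \<Rightarrow> ((nat \<Rightarrow> complex) \<Rightarrow> 'n::finite fmap) \<Rightarrow> bool" where
  "map_family k D F \<longleftrightarrow> (\<forall>i. series_family k D 1 (\<lambda>t. F t $ i))"

lemma series_family_mult: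
  assumes f: "series_family k D l f" and g: "series_family k D m g"
  shows "series_family k D (l + m) (\<lambda>t. f t * g t)"
  unfolding series_family_def
proof (intro conjI allI)
  show "mfps_order_ge (l + m) (f t * g t)" for t
    using f g by (intro mfps_order_ge_mult) (auto simp: series_family_def)
  fix a :: "nat ^ 'a"
  have "polyfun k (D * (mi_size a - (l + m))) (\<lambda>t. mfps_nth (f t) (fst x) * mfps_nth (g t) (snd x))"
    if x: "fst x + snd x = a" for x
  proof (cases "mi_size (fst x) < l \<or> mi_size (snd x) < m")
    case True
    then have "(\<lambda>t. mfps_nth (f t) (fst x) * mfps_nth (g t) (snd x)) = (\<lambda>t. 0)"
      using f g by (auto simp: series_family_def mfps_order_ge_def)
    then show ?thesis by (simp add: polyfun_const)
  next
    case False
    have a: "mi_size a = mi_size (fst x) + mi_size (snd x)" using x by auto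
    have "D * (mi_size (fst x) - l) + D * (mi_size (snd x) - m) = D * (mi_size a - (l + m))"
      using False unfolding a by (simp flip: distrib_left)
    then show ?thesis
      using polyfun_mult[of k "D * (mi_size (fst x) - l)" "\<lambda>t. mfps_nth (f t) (fst x)"
          "D * (mi_size (snd x) - m)" "\<lambda>t. mfps_nth (g t) (snd x)"] f g
      by (simp add: series_family_def)
  qed
  then show "polyfun k (D * (mi_size a - (l + m))) (\<lambda>t. mfps_nth (f t * g t) a)"
    unfolding mfps_nth_mult case_prod_unfold by (intro polyfun_sum) auto
qed

lemma series_family_mpow:
  assumes "map_family k D F"
  shows "series_family k D (mi_size b) (\<lambda>t. mpow (F t) b)"
proof (induction b rule: mi_induct)
  case zero
  show ?case by (simp add: series_family_def mfps_order_ge_def polyfun_const)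
next
  case (add b j)
  then show ?case using series_family_mult[OF add, of 1 "\<lambda>t. F t $ j"] assms
    unfolding mpow_add mpow_axis by (simp add: map_family_def)
qed

text \<open>A term \<open>F\<^sub>b * (G\<^sup>b)\<^sub>a\<close> has degree at most
  \<open>D * (mi_size b - 1) + D * (mi_size a - mi_size b) = D * (mi_size a - 1)\<close>.\<close>

lemma map_family_comp:
  assumes F: "map_family k D F" and G: "map_family k D G"
  shows "map_family k D (\<lambda>t. fm_comp (F t) (G t))"
  unfolding map_family_def series_family_def
proof (intro allI conjI)
  fix i
  have F': "mfps_order_ge 1 (F t $ i)" and G': "mfps_order_ge 1 (G t $ j)" for t j
    using F G by (auto simp: map_family_def series_family_def)
  show "mfps_order_ge 1 (fm_comp (F t) (G t) $ i)" for t
    unfolding fm_comp_nth by (intro compose_order F' G')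
  fix a :: "nat ^ 'a"
  have "polyfun k (D * (mi_size a - 1)) (\<lambda>t. mfps_nth (F t $ i) b * mfps_nth (mpow (G t) b) a)"
    if b: "mi_size b \<le> mi_size a" for b
  proof (cases "mi_size b = 0")
    case True
    then have "mfps_nth (F t $ i) b = 0" for t using F'[of t] by (auto simp: mfps_order_ge_def)
    then show ?thesis by (simp add: polyfun_const)
  next
    case False
    then have "mi_size b - 1 + (mi_size a - mi_size b) = mi_size a - 1"
      using b by linarith
    then have "D * (mi_size b - 1) + D * (mi_size a - mi_size b) = D * (mi_size a - 1)"
      by (metis distrib_left)
    moreover have "polyfun k (D * (mi_size b - 1)) (\<lambda>t. mfps_nth (F t $ i) b)"
      using F by (simp add: map_family_def series_family_def)
    moreover have "polyfun k (D * (mi_size a - mi_size b)) (\<lambda>t. mfps_nth (mpow (G t) b) a)"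
      using series_family_mpow[OF G, of b] by (simp add: series_family_def)
    ultimately show ?thesis
      using polyfun_mult[of k "D * (mi_size b - 1)" "\<lambda>t. mfps_nth (F t $ i) b"
          "D * (mi_size a - mi_size b)" "\<lambda>t. mfps_nth (mpow (G t) b) a"] by simp
  qed
  then show "polyfun k (D * (mi_size a - 1)) (\<lambda>t. mfps_nth (fm_comp (F t) (G t) $ i) a)"
    unfolding fm_comp_nth nth_compose' by (intro polyfun_sum) auto
qed

lemma map_familyD: "map_family k D F \<Longrightarrow> polyfun k (D * (mi_size a - 1)) (\<lambda>t. mfps_nth (F t $ i) a)"
  and map_family_order: "map_family k D F \<Longrightarrow> fm_order_ge 1 (F t)"
  by (auto simp: map_family_def series_family_def fm_order_ge_iff)

lemma map_familyI:
  "(\<And>t. fm_order_ge 1 (F t)) \<Longrightarrow> (\<And>i a. polyfun k (D * (mi_size a - 1)) (\<lambda>t. mfps_nth (F t $ i) a))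
    \<Longrightarrow> map_family k D F"
  by (auto simp: map_family_def series_family_def fm_order_ge_iff)

lemma map_family_const: "fm_order_ge 1 F \<Longrightarrow> map_family k D (\<lambda>t. F)"
  by (intro map_familyI polyfun_const)

lemma map_family_diff: "map_family k D F \<Longrightarrow> map_family k D G \<Longrightarrow> map_family k D (\<lambda>t. F t - G t)"
  by (intro map_familyI) (auto intro: fm_order_ge_diff map_family_order polyfun_diff map_familyD)

lemma map_family_graded_op:
  assumes "map_family k D F"
  shows "map_family k D (\<lambda>t. graded_op p (F t))"
proof (rule map_familyI)
  fix i and a :: "nat ^ 'a"
  have "polyfun k (D * (mi_size a - 1)) (\<lambda>t. p (i, a) x * mfps_nth (F t $ fst x) (snd x))"
    if "x \<in> coeffs_of_degree (mi_size a)" for x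
    using polyfun_cmult[OF map_familyD[OF assms, of "snd x" "fst x"], of "p (i, a) x"] that
    by (auto simp: coeffs_of_degree_def)
  then show "polyfun k (D * (mi_size a - 1)) (\<lambda>t. mfps_nth (graded_op p (F t) $ i) a)"
    unfolding graded_op_nth by (rule polyfun_sum)
qed (auto intro: graded_op_order map_family_order[OF assms])

lemma map_family_fixed_point:
  assumes G: "map_family k D G"
  shows "map_family k D (\<lambda>t. fixed_point p (G t))"
proof -
  have it: "map_family k D (\<lambda>t. fixed_point_iterate p (G t) j)" for j
  proof (induction j)
    case 0
    show ?case by (simp add: map_family_const fm_order_ge_id)
  next
    case (Suc j)
    show ?case unfolding fixed_point_iterate.simps
      by (intro map_family_diff map_family_graded_op map_family_comp G Suc map_family_const fm_order_ge_id)
  qed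
  show ?thesis
  proof (rule map_familyI)
    show "fm_order_ge 1 (fixed_point p (G t))" for t
      using fm_order_ge_id by (auto simp: fixed_point_def fm_order_ge_def)
    show "polyfun k (D * (mi_size a - 1)) (\<lambda>t. mfps_nth (fixed_point p (G t) $ i) a)" for i a
      using map_familyD[OF it[of "mi_size a"], of a i] by (simp add: fixed_point_def)
  qed
qed

lemma map_family_normalization:
  assumes "map_family k D F"
  shows "map_family k D (\<lambda>t. normalization p (F t))"
  unfolding normalization_def
  by (intro map_family_comp map_family_fixed_point map_family_diff assms map_family_const fm_order_ge_id)

lemma map_family_inv:
  assumes "map_family k D F" "\<And>t. F t \<in> G_hat0"
  shows "map_family k D (\<lambda>t. fm_inv (F t))"
  unfolding fm_inv_eq_fixed_point[OF assms(2)]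
  by (intro map_family_fixed_point map_family_diff assms(1) map_family_const fm_order_ge_id)

text \<open>A degree bound \<open>d * m\<close> in order \<open>m\<close> is at most \<open>2 * d * (m - 1)\<close>, except in orders below \<open>2\<close>,
  where the coefficients of a map tangent to the identity do not depend on the parameter.\<close>

lemma map_familyI_G_hat0:
  assumes F: "\<And>t. F t \<in> G_hat0"
    and deg: "\<And>i a. polyfun k (d * mi_size a) (\<lambda>t. mfps_nth (F t $ i) a)"
  shows "map_family k (2 * d) F"
proof (rule map_familyI)
  fix i and a :: "nat ^ 'a"
  show "polyfun k (2 * d * (mi_size a - 1)) (\<lambda>t. mfps_nth (F t $ i) a)"
  proof (cases "mi_size a < 2")
    case True
    then have "mfps_nth ((F t - fm_id) $ i) a = 0" for t
      using F[of t] unfolding G_hat0_iff fm_order_ge_def by blast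
    then have "mfps_nth (F t $ i) a = mfps_nth (fm_id $ i) a" for t by simp
    then show ?thesis by (simp add: polyfun_const)
  next
    case False
    then have "d * mi_size a \<le> d * (2 * (mi_size a - 1))" by (intro mult_left_mono) auto
    then show ?thesis using polyfun_mono[OF deg] by (simp add: mult_ac)
  qed
qed (use F G_hat0_order in auto)

section \<open>Polynomials on sets of positive capacity\<close>

text \<open>The positive part of the kernel; its integral decides whether an energy is finite.\<close>

abbreviation log_kernel_pos :: "complex \<Rightarrow> complex \<Rightarrow> ennreal" where
  "log_kernel_pos z w \<equiv> e2ennreal (log_kernel z w)"

lemma log_kernel_pos_measurable [measurable]:
  "(\<lambda>x. log_kernel_pos (fst x) (snd x)) \<in> borel_measurable (borel \<Otimes>\<^sub>M borel)"
  unfolding log_kernel_def by measurable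

lemma log_kernel_pos_measurable':
  assumes [simp, measurable_cong]: "sets M = sets borel" "sets N = sets borel"
  shows "(\<lambda>x. log_kernel_pos (fst x) (snd x)) \<in> borel_measurable (M \<Otimes>\<^sub>M N)"
  using log_kernel_pos_measurable by (simp cong: measurable_cong_sets sets_pair_measure_cong)

lemma log_kernel_pos_eq:
  "z \<noteq> w \<Longrightarrow> log_kernel_pos z w = ennreal (- ln (dist z w))"
  by (simp add: log_kernel_def)

lemma log_kernel_pos_refl [simp]: "log_kernel_pos z z = \<infinity>"
  by (simp add: log_kernel_def)

lemma positive_capacity_finite_energy:
  assumes "log_capacity S > 0"
  obtains \<mu> K where "prob_space \<mu>" "sets \<mu> = sets borel" "compact K" "K \<subseteq> S" "emeasure \<mu> K = 1"
    "(\<integral>\<^sup>+ z. \<integral>\<^sup>+ w. log_kernel_pos z w \<partial>\<mu> \<partial>\<mu>) < \<infinity>"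
proof -
  obtain \<mu> K where \<mu>: "prob_space \<mu>" "sets \<mu> = sets borel" "compact K" "K \<subseteq> S" "emeasure \<mu> K = 1"
    and e: "log_energy \<mu> \<noteq> \<infinity>"
    using assms unfolding log_capacity_def less_SUP_iff by (auto split: if_splits)
  have "(\<integral>\<^sup>+ z. \<integral>\<^sup>+ w. log_kernel_pos z w \<partial>\<mu> \<partial>\<mu>) \<noteq> \<infinity>"
    using e unfolding log_energy_def by auto
  then show ?thesis using that \<mu> by (simp add: top.not_eq_extremum)
qed

text \<open>Let \<open>w0\<close> be a point of \<open>K\<close> nearest to \<open>\<zeta>\<close>. Then \<open>dist w0 w \<le> 2 * dist \<zeta> w\<close> on \<open>K\<close>, so
  that the potential at \<open>\<zeta>\<close> exceeds the potential at \<open>w0\<close> by at most \<open>ln 2\<close>.\<close>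

lemma log_kernel_pos_nearest:
  assumes "dist \<zeta> w0 \<le> dist \<zeta> w"
  shows "log_kernel_pos \<zeta> w \<le> log_kernel_pos w0 w + ennreal (ln 2)"
proof (cases "w0 = w")
  case False
  then have "\<zeta> \<noteq> w" using assms by auto
  have "dist w0 w \<le> 2 * dist \<zeta> w"
    using dist_triangle[of w0 w \<zeta>] assms by (simp add: dist_commute)
  then have "ln (dist w0 w) \<le> ln (2 * dist \<zeta> w)"
    using False \<open>\<zeta> \<noteq> w\<close> by (subst ln_le_cancel_iff) auto
  also have "\<dots> = ln 2 + ln (dist \<zeta> w)" using \<open>\<zeta> \<noteq> w\<close> by (simp add: ln_mult)
  finally have *: "- ln (dist \<zeta> w) \<le> - ln (dist w0 w) + ln 2" by simp
  have "ennreal (- ln (dist \<zeta> w)) \<le> ennreal (max 0 (- ln (dist w0 w)) + ln 2)"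
    using * by (intro ennreal_leI) simp
  also have "\<dots> = ennreal (max 0 (- ln (dist w0 w))) + ennreal (ln 2)"
    by (intro ennreal_plus) auto
  finally show ?thesis using False \<open>\<zeta> \<noteq> w\<close> by (simp add: log_kernel_pos_eq ennreal_max_0)
qed auto

text \<open>A measure of finite energy has a finite potential almost everywhere. Hence the potential is bounded on
  a set of positive measure, which may be taken compact and inside one of the sets \<open>C N\<close>.
  Restricting the measure to it decreases the potential, and by \<open>log_kernel_pos_nearest\<close> the
  restricted measure has a potential that is bounded on the whole plane.\<close>

lemma bounded_potential_measure:
  fixes C :: "nat \<Rightarrow> complex set"
  assumes cap: "log_capacity S > 0" and S: "S \<subseteq> (\<Union>N. C N)" and C: "\<And>N. closed (C N)"
  obtains N \<nu> K B where "prob_space \<nu>" "sets \<nu> = sets borel" "compact K" "K \<subseteq> C N" "AE z in \<nu>. z \<in> K"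
    "0 \<le> B" "\<And>\<zeta>. (\<integral>\<^sup>+ z. log_kernel_pos \<zeta> z \<partial>\<nu>) \<le> ennreal B"
proof -
  obtain \<mu> K where \<mu>: "prob_space \<mu>" "compact K" "K \<subseteq> S" "emeasure \<mu> K = 1"
    and sets [measurable_cong, simp]: "sets \<mu> = sets borel"
    and fin: "(\<integral>\<^sup>+ z. \<integral>\<^sup>+ w. log_kernel_pos z w \<partial>\<mu> \<partial>\<mu>) < \<infinity>"
    using positive_capacity_finite_energy[OF cap] by metis
  interpret prob_space \<mu> by fact
  have [simp]: "space \<mu> = UNIV" using sets_eq_imp_space_eq[OF sets] by simp
  have [measurable]: "K \<in> sets borel" using \<mu>(2) by (simp add: borel_compact)
  have [measurable]: "C N \<in> sets borel" for N using C by (simp add: borel_closed)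
  define u where "u z = (\<integral>\<^sup>+ w. log_kernel_pos z w \<partial>\<mu>)" for z
  have "(\<lambda>z. \<integral>\<^sup>+ w. log_kernel_pos (fst (z, w)) (snd (z, w)) \<partial>\<mu>) \<in> borel_measurable \<mu>"
    by (rule borel_measurable_nn_integral_fst[OF log_kernel_pos_measurable']) auto
  then have u: "u \<in> borel_measurable \<mu>" by (simp add: u_def[abs_def])
  then have [measurable]: "u \<in> borel_measurable borel" by (simp cong: measurable_cong_sets)
  have "AE z in \<mu>. u z \<noteq> \<infinity>"
    by (rule nn_integral_PInf_AE[OF u]) (use fin in \<open>simp add: u_def[abs_def] top.not_eq_extremum\<close>)
  moreover have "AE z in \<mu>. z \<in> K"
    using \<mu>(4) by (intro AE_in_set_eq_1[THEN iffD2]) (auto simp: emeasure_eq_measure)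
  ultimately have AE: "AE z in \<mu>. z \<in> K \<and> u z \<noteq> \<infinity>" by eventually_elim simp
  define D where "D n N = {z \<in> K \<inter> C N. u z \<le> of_nat n}" for n N
  have D [measurable]: "D n N \<in> sets borel" for n N unfolding D_def by measurable
  obtain n N where nN: "emeasure \<mu> (D n N) > 0"
  proof (rule ccontr)
    assume "\<not> thesis"
    then have "emeasure \<mu> (D n N) = 0" for n N using that by (metis not_gr_zero)
    then have "AE z in \<mu>. z \<notin> D n N" for n N
      by (intro AE_not_in) (auto simp: null_sets_def)
    then have "AE z in \<mu>. \<forall>n N. z \<notin> D n N" by (simp add: AE_all_countable)
    with AE have "AE z in \<mu>. False"
    proof eventually_elim
      case (elim z)
      then obtain N where "z \<in> C N" using \<mu>(3) S by blast
      moreover obtain n where "u z \<le> of_nat n"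
        using elim ennreal_Ex_less_of_nat[of "u z"] by (auto simp: top.not_eq_extremum intro: less_imp_le)
      ultimately show False using elim by (auto simp: D_def)
    qed
    then show False by simp
  qed
  have "emeasure \<mu> (D n N) = (SUP K \<in> {K. K \<subseteq> D n N \<and> compact K}. emeasure \<mu> K)"
    by (rule inner_regular) auto
  with nN obtain K' where K': "K' \<subseteq> D n N" "compact K'" "emeasure \<mu> K' > 0"
    by (auto simp: less_SUP_iff)
  have [measurable]: "K' \<in> sets borel" using K'(2) by (simp add: borel_compact)
  define \<nu> where "\<nu> = uniform_measure \<mu> K'"
  define m where "m = measure \<mu> K'"
  have m: "emeasure \<mu> K' = ennreal m" "m > 0"
    using K'(3) by (auto simp: m_def emeasure_eq_measure)
  have bound: "(\<integral>\<^sup>+ z. log_kernel_pos \<zeta> z \<partial>\<nu>) \<le> ennreal ((real n + ln 2) / m)" for \<zeta>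
  proof -
    have "K' \<noteq> {}" using K'(3) by auto
    then obtain w0 where w0: "w0 \<in> K'" "\<And>w. w \<in> K' \<Longrightarrow> dist \<zeta> w0 \<le> dist \<zeta> w"
      using distance_attains_inf[of K' \<zeta>] K'(2) compact_imp_closed by blast
    have [measurable]: "log_kernel_pos \<xi> \<in> borel_measurable borel" for \<xi>
      using measurable_compose_Pair1[OF _ log_kernel_pos_measurable, of \<xi>] by simp
    have "(\<integral>\<^sup>+ z. log_kernel_pos \<zeta> z * indicator K' z \<partial>\<mu>)
        \<le> (\<integral>\<^sup>+ z. log_kernel_pos w0 z + ennreal (ln 2) \<partial>\<mu>)"
      by (intro nn_integral_mono) (auto simp: w0 log_kernel_pos_nearest split: split_indicator)
    also have "\<dots> = u w0 + ennreal (ln 2)"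
      unfolding u_def by (subst nn_integral_add) (auto simp: emeasure_space_1[simplified])
    also have "\<dots> \<le> of_nat n + ennreal (ln 2)"
      using w0(1) K'(1) by (intro add_right_mono) (auto simp: D_def)
    also have "\<dots> = ennreal (real n + ln 2)"
      by (simp add: ennreal_of_nat_eq_real_of_nat)
    finally have "(\<integral>\<^sup>+ z. log_kernel_pos \<zeta> z * indicator K' z \<partial>\<mu>) / emeasure \<mu> K'
        \<le> ennreal (real n + ln 2) / ennreal m"
      unfolding m by (rule divide_right_mono_ennreal)
    also have "\<dots> = ennreal ((real n + ln 2) / m)" using m by (intro divide_ennreal) auto
    finally show ?thesis
      unfolding \<nu>_def by (subst nn_integral_uniform_measure) (auto cong: measurable_cong_sets)
  qed
  show ?thesis
  proof (rule that[of \<nu> K' N "(real n + ln 2) / m"])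
    show "prob_space \<nu>" unfolding \<nu>_def
      by (rule prob_space_uniform_measure) (use K'(3) in \<open>auto simp: emeasure_eq_measure\<close>)
    show "AE z in \<nu>. z \<in> K'" unfolding \<nu>_def by (rule AE_uniform_measureI) auto
  qed (use K' m bound in \<open>auto simp: \<nu>_def D_def\<close>)
qed

definition poly_l1_norm :: "complex poly \<Rightarrow> real" where
  "poly_l1_norm Q = (\<Sum>i\<le>degree Q. cmod (coeff Q i))"

lemma poly_l1_norm_eq: "degree Q \<le> m \<Longrightarrow> poly_l1_norm Q = (\<Sum>i\<le>m. cmod (coeff Q i))"
  unfolding poly_l1_norm_def by (rule sum.mono_neutral_left) (auto intro: coeff_eq_0)

lemma poly_l1_norm_pos: "Q \<noteq> 0 \<Longrightarrow> 0 < poly_l1_norm Q"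
  unfolding poly_l1_norm_def by (rule sum_pos2[of _ "degree Q"]) auto

lemma coeff_le_poly_l1_norm: "cmod (coeff Q i) \<le> poly_l1_norm Q"
  using poly_l1_norm_eq[of Q "max i (degree Q)"]
    member_le_sum[of i "{..max i (degree Q)}" "\<lambda>i. cmod (coeff Q i)"] by auto

text \<open>This norm bounds all coefficients at once and is controlled root by root for a product of linear
  factors, just like the integral of \<open>ln \<bar>Q\<bar>\<close>.\<close>

lemma poly_l1_norm_linear_factor:
  "poly_l1_norm ([:- \<zeta>, 1:] * Q) \<le> (1 + cmod \<zeta>) * poly_l1_norm Q"
proof -
  let ?d = "degree Q"
  have "degree ([:- \<zeta>, 1:] * Q) \<le> Suc ?d"
    using degree_mult_le[of "[:- \<zeta>, 1:]" Q] by simp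
  then have "poly_l1_norm ([:- \<zeta>, 1:] * Q) = (\<Sum>i\<le>Suc ?d. cmod (coeff (pCons 0 Q) i - \<zeta> * coeff Q i))"
    by (simp add: poly_l1_norm_eq)
  also have "\<dots> \<le> (\<Sum>i\<le>Suc ?d. cmod (coeff (pCons 0 Q) i) + cmod \<zeta> * cmod (coeff Q i))"
    by (intro sum_mono) (metis norm_mult norm_triangle_ineq4)
  also have "\<dots> = (\<Sum>i\<le>Suc ?d. cmod (coeff (pCons 0 Q) i)) + cmod \<zeta> * (\<Sum>i\<le>Suc ?d. cmod (coeff Q i))"
    by (simp only: sum.distrib sum_distrib_left)
  also have "(\<Sum>i\<le>Suc ?d. cmod (coeff (pCons 0 Q) i)) = (\<Sum>i\<le>?d. cmod (coeff Q i))"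
    by (subst sum.atMost_Suc_shift) simp
  also have "(\<Sum>i\<le>Suc ?d. cmod (coeff Q i)) = (\<Sum>i\<le>?d. cmod (coeff Q i))"
    by (simp add: coeff_eq_0)
  finally show ?thesis by (simp add: poly_l1_norm_def algebra_simps)
qed

context
  fixes \<nu> :: "complex measure" and K R B
  assumes \<nu>: "prob_space \<nu>" and sets [measurable_cong, simp]: "sets \<nu> = sets borel"
    and K: "AE z in \<nu>. z \<in> K" "\<And>z. z \<in> K \<Longrightarrow> cmod z \<le> R" and R: "0 \<le> R"
    and B: "0 \<le> B" "\<And>\<zeta>. (\<integral>\<^sup>+ z. log_kernel_pos \<zeta> z \<partial>\<nu>) \<le> ennreal B"
begin

text \<open>For \<open>\<zeta>\<close> close to \<open>K\<close> the lower bound is the bound on the potential, and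
  \<open>ln (1 + cmod \<zeta>)\<close> is bounded. For distant \<open>\<zeta>\<close>, \<open>cmod (z - \<zeta>) \<ge> (1 + cmod \<zeta>) / 2\<close> on \<open>K\<close>.\<close>

lemma integral_ln_linear:
  shows "AE z in \<nu>. z \<noteq> \<zeta>" and "integrable \<nu> (\<lambda>z. ln (cmod (z - \<zeta>)))"
    and "ln (1 + cmod \<zeta>) - (B + ln (2 + 2 * R) + ln 2) \<le> (\<integral>z. ln (cmod (z - \<zeta>)) \<partial>\<nu>)"
proof -
  interpret prob_space \<nu> by (fact \<nu>)
  have ker [measurable]: "log_kernel_pos \<zeta> \<in> borel_measurable \<nu>"
    using measurable_compose_Pair1[OF _ log_kernel_pos_measurable, of \<zeta>] by (simp cong: measurable_cong_sets)
  have "(\<integral>\<^sup>+ z. log_kernel_pos \<zeta> z \<partial>\<nu>) \<noteq> \<infinity>"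
    using B(2)[of \<zeta>] by (metis ennreal_less_top infinity_ennreal_def leD)
  then have "AE z in \<nu>. log_kernel_pos \<zeta> z \<noteq> \<infinity>"
    by (intro nn_integral_PInf_AE ker)
  then show ne: "AE z in \<nu>. z \<noteq> \<zeta>" by eventually_elim auto
  have pos: "AE z in \<nu>. ennreal (max 0 (- ln (cmod (z - \<zeta>)))) = log_kernel_pos \<zeta> z"
    using ne by eventually_elim (auto simp: log_kernel_pos_eq dist_norm norm_minus_commute ennreal_max_0)
  define U where "U = max 0 (ln (R + cmod \<zeta>))"
  have up: "AE z in \<nu>. ln (cmod (z - \<zeta>)) \<le> U"
    using K(1) ne
  proof eventually_elim
    case (elim z)
    have "cmod (z - \<zeta>) \<le> R + cmod \<zeta>" using K(2)[OF elim(1)] norm_triangle_ineq4[of z \<zeta>] by linarith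
    then have "ln (cmod (z - \<zeta>)) \<le> ln (R + cmod \<zeta>)"
      using elim(2) by (intro ln_mono) auto
    then show ?case by (simp add: U_def)
  qed
  have int_neg: "(\<integral>\<^sup>+ z. ennreal (max 0 (- ln (cmod (z - \<zeta>)))) \<partial>\<nu>) \<le> ennreal B"
    using B(2)[of \<zeta>] nn_integral_cong_AE[OF pos] by simp
  show int: "integrable \<nu> (\<lambda>z. ln (cmod (z - \<zeta>)))"
  proof (rule integrableI_bounded)
    have "(\<integral>\<^sup>+ z. ennreal (norm (ln (cmod (z - \<zeta>)))) \<partial>\<nu>)
        \<le> (\<integral>\<^sup>+ z. ennreal (max 0 (- ln (cmod (z - \<zeta>)))) + ennreal U \<partial>\<nu>)"
    proof (rule nn_integral_mono_AE, use up in eventually_elim)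
      fix z assume "ln (cmod (z - \<zeta>)) \<le> U"
      moreover have "0 \<le> U" by (simp add: U_def)
      ultimately have "norm (ln (cmod (z - \<zeta>))) \<le> max 0 (- ln (cmod (z - \<zeta>))) + U" by auto
      then show "ennreal (norm (ln (cmod (z - \<zeta>)))) \<le> ennreal (max 0 (- ln (cmod (z - \<zeta>)))) + ennreal U"
        using \<open>0 \<le> U\<close> by (simp add: ennreal_leI flip: ennreal_plus)
    qed
    also have "\<dots> = (\<integral>\<^sup>+ z. ennreal (max 0 (- ln (cmod (z - \<zeta>)))) \<partial>\<nu>) + ennreal U"
      by (subst nn_integral_add) (auto simp: emeasure_space_1)
    also have "\<dots> < \<infinity>" using int_neg by (auto simp: less_top[symmetric] top_unique)
    finally show "(\<integral>\<^sup>+ z. ennreal (norm (ln (cmod (z - \<zeta>)))) \<partial>\<nu>) < \<infinity>" .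
  qed measurable
  show "ln (1 + cmod \<zeta>) - (B + ln (2 + 2 * R) + ln 2) \<le> (\<integral>z. ln (cmod (z - \<zeta>)) \<partial>\<nu>)"
  proof (cases "cmod \<zeta> \<le> 2 * R + 1")
    case True
    have int': "integrable \<nu> (\<lambda>z. max 0 (- ln (cmod (z - \<zeta>))))"
      using int by (intro integrable_max) auto
    have "ennreal (\<integral>z. max 0 (- ln (cmod (z - \<zeta>))) \<partial>\<nu>) \<le> ennreal B"
      using nn_integral_eq_integral[OF int'] int_neg by simp
    then have "(\<integral>z. max 0 (- ln (cmod (z - \<zeta>))) \<partial>\<nu>) \<le> B" using B(1) by simp
    moreover have "- (\<integral>z. max 0 (- ln (cmod (z - \<zeta>))) \<partial>\<nu>) \<le> (\<integral>z. ln (cmod (z - \<zeta>)) \<partial>\<nu>)"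
      unfolding integral_minus[symmetric] by (rule integral_mono) (use int int' in auto)
    moreover have "ln (1 + cmod \<zeta>) \<le> ln (2 + 2 * R)" using True by (intro ln_mono) (auto simp: add_pos_nonneg)
    moreover have "0 \<le> ln (2::real)" by simp
    ultimately show ?thesis by linarith
  next
    case False
    have "ln (1 + cmod \<zeta>) - ln 2 = (\<integral>z. ln (1 + cmod \<zeta>) - ln 2 \<partial>\<nu>)" by (simp add: prob_space[simplified])
    also have "\<dots> \<le> (\<integral>z. ln (cmod (z - \<zeta>)) \<partial>\<nu>)"
    proof (rule integral_mono_AE)
      show "AE z in \<nu>. ln (1 + cmod \<zeta>) - ln 2 \<le> ln (cmod (z - \<zeta>))"
        using K(1)
      proof eventually_elim
        case (elim z)
        have "(1 + cmod \<zeta>) / 2 \<le> cmod (z - \<zeta>)"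
          using K(2)[OF elim] False norm_triangle_ineq2[of \<zeta> z] by (simp add: norm_minus_commute)
        then have "ln ((1 + cmod \<zeta>) / 2) \<le> ln (cmod (z - \<zeta>))"
          by (intro ln_mono) (auto simp: add_pos_nonneg)
        moreover have "1 + cmod \<zeta> \<noteq> 0" using norm_ge_zero[of \<zeta>] by linarith
        ultimately show ?case by (simp add: ln_div)
      qed
    qed (use int in auto)
    moreover have "0 \<le> ln (2 + 2 * R)" using R by simp
    ultimately show ?thesis using B(1) by linarith
  qed
qed

text \<open>Jensen's bound: the integral of \<open>ln \<bar>Q\<bar>\<close> is a sum over the roots of \<open>Q\<close>.\<close>

lemma integral_ln_poly:
  assumes "Q \<noteq> 0"
  shows "(AE z in \<nu>. poly Q z \<noteq> 0) \<and> integrable \<nu> (\<lambda>z. ln (cmod (poly Q z))) \<and>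
    ln (poly_l1_norm Q) - (B + ln (2 + 2 * R) + ln 2) * real (degree Q) \<le> (\<integral>z. ln (cmod (poly Q z)) \<partial>\<nu>)"
  using assms
proof (induction "degree Q" arbitrary: Q)
  case 0
  interpret prob_space \<nu> by (fact \<nu>)
  obtain c where "Q = [:c:]" using 0 by (metis degree_eq_zeroE)
  then show ?case using 0 by (simp add: poly_l1_norm_def prob_space)
next
  case (Suc d)
  interpret prob_space \<nu> by (fact \<nu>)
  let ?C = "B + ln (2 + 2 * R) + ln 2"
  have "\<not> constant (poly Q)" using Suc(2) by (simp add: constant_degree)
  then obtain \<zeta> where "poly Q \<zeta> = 0" using fundamental_theorem_of_algebra by blast
  then obtain P where Q: "Q = [:- \<zeta>, 1:] * P" by (metis poly_eq_0_iff_dvd dvdE)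
  have P: "P \<noteq> 0" using Suc(3) Q by auto
  have dQ: "degree Q = Suc (degree P)" unfolding Q by (subst degree_mult_eq) (use P in auto)
  have IH: "AE z in \<nu>. poly P z \<noteq> 0" "integrable \<nu> (\<lambda>z. ln (cmod (poly P z)))"
    "ln (poly_l1_norm P) - ?C * real (degree P) \<le> (\<integral>z. ln (cmod (poly P z)) \<partial>\<nu>)"
    using Suc(1)[of P] Suc(2) P dQ by auto
  have ne: "AE z in \<nu>. poly Q z \<noteq> 0"
    using IH(1) integral_ln_linear(1)[of \<zeta>] by eventually_elim (simp add: Q)
  have split: "AE z in \<nu>. ln (cmod (z - \<zeta>)) + ln (cmod (poly P z)) = ln (cmod (poly Q z))"
    using IH(1) integral_ln_linear(1)[of \<zeta>]
  proof eventually_elim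
    case (elim z)
    have "poly Q z = (z - \<zeta>) * poly P z" by (simp add: Q algebra_simps)
    then show ?case using elim by (simp add: norm_mult ln_mult)
  qed
  have int: "integrable \<nu> (\<lambda>z. ln (cmod (z - \<zeta>)) + ln (cmod (poly P z)))"
    using IH(2) integral_ln_linear(2)[of \<zeta>] by (intro Bochner_Integration.integrable_add)
  have meas: "(\<lambda>z. ln (cmod (poly Q z))) \<in> borel_measurable \<nu>"
  proof -
    have "(\<lambda>z. cmod (poly Q z)) \<in> borel_measurable borel"
      by (intro borel_measurable_continuous_onI continuous_intros)
    then show ?thesis by (simp cong: measurable_cong_sets)
  qed
  have intQ: "integrable \<nu> (\<lambda>z. ln (cmod (poly Q z)))"
    by (rule integrable_cong_AE_imp[OF int meas]) (use split in \<open>eventually_elim, simp\<close>)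
  have "ln (poly_l1_norm Q) \<le> ln ((1 + cmod \<zeta>) * poly_l1_norm P)"
    using poly_l1_norm_linear_factor[of \<zeta> P] poly_l1_norm_pos[OF Suc(3)] unfolding Q by (intro ln_mono) auto
  also have "\<dots> = ln (1 + cmod \<zeta>) + ln (poly_l1_norm P)"
    using poly_l1_norm_pos[OF P] by (intro ln_mult_pos) (auto simp: add_pos_nonneg)
  finally have "ln (poly_l1_norm Q) - ?C * real (degree Q)
      \<le> (\<integral>z. ln (cmod (z - \<zeta>)) \<partial>\<nu>) + (\<integral>z. ln (cmod (poly P z)) \<partial>\<nu>)"
    using integral_ln_linear(3)[of \<zeta>] IH(3) unfolding dQ by (simp add: algebra_simps)
  also have "\<dots> = (\<integral>z. ln (cmod (z - \<zeta>)) + ln (cmod (poly P z)) \<partial>\<nu>)"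
    using IH(2) integral_ln_linear(2)[of \<zeta>] by simp
  also have "\<dots> = (\<integral>z. ln (cmod (poly Q z)) \<partial>\<nu>)"
    by (rule integral_cong_AE) (use int meas split in auto)
  finally show ?case using ne intQ by simp
qed

lemma poly_l1_norm_le:
  assumes M: "\<And>z. z \<in> K \<Longrightarrow> cmod (poly Q z) \<le> M"
  shows "poly_l1_norm Q \<le> M * exp (B + ln (2 + 2 * R) + ln 2) ^ degree Q"
proof -
  interpret prob_space \<nu> by (fact \<nu>)
  obtain z0 where "z0 \<in> K"
    using K(1) AE_E_prob by (metis (no_types, lifting) AE_False eventually_mono prob_space_axioms)
  then have M0: "0 \<le> M" using M[of z0] norm_ge_zero order.trans by blast
  show ?thesis
  proof (cases "Q = 0")
    case True
    then show ?thesis using M0 by (simp add: poly_l1_norm_def)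
  next
    case False
    note I = integral_ln_poly[OF False]
    have "AE z in \<nu>. M > 0"
      using K(1) conjunct1[OF I]
    proof eventually_elim
      case (elim z)
      then show ?case using M[OF elim(1)] by (meson less_le_trans zero_less_norm_iff)
    qed
    then have Mpos: "M > 0" by simp
    let ?C = "B + ln (2 + 2 * R) + ln 2"
    have "ln (poly_l1_norm Q) - ?C * real (degree Q) \<le> (\<integral>z. ln (cmod (poly Q z)) \<partial>\<nu>)"
      using I by blast
    also have "\<dots> \<le> (\<integral>z. ln M \<partial>\<nu>)"
    proof (rule integral_mono_AE)
      show "AE z in \<nu>. ln (cmod (poly Q z)) \<le> ln M"
        using K(1) conjunct1[OF I] by eventually_elim (use M in \<open>auto intro!: ln_mono\<close>)
    qed (use I in auto)
    also have "\<dots> = ln M" by (simp add: prob_space)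
    finally have "poly_l1_norm Q \<le> exp (ln M + ?C * real (degree Q))"
      using poly_l1_norm_pos[OF False] by (metis add.commute diff_le_eq exp_le_cancel_iff exp_ln)
    also have "\<dots> = M * exp ?C ^ degree Q"
      using Mpos by (simp only: exp_add exp_ln exp_of_nat2_mult)
    finally show ?thesis .
  qed
qed

end

text \<open>The constant \<open>D\<close> does not depend on the polynomial, so that the inequality can be applied to all
  members of a family at once.\<close>

lemma bernstein_inequality_positive_capacity:
  fixes C :: "nat \<Rightarrow> complex set"
  assumes "log_capacity S > 0" "S \<subseteq> (\<Union>N. C N)" "\<And>N. closed (C N)"
  obtains N D where "1 \<le> D" "\<And>Q M. (\<And>z. z \<in> C N \<Longrightarrow> cmod (poly Q z) \<le> M) \<Longrightarrow>
    poly_l1_norm Q \<le> M * D ^ degree Q"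
proof -
  obtain N \<nu> K B where *: "prob_space \<nu>" "sets \<nu> = sets borel" "compact K" "K \<subseteq> C N" "AE z in \<nu>. z \<in> K"
    "0 \<le> B" "\<And>\<zeta>. (\<integral>\<^sup>+ z. log_kernel_pos \<zeta> z \<partial>\<nu>) \<le> ennreal B"
    using bounded_potential_measure[OF assms] by metis
  obtain R where R: "0 < R" "\<And>z. z \<in> K \<Longrightarrow> cmod z \<le> R"
    using compact_imp_bounded[OF *(3)] unfolding bounded_pos by blast
  have "poly_l1_norm Q \<le> M * exp (B + ln (2 + 2 * R) + ln 2) ^ degree Q"
    if "\<And>z. z \<in> C N \<Longrightarrow> cmod (poly Q z) \<le> M" for Q M
    by (rule poly_l1_norm_le[OF *(1,2,5) R(2) _ *(6,7)]) (use R that *(4) in auto)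
  moreover have "1 \<le> exp (B + ln (2 + 2 * R) + ln 2)" using *(6) R by simp
  ultimately show ?thesis using that by blast
qed

section \<open>Monotonicity and positivity of capacities\<close>

lemma log_capacity_mono: "S \<subseteq> T \<Longrightarrow> log_capacity S \<le> log_capacity T"
  unfolding log_capacity_def by (rule SUP_subset_mono) auto

text \<open>The number of integers \<open>j \<ge> 0\<close> with \<open>j < u\<close> is at least \<open>u\<close>, here for
  \<open>u = - ln (dist z w)\<close>. Integrating in \<open>w\<close> turns the bound into the sum of the masses of discs of radius
  \<open>exp (- j)\<close>.\<close>

lemma log_kernel_pos_le_suminf:
  "log_kernel_pos z w \<le> (\<Sum>j. indicator {x. dist z x < exp (- real j)} w)"
proof (cases "z = w")
  case True
  then have "(\<Sum>j. indicator {x. dist z x < exp (- real j)} w :: ennreal) = (\<Sum>j::nat. 1)" by simp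
  also have "\<dots> = \<infinity>"
  proof (rule ccontr)
    assume "(\<Sum>j::nat. 1 :: ennreal) \<noteq> \<infinity>"
    then obtain n where n: "(\<Sum>j::nat. 1 :: ennreal) < of_nat n"
      using ennreal_Ex_less_of_nat by (auto simp: top.not_eq_extremum)
    have "(\<Sum>j<n. 1 :: ennreal) \<le> (\<Sum>j::nat. 1)" by (rule sum_le_suminf) auto
    with n show False by simp
  qed
  finally show ?thesis by simp
next
  case False
  define u where "u = - ln (dist z w)"
  have "ennreal u \<le> ennreal (real (nat \<lceil>u\<rceil>))" by (intro ennreal_leI) linarith
  also have "\<dots> = (\<Sum>j<nat \<lceil>u\<rceil>. 1)" by (simp add: ennreal_of_nat_eq_real_of_nat)
  also have "\<dots> = (\<Sum>j<nat \<lceil>u\<rceil>. indicator {x. dist z x < exp (- real j)} w)"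
  proof (rule sum.cong)
    fix j assume "j \<in> {..<nat \<lceil>u\<rceil>}"
    then have "real j < u" by (simp add: less_ceiling_iff zless_nat_eq_int_zless)
    then have "exp (- u) < exp (- real j)" by simp
    then show "1 = indicator {x. dist z x < exp (- real j)} w" using False by (simp add: u_def)
  qed simp
  also have "\<dots> \<le> (\<Sum>j. indicator {x. dist z x < exp (- real j)} w)"
    by (rule sum_le_suminf) auto
  finally show ?thesis using False by (simp add: log_kernel_pos_eq u_def)
qed

text \<open>The uniform distribution on the unit interval has finite energy.\<close>

lemma log_capacity_UNIV_pos: "log_capacity UNIV > 0"
proof -
  define M where "M = uniform_measure lborel {0..1::real}"
  define \<mu> where "\<mu> = distr M borel complex_of_real"
  have [measurable_cong, simp]: "sets M = sets borel" by (simp add: M_def)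
  interpret M: prob_space M unfolding M_def by (rule prob_space_uniform_measure) auto
  have M_le: "(\<integral>\<^sup>+ x. f x \<partial>M) \<le> (\<integral>\<^sup>+ x. f x \<partial>lborel)" if [measurable]: "f \<in> borel_measurable borel" for f
  proof -
    have "(\<integral>\<^sup>+ x. f x \<partial>M) = (\<integral>\<^sup>+ x. f x * indicator {0..1} x \<partial>lborel) / emeasure lborel {0..1::real}"
      unfolding M_def by (rule nn_integral_uniform_measure) auto
    also have "\<dots> \<le> (\<integral>\<^sup>+ x. f x \<partial>lborel)"
      by (simp add: divide_ennreal_def) (intro nn_integral_mono, auto split: split_indicator)
    finally show ?thesis .
  qed
  have [measurable]: "complex_of_real \<in> borel_measurable borel"
    by (intro borel_measurable_continuous_onI continuous_intros)
  have prob: "prob_space \<mu>" unfolding \<mu>_def by (rule M.prob_space_distr) simp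
  have [simp]: "sets \<mu> = sets borel" by (simp add: \<mu>_def)
  define K where "K = complex_of_real ` {0..1}"
  have K: "compact K" unfolding K_def by (intro compact_continuous_image continuous_intros) simp
  have "emeasure \<mu> K = emeasure M (complex_of_real -` K \<inter> space M)"
    unfolding \<mu>_def using K by (intro emeasure_distr) (auto simp: borel_compact)
  also have "complex_of_real -` K \<inter> space M = {0..1}"
    by (auto simp: K_def M_def)
  also have "emeasure M {0..1} = 1" by (simp add: M_def)
  finally have \<mu>K: "emeasure \<mu> K = 1" .
  define c where "c = (\<Sum>j. ennreal (2 * exp (- real j)))"
  have c: "c < \<infinity>"
  proof -
    have "summable (\<lambda>j::nat. 2 * exp (-1) ^ j :: real)" by (intro summable_mult summable_geometric) simp
    then have "summable (\<lambda>j::nat. 2 * exp (- real j))" by (simp add: exp_of_nat_mult[symmetric])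
    then show ?thesis unfolding c_def by (simp add: suminf_ennreal2)
  qed
  have meas [measurable]: "log_kernel_pos \<xi> \<in> borel_measurable borel" for \<xi>
    using measurable_compose_Pair1[OF _ log_kernel_pos_measurable, of \<xi>] by simp
  have inner: "(\<integral>\<^sup>+ w. log_kernel_pos (complex_of_real x) w \<partial>\<mu>) \<le> c" for x
  proof -
    have "(\<integral>\<^sup>+ w. log_kernel_pos (complex_of_real x) w \<partial>\<mu>)
        = (\<integral>\<^sup>+ y. log_kernel_pos (complex_of_real x) (complex_of_real y) \<partial>M)"
      unfolding \<mu>_def by (rule nn_integral_distr) auto
    also have "\<dots> \<le> (\<integral>\<^sup>+ y. log_kernel_pos (complex_of_real x) (complex_of_real y) \<partial>lborel)"
      by (rule M_le) measurable
    also have "\<dots> \<le> (\<integral>\<^sup>+ y. (\<Sum>j. indicator {x - exp (- real j)<..<x + exp (- real j)} y) \<partial>lborel)"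
    proof (rule nn_integral_mono)
      fix y :: real
      have "indicator {z. dist (complex_of_real x) z < e} (complex_of_real y)
          = (indicator {x - e<..<x + e} y :: ennreal)" for e
        by (auto simp: dist_norm abs_less_iff simp flip: of_real_diff split: split_indicator)
      then show "log_kernel_pos (complex_of_real x) (complex_of_real y)
          \<le> (\<Sum>j. indicator {x - exp (- real j)<..<x + exp (- real j)} y)"
        using log_kernel_pos_le_suminf[of "complex_of_real x" "complex_of_real y"] by simp
    qed
    also have "\<dots> = (\<Sum>j. \<integral>\<^sup>+ y. indicator {x - exp (- real j)<..<x + exp (- real j)} y \<partial>lborel)"
      by (rule nn_integral_suminf) auto
    also have "\<dots> = c"
      by (simp add: c_def)
    finally show ?thesis .
  qed
  have "(\<integral>\<^sup>+ z. \<integral>\<^sup>+ w. log_kernel_pos z w \<partial>\<mu> \<partial>\<mu>) = (\<integral>\<^sup>+ x. \<integral>\<^sup>+ w. log_kernel_pos (complex_of_real x) w \<partial>\<mu> \<partial>M)"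
  proof -
    have "prob_space \<mu>" by fact
    then interpret \<mu>: prob_space \<mu> .
    have "(\<lambda>z. \<integral>\<^sup>+ w. log_kernel_pos (fst (z, w)) (snd (z, w)) \<partial>\<mu>) \<in> borel_measurable borel"
      by (rule \<mu>.borel_measurable_nn_integral_fst[OF log_kernel_pos_measurable']) auto
    then show ?thesis unfolding \<mu>_def by (subst nn_integral_distr) auto
  qed
  also have "\<dots> \<le> (\<integral>\<^sup>+ x. c \<partial>M)" by (intro nn_integral_mono inner)
  also have "\<dots> < \<infinity>" using c by (simp add: M.emeasure_space_1)
  finally have "log_energy \<mu> \<noteq> \<infinity>"
    unfolding log_energy_def
    by (cases "\<integral>\<^sup>+ z. \<integral>\<^sup>+ w. log_kernel_pos z w \<partial>\<mu> \<partial>\<mu>"; cases "\<integral>\<^sup>+ z. \<integral>\<^sup>+ w. e2ennreal (- log_kernel z w) \<partial>\<mu> \<partial>\<mu>") auto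
  then have "0 < (if log_energy \<mu> = \<infinity> then 0 else ennreal (exp (- real_of_ereal (log_energy \<mu>))))" by simp
  also have "\<dots> \<le> log_capacity UNIV"
    unfolding log_capacity_def by (rule SUP_upper) (use prob K \<mu>K in auto)
  finally show ?thesis .
qed

lemma Gamma_slice_mono: "E \<subseteq> F \<Longrightarrow> Gamma_slice k E \<subseteq> Gamma_slice k F"
proof
  fix z assume EF: "E \<subseteq> F" and z: "z \<in> Gamma_slice k E"
  have "log_capacity {w. z(k := w) \<in> E} \<le> log_capacity {w. z(k := w) \<in> F}"
    by (rule log_capacity_mono) (use EF in auto)
  then show "z \<in> Gamma_slice k F" using z by (auto simp: Gamma_slice_def)
qed

lemma Gamma_one_mono: "E \<subseteq> F \<Longrightarrow> Gamma_one k E \<subseteq> Gamma_one k F"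
proof (induction k E arbitrary: F rule: Gamma_one.induct)
  case (3 k E)
  then show ?case using Gamma_slice_mono[OF 3(2), of "Suc k"] by simp
qed auto

lemma cspace_fun_upd: "z \<in> cspace (enat k) \<Longrightarrow> z(k := w) \<in> cspace (enat (Suc k))"
  by (auto simp: cspace_def)

lemma Gamma_one_cspace: "Gamma_one (Suc k) (cspace (enat (Suc k))) = UNIV"
proof (induction k)
  case 0
  have "(\<lambda>_. 0) \<in> cspace (enat 0)" by (simp add: cspace_def)
  then show ?case using cspace_fun_upd[of "\<lambda>_. 0" 0] by auto
next
  case (Suc k)
  have "Gamma_slice (Suc k) (cspace (enat (Suc (Suc k)))) = cspace (enat (Suc k))"
    by (auto simp: Gamma_slice_def cspace_fun_upd log_capacity_UNIV_pos)
  then show ?case using Suc by simp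
qed

lemma Gamma_capacity_cspace:
  assumes "k \<ge> 1"
  shows "Gamma_capacity k (cspace (enat k)) > 0"
proof -
  let ?I = "\<lambda>i j :: nat. if i = j then 1 else 0 :: complex"
  have I: "apply_matrix k ?I t = t" if "t \<in> cspace (enat k)" for t
    using that by (auto simp: apply_matrix_def cspace_def fun_eq_iff if_distrib[of "\<lambda>x. x * _"] cong: if_cong)
  then have "apply_matrix k ?I ` cspace (enat k) = cspace (enat k)" by (auto simp: image_iff)
  moreover obtain k' where "k = Suc k'" using assms by (metis not_one_le_zero old.nat.exhaust)
  ultimately have "0 < log_capacity (Gamma_one k (apply_matrix k ?I ` cspace (enat k)))"
    using Gamma_one_cspace[of k'] log_capacity_UNIV_pos by simp
  also have "\<dots> \<le> Gamma_capacity k (cspace (enat k))"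
    unfolding Gamma_capacity_def
    by (rule SUP_upper) (auto simp: unitary_matrix_def if_distrib[of "\<lambda>x. x * _"] if_distrib[of cnj] cong: if_cong)
  finally show ?thesis .
qed

section \<open>Propagation of geometric bounds through slices\<close>

text \<open>The variable with index \<open>k\<close> is the one that \<open>Gamma_slice k\<close> eliminates.\<close>

lemma polyfun_last_variable:
  "polyfun (Suc k) d p \<Longrightarrow> \<exists>Q :: (nat \<Rightarrow> complex) \<Rightarrow> complex poly. \<forall>t. degree (Q t) \<le> d \<and>
    (\<forall>w. p (t(k := w)) = poly (Q t) w) \<and> (\<forall>j. polyfun k d (\<lambda>t. coeff (Q t) j))"
proof (induction rule: polyfun.induct)
  case (polyfun_const d c)
  show ?case by (rule exI[of _ "\<lambda>t. [:c:]"]) (auto intro: polyfun.polyfun_const)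
next
  case (polyfun_var j)
  show ?case
  proof (cases "j = k")
    case True
    then show ?thesis by (intro exI[of _ "\<lambda>t. [:0, 1:]"]) (auto intro: polyfun.polyfun_const)
  next
    case False
    have "polyfun k 1 (\<lambda>t. coeff [:t j:] i)" for i
      by (cases i) (use polyfun_var False in \<open>auto intro!: polyfun.polyfun_const polyfun.polyfun_var\<close>)
    then show ?thesis using False by (intro exI[of _ "\<lambda>t. [:t j:]"]) auto
  qed
next
  case (polyfun_add d p q)
  then obtain P Q :: "(nat \<Rightarrow> complex) \<Rightarrow> complex poly" where PQ:
    "\<And>t. degree (P t) \<le> d" "\<And>t w. p (t(k := w)) = poly (P t) w" "\<And>j. polyfun k d (\<lambda>t. coeff (P t) j)"
    "\<And>t. degree (Q t) \<le> d" "\<And>t w. q (t(k := w)) = poly (Q t) w" "\<And>j. polyfun k d (\<lambda>t. coeff (Q t) j)"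
    by blast
  have "polyfun k d (\<lambda>t. coeff (P t + Q t) j)" for j
    unfolding coeff_add by (intro polyfun.polyfun_add PQ)
  then show ?case
    by (intro exI[of _ "\<lambda>t. P t + Q t"] allI conjI degree_add_le PQ)
      (simp_all only: PQ(2,5) poly_add)
next
  case (polyfun_mult d p e q)
  then obtain P Q :: "(nat \<Rightarrow> complex) \<Rightarrow> complex poly" where PQ:
    "\<And>t. degree (P t) \<le> d" "\<And>t w. p (t(k := w)) = poly (P t) w" "\<And>j. polyfun k d (\<lambda>t. coeff (P t) j)"
    "\<And>t. degree (Q t) \<le> e" "\<And>t w. q (t(k := w)) = poly (Q t) w" "\<And>j. polyfun k e (\<lambda>t. coeff (Q t) j)"
    by blast
  have "degree (P t * Q t) \<le> d + e" for t
    using degree_mult_le[of "P t" "Q t"] PQ(1,4)[of t] by linarith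
  moreover have "polyfun k (d + e) (\<lambda>t. coeff (P t * Q t) j)" for j
    unfolding coeff_mult by (intro polyfun_sum polyfun.polyfun_mult PQ)
  ultimately show ?case
    by (intro exI[of _ "\<lambda>t. P t * Q t"] allI conjI) (simp_all only: PQ(2,5) poly_mult)
qed

lemma polyfun_apply_matrix: "polyfun k d p \<Longrightarrow> polyfun k d (\<lambda>t. p (apply_matrix k V t))"
proof (induction rule: polyfun.induct)
  case (polyfun_var j)
  then show ?case
    by (auto simp: apply_matrix_def intro!: polyfun_sum polyfun_cmult polyfun.polyfun_var)
qed (auto intro: polyfun.intros)

text \<open>In a pair \<open>(d, p)\<close> of the family \<open>F\<close>, \<open>p\<close> is a coefficient of order \<open>d\<close> of a power series that
  depends on parameters; the locus is the set of parameters where the coefficients grow at most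
  geometrically.\<close>

definition geometric_locus :: "(nat \<times> ((nat \<Rightarrow> complex) \<Rightarrow> complex)) set \<Rightarrow> (nat \<Rightarrow> complex) set" where
  "geometric_locus F = {t. \<exists>N::nat. \<forall>(d, p)\<in>F. cmod (p t) \<le> real N ^ d}"

lemma poly_cmod_le:
  assumes "degree Q \<le> m" "\<And>j. cmod (coeff Q j) \<le> B"
  shows "cmod (poly Q w) \<le> B * (2 * max 1 (cmod w)) ^ m"
proof -
  let ?W = "max 1 (cmod w)"
  have B: "0 \<le> B" using assms(2)[of 0] norm_ge_zero order.trans by blast
  have "cmod (poly Q w) \<le> (\<Sum>i\<le>degree Q. cmod (coeff Q i * w ^ i))"
    unfolding poly_altdef by (rule norm_sum)
  also have "\<dots> \<le> (\<Sum>i\<le>degree Q. B * ?W ^ m)"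
  proof (rule sum_mono)
    fix i assume i: "i \<in> {..degree Q}"
    have "cmod w ^ i \<le> ?W ^ i" by (rule power_mono) auto
    also have "\<dots> \<le> ?W ^ m" using i assms(1) by (intro power_increasing) auto
    finally show "cmod (coeff Q i * w ^ i) \<le> B * ?W ^ m"
      using assms(2)[of i] B by (simp add: norm_mult norm_power mult_mono)
  qed
  also have "\<dots> = real (Suc (degree Q)) * (B * ?W ^ m)" by simp
  also have "\<dots> \<le> 2 ^ m * (B * ?W ^ m)"
  proof (rule mult_right_mono)
    have "Suc (degree Q) \<le> 2 ^ degree Q" by (simp add: Suc_leI)
    also have "\<dots> \<le> 2 ^ m" using assms(1) by (rule power_increasing) simp
    finally show "real (Suc (degree Q)) \<le> 2 ^ m" by (metis of_nat_le_iff of_nat_numeral of_nat_power)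
  qed (use B in auto)
  finally show ?thesis by (simp add: power_mult_distrib mult_ac)
qed

text \<open>The locus is the union of the closed sets \<open>C N\<close> on which the bounds hold with a given \<open>N\<close>. The
  Bernstein inequality on one of them costs a factor \<open>E ^ (D * d)\<close>, which a larger \<open>N\<close> absorbs.\<close>

lemma univariate_propagation:
  fixes F :: "(nat \<times> 'b) set" and Q :: "nat \<Rightarrow> 'b \<Rightarrow> complex poly"
  assumes deg: "\<And>d p. (d, p) \<in> F \<Longrightarrow> degree (Q d p) \<le> D * d"
    and cap: "log_capacity {w. \<exists>N::nat. \<forall>(d, p)\<in>F. cmod (poly (Q d p) w) \<le> real N ^ d} > 0"
  obtains N :: nat where "\<And>d p j. (d, p) \<in> F \<Longrightarrow> cmod (coeff (Q d p) j) \<le> real N ^ d"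
proof -
  define C where "C N = {w. \<forall>(d, p)\<in>F. cmod (poly (Q d p) w) \<le> real N ^ d}" for N :: nat
  have C: "C N = (\<Inter>x\<in>F. {w. cmod (poly (Q (fst x) (snd x)) w) \<le> real N ^ fst x})" for N
    by (auto simp: C_def case_prod_unfold)
  have "closed {w. cmod (poly q w) \<le> M}" for q and M :: real
    by (intro closed_Collect_le continuous_intros)
  then have closed: "closed (C N)" for N unfolding C by (intro closed_INT) auto
  have sub: "{w. \<exists>N::nat. \<forall>(d, p)\<in>F. cmod (poly (Q d p) w) \<le> real N ^ d} \<subseteq> (\<Union>N. C N)"
    by (auto simp: C_def)
  obtain N E where E: "1 \<le> E" "\<And>q M. (\<And>z. z \<in> C N \<Longrightarrow> cmod (poly q z) \<le> M) \<Longrightarrow>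
    poly_l1_norm q \<le> M * E ^ degree q"
    by (rule bernstein_inequality_positive_capacity[OF cap sub closed]) blast
  define N' where "N' = nat \<lceil>real N * E ^ D\<rceil>"
  have "cmod (coeff (Q d p) j) \<le> real N' ^ d" if dp: "(d, p) \<in> F" for d p j
  proof -
    have "cmod (coeff (Q d p) j) \<le> poly_l1_norm (Q d p)" by (rule coeff_le_poly_l1_norm)
    also have "\<dots> \<le> real N ^ d * E ^ degree (Q d p)"
      by (rule E(2)) (use dp in \<open>auto simp: C_def\<close>)
    also have "\<dots> \<le> real N ^ d * E ^ (D * d)"
      using E(1) deg[OF dp] by (intro mult_left_mono power_increasing) auto
    also have "\<dots> = (real N * E ^ D) ^ d" by (simp add: power_mult_distrib power_mult)
    also have "\<dots> \<le> real N' ^ d" using E(1) by (intro power_mono) (auto simp: N'_def)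
    finally show ?thesis .
  qed
  then show ?thesis by (rule that)
qed

lemma polyfun_family_last_variable:
  assumes "\<And>d p. (d, p) \<in> F \<Longrightarrow> polyfun (Suc k) (D * d) p"
  shows "\<exists>Q :: nat \<Rightarrow> ((nat \<Rightarrow> complex) \<Rightarrow> complex) \<Rightarrow> (nat \<Rightarrow> complex) \<Rightarrow> complex poly.
    \<forall>(d, p)\<in>F. \<forall>t. degree (Q d p t) \<le> D * d \<and> (\<forall>w. p (t(k := w)) = poly (Q d p t) w) \<and>
      (\<forall>j. polyfun k (D * d) (\<lambda>t. coeff (Q d p t) j))"
proof -
  define Q where "Q d p = (SOME Q :: (nat \<Rightarrow> complex) \<Rightarrow> complex poly. \<forall>t. degree (Q t) \<le> D * d \<and>
    (\<forall>w. p (t(k := w)) = poly (Q t) w) \<and> (\<forall>j. polyfun k (D * d) (\<lambda>t. coeff (Q t) j)))" for d p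
  have "\<forall>t. degree (Q d p t) \<le> D * d \<and> (\<forall>w. p (t(k := w)) = poly (Q d p t) w) \<and>
      (\<forall>j. polyfun k (D * d) (\<lambda>t. coeff (Q d p t) j))" if "(d, p) \<in> F" for d p
    unfolding Q_def by (rule someI_ex[OF polyfun_last_variable[OF assms[OF that]]])
  then show ?thesis by (intro exI[of _ Q]) blast
qed

lemma coefficients_bound_imp_geometric_locus:
  assumes deg: "\<And>d p. (d, p) \<in> F \<Longrightarrow> degree (Q d p) \<le> D * d \<and> p t = poly (Q d p) w"
    and N: "\<And>d p j. (d, p) \<in> F \<Longrightarrow> cmod (coeff (Q d p) j) \<le> real N ^ d"
  shows "t \<in> geometric_locus F"
proof -
  define N' where "N' = nat \<lceil>real N * (2 * max 1 (cmod w)) ^ D\<rceil>"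
  have "cmod (p t) \<le> real N' ^ d" if dp: "(d, p) \<in> F" for d p
  proof -
    have "cmod (p t) \<le> real N ^ d * (2 * max 1 (cmod w)) ^ (D * d)"
      using deg[OF dp] poly_cmod_le[of "Q d p" "D * d" "real N ^ d" w] N[OF dp] by simp
    also have "\<dots> = (real N * (2 * max 1 (cmod w)) ^ D) ^ d" by (simp add: power_mult_distrib power_mult)
    also have "\<dots> \<le> real N' ^ d" by (intro power_mono) (auto simp: N'_def)
    finally show ?thesis .
  qed
  then show ?thesis by (auto simp: geometric_locus_def)
qed

text \<open>\<open>F'\<close> consists of the coefficients of the members of \<open>F\<close>, seen as polynomials in the last variable.
  They form a family of the same kind in one variable less, so that the step can be repeated.\<close>

lemma geometric_locus_slice:
  assumes F: "\<And>d p. (d, p) \<in> F \<Longrightarrow> polyfun (Suc k) (D * d) p"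
  obtains F' where "\<And>d q. (d, q) \<in> F' \<Longrightarrow> polyfun k (D * d) q"
    "\<And>z. log_capacity {w. z(k := w) \<in> geometric_locus F} > 0 \<Longrightarrow> z \<in> geometric_locus F'"
    "\<And>z w. z \<in> geometric_locus F' \<Longrightarrow> z(k := w) \<in> geometric_locus F"
proof -
  obtain Q where "\<forall>(d, p)\<in>F. \<forall>t. degree (Q d p t) \<le> D * d \<and>
      (\<forall>w. p (t(k := w)) = poly (Q d p t) w) \<and> (\<forall>j. polyfun k (D * d) (\<lambda>t. coeff (Q d p t) j))"
    using polyfun_family_last_variable[of F k D] F by auto
  then have Q: "\<And>d p t. (d, p) \<in> F \<Longrightarrow> degree (Q d p t) \<le> D * d"
    "\<And>d p t w. (d, p) \<in> F \<Longrightarrow> p (t(k := w)) = poly (Q d p t) w"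
    "\<And>d p j. (d, p) \<in> F \<Longrightarrow> polyfun k (D * d) (\<lambda>t. coeff (Q d p t) j)"
    by blast+
  define F' where "F' = {(d, \<lambda>t. coeff (Q d p t) j) | d p j. (d, p) \<in> F}"
  show ?thesis
  proof (rule that[of F'])
    show "polyfun k (D * d) q" if "(d, q) \<in> F'" for d q
      using that Q(3) by (auto simp: F'_def)
  next
    fix z assume cap: "log_capacity {w. z(k := w) \<in> geometric_locus F} > 0"
    have "{w. z(k := w) \<in> geometric_locus F}
        \<subseteq> {w. \<exists>N::nat. \<forall>(d, p)\<in>F. cmod (poly (Q d p z) w) \<le> real N ^ d}"
      using Q(2)[symmetric, of _ _ z] by (auto simp: geometric_locus_def case_prod_unfold)
    then have "log_capacity {w. \<exists>N::nat. \<forall>(d, p)\<in>F. cmod (poly (Q d p z) w) \<le> real N ^ d} > 0"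
      using cap log_capacity_mono less_le_trans by blast
    then obtain N :: nat where N: "\<And>d p j. (d, p) \<in> F \<Longrightarrow> cmod (coeff (Q d p z) j) \<le> real N ^ d"
      using univariate_propagation[of F "\<lambda>d p. Q d p z" D] Q(1) by blast
    then show "z \<in> geometric_locus F'"
      unfolding geometric_locus_def F'_def by (intro CollectI exI[of _ N]) auto
  next
    fix z w assume "z \<in> geometric_locus F'"
    then obtain N :: nat where N: "\<And>d q. (d, q) \<in> F' \<Longrightarrow> cmod (q z) \<le> real N ^ d"
      unfolding geometric_locus_def by blast
    have "cmod (coeff (Q d p z) j) \<le> real N ^ d" if "(d, p) \<in> F" for d p j
      using N[of d "\<lambda>t. coeff (Q d p t) j"] that by (auto simp: F'_def)
    then show "z(k := w) \<in> geometric_locus F"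
      by (intro coefficients_bound_imp_geometric_locus[of F "\<lambda>d p. Q d p z" D "z(k := w)" w N])
        (use Q(1,2) in auto)
  qed
qed

text \<open>By \<open>geometric_locus_slice\<close> the slice operation maps the locus of \<open>F\<close> into the locus of \<open>F'\<close>. This
  inclusion holds point by point, and \<open>Gamma_one\<close> is monotone, so that induction on the number of
  variables applies.\<close>

lemma geometric_locus_propagation:
  assumes "\<And>d p. (d, p) \<in> F \<Longrightarrow> polyfun (Suc k) (D * d) p"
    and "log_capacity (Gamma_one (Suc k) (cspace (enat (Suc k)) \<inter> geometric_locus F)) > 0"
  shows "cspace (enat (Suc k)) \<subseteq> geometric_locus F"
  using assms
proof (induction k arbitrary: F)
  case (0 F)
  let ?z = "\<lambda>_::nat. 0 :: complex"
  obtain F' where F':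
    "\<And>z. log_capacity {w. z(0 := w) \<in> geometric_locus F} > 0 \<Longrightarrow> z \<in> geometric_locus F'"
    "\<And>z w. z \<in> geometric_locus F' \<Longrightarrow> z(0 := w) \<in> geometric_locus F"
    using geometric_locus_slice[of F 0 D] 0(1) by metis
  have "Gamma_one (Suc 0) (cspace (enat (Suc 0)) \<inter> geometric_locus F) \<subseteq> {w. ?z(0 := w) \<in> geometric_locus F}"
    by auto
  then have z: "?z \<in> geometric_locus F'"
    using 0(2) log_capacity_mono less_le_trans by (blast intro: F'(1))
  show ?case
  proof
    fix t assume "t \<in> cspace (enat (Suc 0))"
    then have "t = ?z(0 := t 0)" by (auto simp: cspace_def fun_eq_iff)
    then show "t \<in> geometric_locus F" using F'(2)[OF z, of "t 0"] by simp
  qed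
next
  case (Suc k F)
  obtain F' where F': "\<And>d q. (d, q) \<in> F' \<Longrightarrow> polyfun (Suc k) (D * d) q"
    "\<And>z. log_capacity {w. z(Suc k := w) \<in> geometric_locus F} > 0 \<Longrightarrow> z \<in> geometric_locus F'"
    "\<And>z w. z \<in> geometric_locus F' \<Longrightarrow> z(Suc k := w) \<in> geometric_locus F"
    using geometric_locus_slice[of F "Suc k" D] Suc(2) by metis
  have "Gamma_slice (Suc k) (cspace (enat (Suc (Suc k))) \<inter> geometric_locus F)
      \<subseteq> cspace (enat (Suc k)) \<inter> geometric_locus F'"
  proof
    fix z assume z: "z \<in> Gamma_slice (Suc k) (cspace (enat (Suc (Suc k))) \<inter> geometric_locus F)"
    have "{w. z(Suc k := w) \<in> cspace (enat (Suc (Suc k))) \<inter> geometric_locus F}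
        \<subseteq> {w. z(Suc k := w) \<in> geometric_locus F}" by auto
    then have "log_capacity {w. z(Suc k := w) \<in> geometric_locus F} > 0"
      using z log_capacity_mono less_le_trans unfolding Gamma_slice_def by blast
    then show "z \<in> cspace (enat (Suc k)) \<inter> geometric_locus F'"
      using z F'(2) by (simp add: Gamma_slice_def)
  qed
  then have "Gamma_one (Suc k) (Gamma_slice (Suc k) (cspace (enat (Suc (Suc k))) \<inter> geometric_locus F))
      \<subseteq> Gamma_one (Suc k) (cspace (enat (Suc k)) \<inter> geometric_locus F')"
    by (rule Gamma_one_mono)
  then have "log_capacity (Gamma_one (Suc k) (cspace (enat (Suc k)) \<inter> geometric_locus F')) > 0"
    using Suc(3) log_capacity_mono less_le_trans unfolding Gamma_one.simps by blast
  then have IH: "cspace (enat (Suc k)) \<subseteq> geometric_locus F'"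
    by (intro Suc(1) F'(1))
  show ?case
  proof
    fix t assume t: "t \<in> cspace (enat (Suc (Suc k)))"
    let ?z = "t(Suc k := 0)"
    have "?z i = 0" if "Suc k \<le> i" for i using t that by (cases "i = Suc k") (auto simp: cspace_def)
    then have "?z \<in> cspace (enat (Suc k))" by (simp add: cspace_def)
    then show "t \<in> geometric_locus F" using IH F'(3)[of ?z "t (Suc k)"] by auto
  qed
qed

text \<open>The degree of a polynomial is invariant under the unitary changes of coordinates in the definition of
  the \<open>\<Gamma>\<close>-capacity.\<close>

lemma geometric_locus_Gamma_capacity:
  assumes k: "k \<ge> 1" and F: "\<And>d p. (d, p) \<in> F \<Longrightarrow> polyfun k (D * d) p"
    and cap: "Gamma_capacity k (cspace (enat k) \<inter> geometric_locus F) \<noteq> 0"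
  shows "cspace (enat k) \<subseteq> geometric_locus F"
proof -
  let ?E = "cspace (enat k) \<inter> geometric_locus F"
  have "Gamma_capacity k ?E > 0" using cap by (simp add: not_gr_zero zero_less_iff_neq_zero)
  then obtain U where U: "unitary_matrix k U"
    and capU: "log_capacity (Gamma_one k (apply_matrix k U ` ?E)) > 0"
    unfolding Gamma_capacity_def less_SUP_iff by blast
  define V where "V i j = cnj (U j i)" for i j
  have cs: "apply_matrix k W t \<in> cspace (enat k)" for W t by (simp add: apply_matrix_def cspace_def)
  have VU: "apply_matrix k V (apply_matrix k U t) = t" if t: "t \<in> cspace (enat k)" for t
  proof
    fix i
    show "apply_matrix k V (apply_matrix k U t) i = t i"
    proof (cases "i < k")
      case True
      have "apply_matrix k V (apply_matrix k U t) i = (\<Sum>l<k. \<Sum>j<k. cnj (U l i) * U l j * t j)"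
        using True by (simp add: apply_matrix_def V_def sum_distrib_left mult.assoc)
      also have "\<dots> = (\<Sum>j<k. (\<Sum>l<k. cnj (U l i) * U l j) * t j)"
        by (subst sum.swap) (simp add: sum_distrib_right)
      also have "\<dots> = (\<Sum>j<k. if i = j then t j else 0)"
        using U True by (intro sum.cong) (auto simp: unitary_matrix_def)
      also have "\<dots> = t i" using True by simp
      finally show ?thesis .
    next
      case False
      then show ?thesis using t by (simp add: apply_matrix_def cspace_def)
    qed
  qed
  define F' where "F' = (\<lambda>(d, p). (d, \<lambda>t. p (apply_matrix k V t))) ` F"
  have locus: "t \<in> geometric_locus F' \<longleftrightarrow> apply_matrix k V t \<in> geometric_locus F" for t
    by (auto simp: geometric_locus_def F'_def case_prod_unfold)
  have "apply_matrix k U ` ?E \<subseteq> cspace (enat k) \<inter> geometric_locus F'"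
    by (auto simp: locus VU cs)
  then have "log_capacity (Gamma_one k (cspace (enat k) \<inter> geometric_locus F')) > 0"
    using capU log_capacity_mono[OF Gamma_one_mono] less_le_trans by blast
  moreover obtain k' where k': "k = Suc k'" using k by (metis not_one_le_zero old.nat.exhaust)
  moreover have "polyfun k (D * d) p" if "(d, p) \<in> F'" for d p
    using that F polyfun_apply_matrix by (auto simp: F'_def)
  ultimately have *: "cspace (enat k) \<subseteq> geometric_locus F'"
    using geometric_locus_propagation[of F' k' D] by simp
  show ?thesis
  proof
    fix t assume t: "t \<in> cspace (enat k)"
    have "apply_matrix k U t \<in> geometric_locus F'" using * cs by blast
    then show "t \<in> geometric_locus F" using locus VU[OF t] by simp
  qed
qed

section \<open>Jets of the centralizer\<close>

lemma fm_jet_nth [simp]: "mfps_nth (fm_jet m F $ i) a = (if mi_size a \<le> m then mfps_nth (F $ i) a else 0)"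
  by (simp add: fm_jet_def)

lemma fm_jet_eqI: "fm_order_ge (Suc m) (F - G) \<Longrightarrow> fm_jet m F = fm_jet m G"
  by (rule fmap_eqI) (auto simp: fm_order_ge_def)

lemma commutes_with_iff_coeffs:
  "commutes_with A F \<longleftrightarrow> fm_order_ge 1 F \<and> (\<forall>i b.
     (\<Sum>x\<in>coeffs_of_degree (mi_size b). commutator_functional A (i, b) x * mfps_nth (F $ fst x) (snd x)) = 0)"
proof (cases "fm_order_ge 1 F")
  case True
  have "fm_comp F (fm_linear A) = fm_comp (fm_linear A) F \<longleftrightarrow>
      (\<forall>i b. mfps_nth ((fm_comp F (fm_linear A) - fm_comp (fm_linear A) F) $ i) b = 0)"
    (is "?X = ?Y \<longleftrightarrow> _")
  proof
    assume "\<forall>i b. mfps_nth ((?X - ?Y) $ i) b = 0"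
    then show "?X = ?Y"
      by (intro fmap_eqI) (simp del: fm_comp_nth)
  qed simp
  then show ?thesis
    unfolding commutes_with_def by (simp only: commutator_functional_sum[OF True] True simp_thms)
qed (simp add: commutes_with_def)

text \<open>Composition with a linear map preserves homogeneous degrees, so truncating preserves the
  property of commuting with it.\<close>

lemma commutes_with_jet:
  assumes F: "commutes_with A F"
  shows "commutes_with A (fm_jet m F)"
  unfolding commutes_with_iff_coeffs
proof (intro conjI allI)
  show "fm_order_ge 1 (fm_jet m F)" using F by (simp add: commutes_with_def fm_order_ge_def)
  fix i b
  have "(\<Sum>x\<in>coeffs_of_degree (mi_size b). commutator_functional A (i, b) x * mfps_nth (fm_jet m F $ fst x) (snd x))
    = (if mi_size b \<le> m then (\<Sum>x\<in>coeffs_of_degree (mi_size b). commutator_functional A (i, b) x * mfps_nth (F $ fst x) (snd x)) else 0)"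
    by (auto simp: coeffs_of_degree_def intro!: sum.cong sum.neutral)
  then show "(\<Sum>x\<in>coeffs_of_degree (mi_size b). commutator_functional A (i, b) x * mfps_nth (fm_jet m F $ fst x) (snd x)) = 0"
    using F by (auto simp: commutes_with_iff_coeffs)
qed

lemma Cent_jet:
  assumes k: "k \<in> Cent A"
  shows "fm_id + fm_jet m (k - fm_id) \<in> Cent A"
proof -
  have "commutes_with A (k - fm_id)"
    using k by (auto simp: Cent_iff intro: commutes_with_diff commutes_with_id)
  then have "commutes_with A (fm_jet m (k - fm_id))" by (rule commutes_with_jet)
  moreover have "commutes_with A (0 :: 'a fmap)"
    using commutes_with_diff[OF commutes_with_id commutes_with_id] by simp
  ultimately have "commutes_with A (fm_id - (0 - fm_jet m (k - fm_id)))"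
    by (intro commutes_with_diff commutes_with_id)
  then have "commutes_with A (fm_id + fm_jet m (k - fm_id))" by simp
  moreover have "fm_order_ge 2 (fm_jet m (k - fm_id))"
    using k by (simp add: Cent_iff G_hat0_iff fm_order_ge_def)
  ultimately show ?thesis by (simp add: Cent_iff G_hat0_iff)
qed

definition unit_map :: "'n::finite \<times> (nat ^ 'n) \<Rightarrow> 'n fmap" where
  "unit_map x = (\<chi> i. Abs_mfps (\<lambda>a. if x = (i, a) then 1 else 0))"

lemma jet_in_span_unit_maps:
  "fm_jet m F \<in> fmap.span (unit_map ` (UNIV \<times> {a. mi_size a \<le> m}))"
proof -
  let ?S = "UNIV \<times> {a. mi_size a \<le> m} :: ('a \<times> (nat ^ 'a)) set"
  have "fm_jet m F = (\<Sum>x\<in>?S. fm_scale (mfps_nth (F $ fst x) (snd x)) (unit_map x))"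
  proof (rule fmap_eqI)
    fix i a
    have "(\<Sum>x\<in>?S. mfps_nth (F $ fst x) (snd x) * (if x = (i, a) then 1 else 0))
        = (\<Sum>x\<in>?S. if x = (i, a) then mfps_nth (F $ fst x) (snd x) else 0)"
      by (intro sum.cong) auto
    then show "mfps_nth (fm_jet m F $ i) a
        = mfps_nth ((\<Sum>x\<in>?S. fm_scale (mfps_nth (F $ fst x) (snd x)) (unit_map x)) $ i) a"
      by (simp add: mfps_nth_sum fm_scale_def mfps_nth_const_mult unit_map_def)
  qed
  also have "\<dots> \<in> fmap.span (unit_map ` ?S)"
    by (intro fmap.span_sum fmap.span_scale fmap.span_base) auto
  finally show ?thesis .
qed

text \<open>By \<open>Cent_jet\<close> the space of \<open>m\<close>-jets of the centralizer is contained in the space of its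
  \<open>(m + 1)\<close>-jets.\<close>

lemma cent_dim_jet_mono: "cent_dim_jet A m \<le> cent_dim_jet A (Suc m)"
proof -
  let ?S = "\<lambda>m. (\<lambda>k. fm_jet m (k - fm_id)) ` Cent A"
  have sub: "?S m \<subseteq> ?S (Suc m)"
  proof
    fix F assume "F \<in> ?S m"
    then obtain k where k: "k \<in> Cent A" "F = fm_jet m (k - fm_id)" by auto
    have "F = fm_jet (Suc m) ((fm_id + fm_jet m (k - fm_id)) - fm_id)"
      unfolding k(2) by (rule fmap_eqI) auto
    then show "F \<in> ?S (Suc m)" using Cent_jet[OF k(1), of m] by blast
  qed
  obtain B where B: "B \<subseteq> ?S (Suc m)" "\<not> fmap.dependent B" "?S (Suc m) \<subseteq> fmap.span B" "card B = fmap.dim (?S (Suc m))"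
    using fmap.basis_exists by blast
  have "B \<subseteq> fmap.span (unit_map ` (UNIV \<times> {a. mi_size a \<le> Suc m}))"
    using B(1) jet_in_span_unit_maps by blast
  then have "finite B" by (intro conjunct1[OF fmap.independent_span_bound[OF _ B(2)]]) auto
  then have "fmap.dim (?S m) \<le> card B"
    using sub B(3) by (intro fmap.dim_le_card) auto
  then show ?thesis using B(4) by (simp add: cent_dim_jet_def)
qed

text \<open>The limit of a monotone sequence is its supremum. Thus a vector of \<open>m\<close>-jet coordinates, continued
  by \<open>0\<close>, is an admissible sequence of coordinates of the centralizer.\<close>

lemma cent_dim_jet_le_cent_dim: "enat (cent_dim_jet A m) \<le> cent_dim A"
proof -
  have "incseq (\<lambda>m. enat (cent_dim_jet A m))"
    by (intro incseq_SucI) (simp add: cent_dim_jet_mono)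
  then have "(\<lambda>m. enat (cent_dim_jet A m)) \<longlonglongrightarrow> (SUP m. enat (cent_dim_jet A m))"
    by (rule LIMSEQ_SUP)
  then have "cent_dim A = (SUP m. enat (cent_dim_jet A m))"
    unfolding cent_dim_def by (rule limI)
  then show ?thesis using SUP_upper[of m UNIV "\<lambda>m. enat (cent_dim_jet A m)"] by simp
qed

lemma converging_polynomial_map:
  fixes F :: "'n::finite fmap"
  assumes F: "fm_order_ge 1 F" and m: "\<And>i a. m < mi_size a \<Longrightarrow> mfps_nth (F $ i) a = 0"
  shows "converging F"
proof -
  let ?S = "UNIV \<times> {a. mi_size a \<le> m} :: ('n \<times> (nat ^ 'n)) set"
  define M where "M = 1 + (\<Sum>x\<in>?S. cmod (mfps_nth (F $ fst x) (snd x)))"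
  have M: "1 \<le> M" by (simp add: M_def sum_nonneg)
  have "cmod (mfps_nth (F $ i) a) \<le> M * 1 ^ mi_size a" for i a
  proof (cases "mi_size a \<le> m")
    case True
    then have "cmod (mfps_nth (F $ i) a) \<le> (\<Sum>x\<in>?S. cmod (mfps_nth (F $ fst x) (snd x)))"
      using member_le_sum[of "(i, a)" ?S "\<lambda>x. cmod (mfps_nth (F $ fst x) (snd x))"] by simp
    then show ?thesis by (simp add: M_def)
  qed (use m M in auto)
  then have "geometrically_bounded (M * 1) F" by (intro geometrically_bounded_absorb F M) auto
  then show ?thesis using M by (intro geometrically_bounded_imp_converging[of M]) auto
qed

section \<open>Total convergence or general divergence\<close>

text \<open>Let \<open>k = c0 \<circ> h\<close> be a convergent linearization. The map \<open>q = c \<circ> c0\<^sup>-\<^sup>1\<close> leads from \<open>k\<close> to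
  \<open>c \<circ> h\<close>. Its truncation \<open>p\<close> is a convergent element of the centralizer, and \<open>p \<circ> c0\<close> has the same
  \<open>m\<close>-jet as \<open>c\<close>.\<close>

lemma converging_linearization_with_prescribed_jet:
  assumes f: "fm_order_ge 1 f" and h: "h \<in> formal_linearizations A f" and lin: "linearizable A f"
    and c: "c \<in> Cent A"
  obtains d where "d \<in> Cent A" "fm_jet m d = fm_jet m c" "converging (fm_comp d h)"
proof -
  obtain k where k: "k \<in> formal_linearizations A f" "converging k"
    using lin by (auto simp: linearizable_def)
  have h0: "h \<in> G_hat0" and k0: "k \<in> G_hat0" using h k by (auto simp: formal_linearizations_def)
  define c0 where "c0 = fm_comp k (fm_inv h)"
  have c0: "c0 \<in> Cent A" unfolding c0_def by (rule linearizations_differ_by_Cent[OF f h k(1)])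
  define q where "q = fm_comp c (fm_inv c0)"
  have q: "q \<in> Cent A" unfolding q_def by (intro Cent_comp Cent_inv c c0)
  define p where "p = fm_id + fm_jet m (q - fm_id)"
  have p: "p \<in> Cent A" unfolding p_def by (rule Cent_jet[OF q])
  have G: "c0 \<in> G_hat0" "q \<in> G_hat0" "p \<in> G_hat0" "c \<in> G_hat0"
    using c0 q p c by (auto simp: Cent_iff)
  note o = G_hat0_order[OF h0] G_hat0_order[OF k0] G_hat0_order[OF G(1)] G_hat0_order[OF G(2)]
    G_hat0_order[OF G(3)] G_hat0_order[OF G(4)] G_hat0_order[OF fm_inv_in_G_hat0[OF h0]]
    G_hat0_order[OF fm_inv_in_G_hat0[OF G(1)]]
  have c0h: "fm_comp c0 h = k"
    unfolding c0_def using o by (simp add: fm_comp_assoc fm_comp_inv_left[OF h0])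
  have qc0: "fm_comp q c0 = c"
    unfolding q_def using o by (simp add: fm_comp_assoc fm_comp_inv_left[OF G(1)])
  show ?thesis
  proof (rule that[of "fm_comp p c0"])
    show "fm_comp p c0 \<in> Cent A" by (rule Cent_comp[OF p c0])
    have "fm_order_ge (Suc m) (p - q)" by (auto simp: fm_order_ge_def p_def)
    then have "fm_order_ge (Suc m) (fm_comp (p - q) c0)" using o by (intro fm_order_ge_comp)
    then show "fm_jet m (fm_comp p c0) = fm_jet m c"
      by (intro fm_jet_eqI) (simp add: fm_comp_diff_left qc0)
    have "converging p"
    proof (rule converging_polynomial_map[of _ "max 1 m"])
      fix i and a :: "nat ^ 'a" assume "max 1 m < mi_size a"
      then show "mfps_nth (p $ i) a = 0" by (auto simp: p_def fm_id_def)
    qed (use o in auto)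
    then have "converging (fm_comp p k)" using k(2) o by (intro converging_comp) auto
    moreover have "fm_comp (fm_comp p c0) h = fm_comp p k"
      using o by (simp add: fm_comp_assoc c0h)
    ultimately show "converging (fm_comp (fm_comp p c0) h)" by simp
  qed
qed

lemma first_coords_id: "t \<in> cspace (enat k) \<Longrightarrow> first_coords k t = t"
  by (auto simp: cspace_def first_coords_def fun_eq_iff)

text \<open>\<open>F\<close> is the family of the coefficients of the normalized solutions. The given linearizations are
  polynomial in \<open>t\<close> only on \<open>cspace (enat k)\<close>; reading them at the first \<open>k\<close> coordinates of \<open>t\<close>
  extends them to all sequences.\<close>

lemma linearizable_iff_geometric_locus:
  fixes A :: "complex ^ 'n::finite ^ 'n"
  assumes f: "\<And>t. t \<in> cspace (enat k) \<Longrightarrow> fm_order_ge 1 (f t)"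
    and h: "polynomial_linearizations A k d f h"
  obtains F where "\<And>d' p. (d', p) \<in> F \<Longrightarrow> polyfun k (2 * d * d') p"
    "\<And>t. t \<in> cspace (enat k) \<Longrightarrow> linearizable A (f t) \<longleftrightarrow> t \<in> geometric_locus F"
proof -
  obtain p where p: "\<And>F. fm_order_ge 1 F \<Longrightarrow> commutes_with A (graded_op p F)"
    "\<And>F. commutes_with A F \<Longrightarrow> graded_op p F = F"
    "\<And>m F. fm_degree_norm m (graded_op p F) \<le> fm_degree_norm m F"
    using centralizer_projection[of A] by metis
  have cs: "first_coords k t \<in> cspace (enat k)" for t
    by (simp add: cspace_def first_coords_def)
  define h' where "h' t = h (first_coords k t)" for t
  have lin: "h' t \<in> formal_linearizations A (f (first_coords k t))" for t
    using h cs by (simp add: polynomial_linearizations_def h'_def)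
  then have h0: "h' t \<in> G_hat0" for t by (simp add: formal_linearizations_def)
  have "map_family k (2 * d) h'"
  proof (rule map_familyI_G_hat0[OF h0])
    show "polyfun k (d * mi_size a) (\<lambda>t. mfps_nth (h' t $ i) a)" for i a
      unfolding h'_def
      using h by (intro polynomial_le_imp_polyfun[where p = "\<lambda>t. mfps_nth (h t $ i) a"])
        (simp add: polynomial_linearizations_def)
  qed
  define g where "g t = normalization p (fm_inv (h' t))" for t
  have g: "map_family k (2 * d) g"
    unfolding g_def by (intro map_family_normalization map_family_inv \<open>map_family k (2 * d) h'\<close> h0)
  define F where "F = range (\<lambda>x. (mi_size (snd x), \<lambda>t. mfps_nth (g t $ fst x) (snd x)))"
  show ?thesis
  proof (rule that[of F])
    show "polyfun k (2 * d * d') q" if dq: "(d', q) \<in> F" for d' q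
    proof -
      obtain x where "(d', q) = (mi_size (snd x), \<lambda>t. mfps_nth (g t $ fst x) (snd x))"
        using dq unfolding F_def by blast
      then have x: "d' = mi_size (snd x)" "q = (\<lambda>t. mfps_nth (g t $ fst x) (snd x))"
        by simp_all
      have "2 * d * (mi_size (snd x) - 1) \<le> 2 * d * mi_size (snd x)" by (intro mult_left_mono) auto
      then show ?thesis unfolding x by (rule polyfun_mono[OF map_familyD[OF g]])
    qed
    fix t assume t: "t \<in> cspace (enat k)"
    have "linearizable A (f t) \<longleftrightarrow> converging (g t)"
      unfolding g_def
      by (rule linearizable_iff_normalization_converging[OF p f[OF t]])
        (assumption | rule lin[of t, unfolded first_coords_id[OF t]])+
    also have "\<dots> \<longleftrightarrow> (\<exists>N::nat. geometrically_bounded (real N) (g t))"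
    proof
      assume "converging (g t)"
      then obtain R where R: "1 \<le> R" "geometrically_bounded R (g t)"
        using converging_imp_geometrically_bounded[OF map_family_order[OF g]] by blast
      have "geometrically_bounded (real (nat \<lceil>R\<rceil>)) (g t)"
        by (rule geometrically_bounded_mono[OF R(2)]) (use R(1) in auto)
      then show "\<exists>N::nat. geometrically_bounded (real N) (g t)" by blast
    next
      assume "\<exists>N::nat. geometrically_bounded (real N) (g t)"
      then obtain N :: nat where "geometrically_bounded (real N) (g t)" by blast
      then show "converging (g t)" by (rule geometrically_bounded_imp_converging[OF of_nat_0_le_iff])
    qed
    also have "\<dots> \<longleftrightarrow> t \<in> geometric_locus F"
    proof -
      have "geometrically_bounded (real N) (g t) \<longleftrightarrow> (\<forall>(d', q)\<in>F. cmod (q t) \<le> real N ^ d')" for N :: nat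
        unfolding F_def geometrically_bounded_def by (simp add: split_paired_All)
      then show ?thesis unfolding geometric_locus_def by (simp only: mem_Collect_eq)
    qed
    finally show "linearizable A (f t) \<longleftrightarrow> t \<in> geometric_locus F" .
  qed
qed

theorem theorem4:
  fixes A :: "complex ^ 'n::finite ^ 'n"
    and k d0 :: nat
    and fc :: "(nat \<Rightarrow> nat) \<Rightarrow> 'n fmap"
    and f h \<psi> :: "(nat \<Rightarrow> complex) \<Rightarrow> 'n fmap"
  assumes A: "invertible A" "in_jordan_normal_form A"
    and k: "k \<ge> 1"
    and fc: "\<And>i. i \<in> exponents k d0 \<Longrightarrow> fm_order_ge 2 (fc i)"
    and f: "\<And>t. t \<in> cspace (enat k) \<Longrightarrow>
      f t = fm_linear A + (\<Sum>i\<in>exponents k d0. fm_scale (monomial k i t) (fc i))"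
    and f_conj: "\<And>t. t \<in> cspace (enat k) \<Longrightarrow> f t \<in> G_hat_conj A"
    and psi: "cent_param A \<psi>"
    and h: "polynomial_linearizations A k d0 f h"
  shows
    "((\<forall>t \<in> cspace (enat k). linearizable A (f t)) \<and>
      (\<forall>m\<ge>2. \<forall>t \<in> cspace (enat k). \<forall>s\<^sub>m \<in> cspace (enat (cent_dim_jet A m)).
         \<exists>s \<in> cspace (cent_dim A).
           s\<^sub>m = first_coords (cent_dim_jet A m) s \<and> converging (universal_family \<psi> h t s)))
     \<longleftrightarrow>
     \<not> (\<exists>E \<subseteq> cspace (enat k). Gamma_capacity k E = 0 \<and>
          (\<forall>t \<in> cspace (enat k) - E.
             (\<forall>s \<in> cspace (cent_dim A). diverging (universal_family \<psi> h t s)) \<and>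
             \<not> linearizable A (f t)))"
  (is "?lin \<and> ?jets \<longleftrightarrow> \<not> ?exceptional")
proof
  assume "?lin \<and> ?jets"
  show "\<not> ?exceptional"
  proof
    assume ?exceptional
    then obtain E where E: "E \<subseteq> cspace (enat k)" "Gamma_capacity k E = 0"
      "\<forall>t \<in> cspace (enat k) - E. \<not> linearizable A (f t)" by blast
    then have "E = cspace (enat k)" using \<open>?lin \<and> ?jets\<close> by blast
    then show False using E(2) Gamma_capacity_cspace[OF k] by simp
  qed
next
  assume not_exceptional: "\<not> ?exceptional"
  have order: "fm_order_ge 1 (f t)" if "t \<in> cspace (enat k)" for t
    using G_hat_conj_order[OF f_conj[OF that]] .
  have h_lin: "h t \<in> formal_linearizations A (f t)" if "t \<in> cspace (enat k)" for t
    using h that by (simp add: polynomial_linearizations_def)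
  have psi_Cent: "\<psi> s \<in> Cent A" if "s \<in> cspace (cent_dim A)" for s
    using psi that by (auto simp: cent_param_def bij_betw_def)
  obtain F where F: "\<And>d' p. (d', p) \<in> F \<Longrightarrow> polyfun k (2 * d0 * d') p"
    "\<And>t. t \<in> cspace (enat k) \<Longrightarrow> linearizable A (f t) \<longleftrightarrow> t \<in> geometric_locus F"
    using linearizable_iff_geometric_locus[OF order h] by metis
  let ?E = "cspace (enat k) \<inter> geometric_locus F"
  have "diverging (universal_family \<psi> h t s)"
    if "t \<in> cspace (enat k)" "\<not> linearizable A (f t)" "s \<in> cspace (cent_dim A)" for t s
    using Cent_comp_linearization[OF order[OF that(1)] h_lin[OF that(1)] psi_Cent[OF that(3)]] that(2)
    by (auto simp: linearizable_def universal_family_def)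
  then have "Gamma_capacity k ?E \<noteq> 0"
    using not_exceptional F(2) by blast
  then have "cspace (enat k) \<subseteq> geometric_locus F"
    using geometric_locus_Gamma_capacity[OF k F(1)] by blast
  then have lin: ?lin using F(2) by blast
  moreover have ?jets
  proof (intro allI impI ballI)
    fix m t s\<^sub>m
    assume t: "t \<in> cspace (enat k)" and sm: "s\<^sub>m \<in> cspace (enat (cent_dim_jet A m))"
    have sm': "s\<^sub>m \<in> cspace (cent_dim A)"
      using sm cent_dim_jet_le_cent_dim[of A m] unfolding cspace_def by (blast intro: order.trans)
    obtain d where d: "d \<in> Cent A" "fm_jet m d = fm_jet m (\<psi> s\<^sub>m)" "converging (fm_comp d (h t))"
      using converging_linearization_with_prescribed_jet[OF order[OF t] h_lin[OF t] _ psi_Cent[OF sm']]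
        lin t by blast
    have "d \<in> \<psi> ` cspace (cent_dim A)"
      using d(1) psi by (simp add: cent_param_def bij_betw_def)
    then obtain s where s: "s \<in> cspace (cent_dim A)" "d = \<psi> s" by blast
    have "first_coords (cent_dim_jet A m) s = first_coords (cent_dim_jet A m) s\<^sub>m"
      using psi s(1) sm' d(2) unfolding s(2) cent_param_def by blast
    then have "s\<^sub>m = first_coords (cent_dim_jet A m) s" using first_coords_id[OF sm] by simp
    then show "\<exists>s \<in> cspace (cent_dim A).
        s\<^sub>m = first_coords (cent_dim_jet A m) s \<and> converging (universal_family \<psi> h t s)"
      using s d(3) by (auto simp: universal_family_def)
  qed
  ultimately show "?lin \<and> ?jets" by blast
qed

end
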